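(* (Riccati correspondence.) Every triple $(f,g,h)\in\mathbf{X}$ has a unique solution generator $\Phi(f,g,h)\in\mathbf{Y}$ for the Riccati equation $y'=fy^2+gy+h$, and the resulting map $\Phi:\mathbf{X}\to\mathbf{Y}$ is a bijection. Explicitly, $\Phi(f,g,h)=\varphi_M$, where $M\in\mathbf{M}$ is the unique solution of $$M'=\begin{pmatrix}\frac12 g&h\\-f&-\frac12 g\end{pmatrix}M,\qquad M(0)=I,$$ namely $$M=\begin{pmatrix}e^{\frac12 Pg}C_{F,H}&e^{\frac12 Pg}S_{H,F}\\ e^{-\frac12 Pg}S_{F,H}&e^{-\frac12 Pg}C_{H,F}\end{pmatrix},\qquad F=-e^{Pg}f,\quad H=e^{-Pg}h.$$ Inversely, each $\varphi_M\in\mathbf{Y}$ determines a unique matrix function $M=\begin{pmatrix}a&b\\c&d\end{pmatrix}\in\mathbf{M}$, and $\Phi^{-1}(\varphi_M)=(f,g,h)$ with $$f=cd'-c'd,\qquad g=2(a'd-b'c),\qquad h=ab'-a'b.$$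
   Context: $L^1_{\mathrm{loc}}(\mathbb{R})$ denotes the space of locally integrable complex valued functions on $\mathbb{R}$ (functions equal almost everywhere are identified), $AC_{\mathrm{loc}}(\mathbb{R})$ the locally absolutely continuous complex valued functions, and $AC_{\mathrm{loc}}(\mathbb{R},\mathrm{SL}(2,\mathbb{C}))$ the locally absolutely continuous functions from $\mathbb{R}$ to the group $\mathrm{SL}(2,\mathbb{C})$ of complex $2\times2$ matrices of determinant $1$. $I$ is the $2\times2$ identity matrix, and $Pu(x)=\int_0^x u$ for $u\in L^1_{\mathrm{loc}}(\mathbb{R})$. $\widehat{\mathbb{C}}=\mathbb{C}\cup\{\infty\}$ is the Riemann sphere, $\mathrm{Aut}\,\widehat{\mathbb{C}}$ its automorphism group. For an invertible matrix $N=\begin{pmatrix}a&b\\c&d\end{pmatrix}$, $\varphi_N\in\mathrm{Aut}\,\widehat{\mathbb{C}}$ is $\varphi_N(z)=\frac{az+b}{cz+d}$. For a matrix function $M:\mathbb{R}\to\mathrm{SL}(2,\mathbb{C})$, $\varphi_M:\mathbb{R}\to\mathrm{Aut}\,\widehat{\mathbb{C}}$ is the path $x\mapsto\varphi_{M(x)}$. Define $$\mathbf{X}=L^1_{\mathrm{loc}}(\mathbb{R})^3,\quad \mathbf{M}=\{M\in AC_{\mathrm{loc}}(\mathbb{R},\mathrm{SL}(2,\mathbb{C}))\mid M(0)=I\},\quad \mathbf{Y}=\{\varphi_M:\mathbb{R}\to\mathrm{Aut}\,\widehat{\mathbb{C}}\mid M\in\mathbf{M}\}.$$ A standard solution to the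 Riccati equation $y'=fy^2+gy+h$ is a function $y\in AC_{\mathrm{loc}}(\mathbb{R})$ for which the equation holds almost everywhere. An element $\varphi_M\in\mathbf{Y}$ is a solution generator for the equation if for almost every $y_0\in\mathbb{C}$ the function $y(x)=\varphi_{M(x)}(y_0)$ $(x\in\mathbb{R})$ is a standard solution to the equation. For $u,v\in L^1_{\mathrm{loc}}(\mathbb{R})$ and $j\ge 1$ let $T^{(j)}_{u,v}(s_1,\ldots,s_j)=u(s_1)v(s_2)u(s_3)\cdots$ ($j$ factors, alternating $u$ with $v$, beginning with $u$). Set $A_0(u,v,x)=1$ and, for $j\geq 1$, $$A_j(u,v,x)=\int_{0<s_1<\cdots<s_j<x}T^{(j)}_{u,v}(s_1,\ldots,s_j)\,ds_1\cdots ds_j\quad (x\ge 0),$$ $$A_j(u,v,x)=(-1)^j\int_{x<s_j<\cdots<s_1<0}T^{(j)}_{u,v}(s_1,\ldots,s_j)\,ds_1\cdots ds_j\quad (x\le 0).$$ The bivariate exponential is $E_{u,v}(x)=1+\sum_{j=1}^\infty A_j(u,v,x)$ for $x\in\mathbb{R}$, and $$C_{u,v}=\tfrac12\bigl(E_{u,v}+E_{-u,-v}\bigr),\qquad S_{u,v}=\tfrac12\bigl(E_{u,v}-E_{-u,-v}\bigr).$$ *)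

theory Defs
  imports "HOL-Analysis.Analysis"
begin

section \<open>Function spaces\<close>

text \<open>All measurability and null sets refer to \<^const>\<open>lebesgue\<close> (the completion of
  \<^const>\<open>lborel\<close>), so changing a function on a null set never destroys local integrability.\<close>

definition locally_integrable :: "(real \<Rightarrow> complex) \<Rightarrow> bool" where
  "locally_integrable u \<longleftrightarrow> (\<forall>a b. u absolutely_integrable_on {a..b})"

definition l1loc_rel :: "(real \<Rightarrow> complex) \<Rightarrow> (real \<Rightarrow> complex) \<Rightarrow> bool" where
  "l1loc_rel u v \<longleftrightarrow>
     locally_integrable u \<and> locally_integrable v \<and> (AE x in lebesgue. u x = v x)"

quotient_type l1loc = "real \<Rightarrow> complex" / partial: l1loc_rel
proof (rule part_equivpI)
  have "locally_integrable (\<lambda>x. 0)"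
    by (simp add: locally_integrable_def)
  then show "\<exists>u. l1loc_rel u u"
    by (auto simp: l1loc_rel_def)
  show "symp l1loc_rel"
    by (auto simp: l1loc_rel_def symp_def eq_commute)
  show "transp l1loc_rel"
    unfolding transp_def l1loc_rel_def by (auto elim: eventually_elim2)
qed

text \<open>Absolute continuity on every compact interval.  A finite family of non-overlapping
  compact subintervals of \<open>{a..b}\<close> is a division \<open>D\<close> of its union.\<close>

definition loc_abs_continuous :: "(real \<Rightarrow> 'a::real_normed_vector) \<Rightarrow> bool" where
  "loc_abs_continuous y \<longleftrightarrow>
     (\<forall>a b. \<forall>\<epsilon>>0. \<exists>\<delta>>0. \<forall>D. D division_of \<Union>D \<and> \<Union>D \<subseteq> {a..b} \<and> (\<Sum>K\<in>D. Sup K - Inf K) < \<delta>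
        \<longrightarrow> (\<Sum>K\<in>D. norm (y (Sup K) - y (Inf K))) < \<epsilon>)"

definition prim :: "(real \<Rightarrow> complex) \<Rightarrow> real \<Rightarrow> complex" where
  "prim u x = (LINT t=0..ereal x|lebesgue. u t)"

section \<open>Paths of Moebius transformations\<close>

definition mat2 :: "complex \<Rightarrow> complex \<Rightarrow> complex \<Rightarrow> complex \<Rightarrow> complex^2^2" where
  "mat2 a b c d = vector [vector [a, b], vector [c, d]]"

definition SL2_paths :: "(real \<Rightarrow> complex^2^2) set" where
  "SL2_paths = {M. loc_abs_continuous M \<and> (\<forall>x. det (M x) = 1) \<and> M 0 = mat 1}"

datatype riemann_sphere = Fin complex | Infty

fun sphere_moebius :: "complex^2^2 \<Rightarrow> riemann_sphere \<Rightarrow> riemann_sphere" where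
  "sphere_moebius N (Fin z) =
     (if N$2$1 * z + N$2$2 = 0 then Infty
      else Fin (moebius (N$1$1) (N$1$2) (N$2$1) (N$2$2) z))"
| "sphere_moebius N Infty = (if N$2$1 = 0 then Infty else Fin (N$1$1 / N$2$1))"

definition moebius_path :: "(real \<Rightarrow> complex^2^2) \<Rightarrow> real \<Rightarrow> riemann_sphere \<Rightarrow> riemann_sphere" where
  "moebius_path M = (\<lambda>x. sphere_moebius (M x))"

definition moebius_paths :: "(real \<Rightarrow> riemann_sphere \<Rightarrow> riemann_sphere) set" where
  "moebius_paths = moebius_path ` SL2_paths"

section \<open>The Riccati equation\<close>

definition riccati_solution ::
    "(real \<Rightarrow> complex) \<Rightarrow> (real \<Rightarrow> complex) \<Rightarrow> (real \<Rightarrow> complex) \<Rightarrow> (real \<Rightarrow> complex) \<Rightarrow> bool" where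
  "riccati_solution f g h y \<longleftrightarrow> loc_abs_continuous y \<and>
     (AE x in lebesgue. (y has_vector_derivative f x * (y x)\<^sup>2 + g x * y x + h x) (at x))"

lift_definition standard_solution :: "l1loc \<Rightarrow> l1loc \<Rightarrow> l1loc \<Rightarrow> (real \<Rightarrow> complex) \<Rightarrow> bool"
  is riccati_solution
proof (rule ext)
  fix f f' g g' h h' y :: "real \<Rightarrow> complex"
  assume "l1loc_rel f f'" "l1loc_rel g g'" "l1loc_rel h h'"
  then have "AE x in lebesgue. f x = f' x \<and> g x = g' x \<and> h x = h' x"
    by (simp add: l1loc_rel_def)
  then have "(AE x in lebesgue. (y has_vector_derivative f x * (y x)\<^sup>2 + g x * y x + h x) (at x))
     \<longleftrightarrow> (AE x in lebesgue. (y has_vector_derivative f' x * (y x)\<^sup>2 + g' x * y x + h' x) (at x))"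
    by (intro eventually_subst) (auto elim: eventually_mono)
  then show "riccati_solution f g h y = riccati_solution f' g' h' y"
    by (simp add: riccati_solution_def)
qed

text \<open>Being a standard solution includes that \<open>\<phi> x (Fin y0)\<close> is finite for every \<open>x\<close>.\<close>

definition solution_generator ::
    "l1loc \<times> l1loc \<times> l1loc \<Rightarrow> (real \<Rightarrow> riemann_sphere \<Rightarrow> riemann_sphere) \<Rightarrow> bool" where
  "solution_generator = (\<lambda>(f, g, h) \<phi>. \<phi> \<in> moebius_paths \<and>
     (AE y0 in lebesgue. \<exists>y. (\<forall>x. \<phi> x (Fin y0) = Fin (y x)) \<and> standard_solution f g h y))"

definition riccati_map ::
    "l1loc \<times> l1loc \<times> l1loc \<Rightarrow> (real \<Rightarrow> riemann_sphere \<Rightarrow> riemann_sphere)" where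
  "riccati_map p = (THE \<phi>. solution_generator p \<phi>)"

section \<open>The bivariate exponential\<close>

definition alternating_prod ::
    "(real \<Rightarrow> complex) \<Rightarrow> (real \<Rightarrow> complex) \<Rightarrow> nat \<Rightarrow> (nat \<Rightarrow> real) \<Rightarrow> complex" where
  "alternating_prod u v j s = (\<Prod>i\<in>{1..j}. if odd i then u (s i) else v (s i))"

text \<open>Integration over \<open>\<real>\<^sup>j\<close> is integration over \<open>Pi\<^sub>M {1..j} (\<lambda>_. lebesgue)\<close>.\<close>

definition biexp_term ::
    "(real \<Rightarrow> complex) \<Rightarrow> (real \<Rightarrow> complex) \<Rightarrow> nat \<Rightarrow> real \<Rightarrow> complex" where
  "biexp_term u v j x =
     (if j = 0 then 1
      else if 0 \<le> x then
        (LINT s:{s. strict_mono_on {1..j} s \<and> (\<forall>i\<in>{1..j}. 0 < s i \<and> s i < x)}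
           |Pi\<^sub>M {1..j} (\<lambda>_. lebesgue). alternating_prod u v j s)
      else
        (- 1) ^ j *
        (LINT s:{s. strict_antimono_on {1..j} s \<and> (\<forall>i\<in>{1..j}. x < s i \<and> s i < 0)}
           |Pi\<^sub>M {1..j} (\<lambda>_. lebesgue). alternating_prod u v j s))"

definition biexp :: "(real \<Rightarrow> complex) \<Rightarrow> (real \<Rightarrow> complex) \<Rightarrow> real \<Rightarrow> complex" where
  "biexp u v x = 1 + (\<Sum>j. biexp_term u v (Suc j) x)"

definition bicosh :: "(real \<Rightarrow> complex) \<Rightarrow> (real \<Rightarrow> complex) \<Rightarrow> real \<Rightarrow> complex" where
  "bicosh u v x = (biexp u v x + biexp (\<lambda>t. - u t) (\<lambda>t. - v t) x) / 2"

definition bisinh :: "(real \<Rightarrow> complex) \<Rightarrow> (real \<Rightarrow> complex) \<Rightarrow> real \<Rightarrow> complex" where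
  "bisinh u v x = (biexp u v x - biexp (\<lambda>t. - u t) (\<lambda>t. - v t) x) / 2"

end

theory Submission
  imports Defs
begin

text \<open>A path \<open>M\<close> in \<open>SL(2)\<close> with \<open>M 0 = I\<close> satisfies a linear system \<open>M' = A M\<close> with trace-free
  \<open>A = M' M\<inverse>\<close>, and the entries of \<open>A\<close> are the coefficients \<open>g/2\<close>, \<open>h\<close>, \<open>-f\<close>, \<open>-g/2\<close> of a Riccati
  equation. A quotient of two components of a solution of the system solves that equation. It stays
  finite for almost every initial value, because the excluded initial values lie on the rectifiable
  curve \<open>-d/c\<close>, which has measure zero in the plane. Conversely, three solutions that are distinct at
  every point determine the coefficients, so \<open>\<phi>\<^sub>M\<close> generates solutions of exactly one equation;
  Wronskians show that the linear system has exactly one solution. The even and odd parts of the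
  bivariate exponential solve \<open>C' = v S\<close>, \<open>S' = u C\<close>, which is the linear system after the factor
  \<open>exp(\<plusminus>Pg/2)\<close> has removed the diagonal.

  The real-variable input is Lebesgue's theorem in two forms. That the derivative of an indefinite integral is
  the integrand almost everywhere follows from Henstock's lemma and a Vitali covering. That
  an absolutely continuous function is an indefinite integral follows by writing its real and imaginary parts as
  differences of monotone absolutely continuous functions, whose Stieltjes measures have densities
  by Radon--Nikodym.\<close>

section \<open>Locally absolutely continuous functions\<close>

text \<open>The coefficients are mere classes of integrable functions, so classical existence and
  uniqueness for ODEs does not apply. Existence comes from the explicit series. Uniqueness rests on
  one fact: a locally absolutely continuous function with derivative 0 almost everywhere is
  constant. Lebesgue's theorem supplies it, and also makes the coefficients read off from a path
  locally integrable and the pole curve a Lipschitz image of a subset of the line. The simplex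
  integrals become iterated primitives when the last variable s_j is integrated outermost: it is the
  one nearest to x, and the remaining integral is the same one of order j-1, still beginning with u.
  The parity of j then decides between u and v, whence the coupled equations. F and H arise from the
  substitution n = exp(Pg/2) p, m = exp(-Pg/2) q, which turns the system for (n, m) into p' = H q,
  q' = F p. A transformation at one point gives its matrix only up to sign; continuity and M(0) = I
  fix the sign. Every path also generates solutions for the coefficients of its own linear system,
  so uniqueness of the equation for a path yields uniqueness of the generator for an
  equation.\<close>

lemma division_of_real_interval:
  fixes D :: "real set set"
  assumes "D division_of S" "K \<in> D"
  shows "K = {Inf K..Sup K}" "Inf K \<le> Sup K"
proof -
  obtain c d where K: "K = cbox c d" "K \<noteq> {}"
    using division_ofD(3,4)[OF assms] by blast
  then show "K = {Inf K..Sup K}" "Inf K \<le> Sup K"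
    by auto
qed

lemma loc_abs_continuousE:
  assumes "loc_abs_continuous y" "\<epsilon> > 0"
  obtains \<delta> where "\<delta> > 0"
    "\<And>D. \<lbrakk>D division_of \<Union>D; \<Union>D \<subseteq> {a..b}; (\<Sum>K\<in>D. Sup K - Inf K) < \<delta>\<rbrakk>
        \<Longrightarrow> (\<Sum>K\<in>D. norm (y (Sup K) - y (Inf K))) < \<epsilon>"
proof -
  obtain \<delta> where "\<delta> > 0" "\<forall>D. D division_of \<Union>D \<and> \<Union>D \<subseteq> {a..b} \<and> (\<Sum>K\<in>D. Sup K - Inf K) < \<delta>
        \<longrightarrow> (\<Sum>K\<in>D. norm (y (Sup K) - y (Inf K))) < \<epsilon>"
    using assms(1)[unfolded loc_abs_continuous_def, THEN spec[of _ a], THEN spec[of _ b],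
        THEN spec[of _ \<epsilon>], THEN mp, OF assms(2)] by (elim exE conjE)
  then show thesis by (intro that[of \<delta>]) auto
qed

text \<open>The closure properties below come from this comparison: increments of a sum, product,
  inverse or exponential are bounded by increments of the arguments. The constant may depend on the
  interval, since continuous functions are bounded on compact intervals.\<close>

lemma loc_abs_continuous_dominated:
  fixes w :: "real \<Rightarrow> 'a::real_normed_vector" and y :: "real \<Rightarrow> 'b::real_normed_vector"
    and z :: "real \<Rightarrow> 'c::real_normed_vector"
  assumes dom: "\<And>a b. \<exists>C. \<forall>s\<in>{a..b}. \<forall>t\<in>{a..b}.
      norm (w t - w s) \<le> C * (norm (y t - y s) + norm (z t - z s))"
    and y: "loc_abs_continuous y" and z: "loc_abs_continuous z"
  shows "loc_abs_continuous w"
  unfolding loc_abs_continuous_def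
proof (intro allI impI)
  fix a b \<epsilon> :: real
  assume "\<epsilon> > 0"
  obtain C0 where C0: "\<And>s t. s\<in>{a..b} \<Longrightarrow> t\<in>{a..b} \<Longrightarrow>
      norm (w t - w s) \<le> C0 * (norm (y t - y s) + norm (z t - z s))"
    using dom[of a b] by blast
  \<comment> \<open>\<open>C0\<close> may be zero or negative; a positive majorant is needed to
    divide \<epsilon> by it.\<close>
  define C where "C = \<bar>C0\<bar> + 1"
  have "C > 0" by (simp add: C_def add_nonneg_pos)
  have C: "norm (w t - w s) \<le> C * (norm (y t - y s) + norm (z t - z s))"
    if "s\<in>{a..b}" "t\<in>{a..b}" for s t
  proof -
    have "C0 * (norm (y t - y s) + norm (z t - z s)) \<le> C * (norm (y t - y s) + norm (z t - z s))"
      by (intro mult_right_mono) (auto simp: C_def)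
    with C0[OF that] show ?thesis by linarith
  qed
  have e: "\<epsilon> / (2 * C) > 0" using \<open>\<epsilon> > 0\<close> \<open>C > 0\<close> by simp
  obtain d1 where d1: "d1 > 0" "\<And>D. \<lbrakk>D division_of \<Union>D; \<Union>D \<subseteq> {a..b}; (\<Sum>K\<in>D. Sup K - Inf K) < d1\<rbrakk>
        \<Longrightarrow> (\<Sum>K\<in>D. norm (y (Sup K) - y (Inf K))) < \<epsilon> / (2 * C)"
    by (rule loc_abs_continuousE[OF y e, of a b]) blast
  obtain d2 where d2: "d2 > 0" "\<And>D. \<lbrakk>D division_of \<Union>D; \<Union>D \<subseteq> {a..b}; (\<Sum>K\<in>D. Sup K - Inf K) < d2\<rbrakk>
        \<Longrightarrow> (\<Sum>K\<in>D. norm (z (Sup K) - z (Inf K))) < \<epsilon> / (2 * C)"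
    by (rule loc_abs_continuousE[OF z e, of a b]) blast
  show "\<exists>\<delta>>0. \<forall>D. D division_of \<Union>D \<and> \<Union>D \<subseteq> {a..b} \<and> (\<Sum>K\<in>D. Sup K - Inf K) < \<delta>
        \<longrightarrow> (\<Sum>K\<in>D. norm (w (Sup K) - w (Inf K))) < \<epsilon>"
  proof (intro exI[of _ "min d1 d2"] conjI allI impI)
    fix D :: "real set set"
    assume D: "D division_of \<Union>D \<and> \<Union>D \<subseteq> {a..b} \<and> (\<Sum>K\<in>D. Sup K - Inf K) < min d1 d2"
    have "(\<Sum>K\<in>D. norm (w (Sup K) - w (Inf K)))
        \<le> (\<Sum>K\<in>D. C * (norm (y (Sup K) - y (Inf K)) + norm (z (Sup K) - z (Inf K))))"
    proof (intro sum_mono C)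
      fix K assume "K \<in> D"
      with D have "K = {Inf K..Sup K}" "Inf K \<le> Sup K" "K \<subseteq> {a..b}"
        using division_of_real_interval[of D "\<Union>D" K] by auto
      then show "Inf K \<in> {a..b}" "Sup K \<in> {a..b}"
        by (metis atLeastAtMost_iff order_refl subsetD)+
    qed
    also have "\<dots> = C * ((\<Sum>K\<in>D. norm (y (Sup K) - y (Inf K))) + (\<Sum>K\<in>D. norm (z (Sup K) - z (Inf K))))"
      by (simp add: sum_distrib_left sum.distrib distrib_left)
    also have "\<dots> < C * (\<epsilon> / (2 * C) + \<epsilon> / (2 * C))"
      using D d1 d2 \<open>C > 0\<close> by (intro mult_strict_left_mono add_strict_mono) auto
    also have "\<dots> = \<epsilon>" using \<open>C > 0\<close> by (simp add: field_simps)
    finally show "(\<Sum>K\<in>D. norm (w (Sup K) - w (Inf K))) < \<epsilon>" .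
  qed (use d1 d2 in auto)
qed

lemma loc_abs_continuous_dominated1:
  fixes w :: "real \<Rightarrow> 'a::real_normed_vector" and y :: "real \<Rightarrow> 'b::real_normed_vector"
  assumes dom: "\<And>a b. \<exists>C. \<forall>s\<in>{a..b}. \<forall>t\<in>{a..b}. norm (w t - w s) \<le> C * norm (y t - y s)"
    and y: "loc_abs_continuous y"
  shows "loc_abs_continuous w"
proof (rule loc_abs_continuous_dominated[OF _ y y])
  fix a b :: real
  obtain C where C: "\<forall>s\<in>{a..b}. \<forall>t\<in>{a..b}. norm (w t - w s) \<le> C * norm (y t - y s)"
    using dom by blast
  show "\<exists>C. \<forall>s\<in>{a..b}. \<forall>t\<in>{a..b}. norm (w t - w s) \<le> C * (norm (y t - y s) + norm (y t - y s))"
    by (intro exI[of _ "C/2"]) (use C in auto)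
qed

lemma loc_abs_continuous_const: "loc_abs_continuous (\<lambda>x. c)"
  unfolding loc_abs_continuous_def by (auto intro: exI[of _ 1])

text \<open>A single interval is already an admissible division, so the \<delta> for divisions in
  \<open>{x-1..x+1}\<close> serves for continuity at \<open>x\<close>.\<close>

lemma loc_abs_continuous_imp_continuous:
  assumes "loc_abs_continuous y"
  shows "continuous_on S y"
proof -
  have "isCont y x" for x
    unfolding continuous_at_eps_delta
  proof (intro allI impI)
    fix e :: real assume "e > 0"
    obtain d where d: "d > 0" "\<And>D. \<lbrakk>D division_of \<Union>D; \<Union>D \<subseteq> {x-1..x+1}; (\<Sum>K\<in>D. Sup K - Inf K) < d\<rbrakk>
        \<Longrightarrow> (\<Sum>K\<in>D. norm (y (Sup K) - y (Inf K))) < e"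
      by (rule loc_abs_continuousE[OF assms \<open>e > 0\<close>, of "x-1" "x+1"]) blast
    have *: "norm (y t - y s) < e" if "s \<le> t" "t - s < d" "x - 1 \<le> s" "t \<le> x + 1" for s t
    proof -
      have "{{s..t}} division_of \<Union>{{s..t}}"
        using that(1) division_of_self[of s t] by simp
      from d(2)[OF this] show ?thesis using that by simp
    qed
    show "\<exists>d>0. \<forall>x'. dist x' x < d \<longrightarrow> dist (y x') (y x) < e"
    proof (intro exI[of _ "min d 1"] conjI allI impI)
      fix x' assume "dist x' x < min d 1"
      then show "dist (y x') (y x) < e"
        using *[of x x'] *[of x' x] by (cases "x \<le> x'") (auto simp: dist_norm norm_minus_commute)
    qed (use d in auto)
  qed
  then show ?thesis
    by (simp add: continuous_at_imp_continuous_on)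
qed

lemma loc_abs_continuous_bounded:
  assumes "loc_abs_continuous y"
  obtains B where "B \<ge> 0" "\<And>x. x \<in> {a..b} \<Longrightarrow> norm (y x) \<le> B"
proof -
  have "bounded (y ` {a..b})"
    by (intro compact_imp_bounded compact_continuous_image loc_abs_continuous_imp_continuous assms) auto
  then obtain B where "B > 0" "\<forall>x\<in>y ` {a..b}. norm x \<le> B"
    unfolding bounded_pos by blast
  then show ?thesis
    by (intro that[of B]) auto
qed

lemma loc_abs_continuous_add:
  assumes "loc_abs_continuous y" "loc_abs_continuous z"
  shows "loc_abs_continuous (\<lambda>x. y x + z x)"
proof (rule loc_abs_continuous_dominated[OF _ assms])
  fix a b :: real
  have "norm (y t + z t - (y s + z s)) \<le> 1 * (norm (y t - y s) + norm (z t - z s))" for s t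
    using norm_triangle_ineq[of "y t - y s" "z t - z s"] by (simp add: algebra_simps)
  then show "\<exists>C. \<forall>s\<in>{a..b}. \<forall>t\<in>{a..b}. norm (y t + z t - (y s + z s)) \<le> C * (norm (y t - y s) + norm (z t - z s))"
    by blast
qed

lemma loc_abs_continuous_linear:
  assumes "bounded_linear L" "loc_abs_continuous y"
  shows "loc_abs_continuous (\<lambda>x. L (y x))"
proof (rule loc_abs_continuous_dominated1[OF _ assms(2)])
  fix a b :: real
  interpret bounded_linear L by fact
  obtain K where K: "\<And>x. norm (L x) \<le> norm x * K" using bounded by blast
  have "norm (L (y t) - L (y s)) \<le> K * norm (y t - y s)" for s t
    using K[of "y t - y s"] by (simp add: diff mult.commute)
  then show "\<exists>C. \<forall>s\<in>{a..b}. \<forall>t\<in>{a..b}. norm (L (y t) - L (y s)) \<le> C * norm (y t - y s)"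
    by blast
qed

lemma loc_abs_continuous_diff:
  assumes "loc_abs_continuous y" "loc_abs_continuous z"
  shows "loc_abs_continuous (\<lambda>x. y x - z x)"
  using loc_abs_continuous_add[OF assms(1) loc_abs_continuous_linear[OF bounded_linear_minus[OF bounded_linear_ident] assms(2)]]
  by simp

lemma loc_abs_continuous_bilinear:
  assumes "bounded_bilinear p" and y: "loc_abs_continuous y" and z: "loc_abs_continuous z"
  shows "loc_abs_continuous (\<lambda>x. p (y x) (z x))"
proof (rule loc_abs_continuous_dominated[OF _ y z])
  fix a b :: real
  interpret bounded_bilinear p by fact
  obtain K where K: "K > 0" "\<And>x y. norm (p x y) \<le> norm x * norm y * K"
    using pos_bounded by auto
  obtain B1 where B1: "B1 \<ge> 0" "\<And>x. x \<in> {a..b} \<Longrightarrow> norm (y x) \<le> B1"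
    by (rule loc_abs_continuous_bounded[OF y, of a b]) blast
  obtain B2 where B2: "B2 \<ge> 0" "\<And>x. x \<in> {a..b} \<Longrightarrow> norm (z x) \<le> B2"
    by (rule loc_abs_continuous_bounded[OF z, of a b]) blast
  have "norm (p (y t) (z t) - p (y s) (z s)) \<le> (B1 + B2) * K * (norm (y t - y s) + norm (z t - z s))"
    if "s \<in> {a..b}" "t \<in> {a..b}" for s t
  proof -
    have "p (y t) (z t) - p (y s) (z s) = p (y t) (z t - z s) + p (y t - y s) (z s)"
      by (simp add: diff_left diff_right)
    then have "norm (p (y t) (z t) - p (y s) (z s))
        \<le> norm (y t) * norm (z t - z s) * K + norm (y t - y s) * norm (z s) * K"
      using norm_triangle_ineq K(2) by (smt (verit))
    also have "\<dots> \<le> B1 * norm (z t - z s) * K + norm (y t - y s) * B2 * K"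
      using B1 B2 K that by (intro add_mono mult_right_mono mult_left_mono) auto
    also have "\<dots> \<le> (B1 + B2) * K * (norm (y t - y s) + norm (z t - z s))"
      using B1(1) B2(1) K(1) by (simp add: algebra_simps)
    finally show ?thesis .
  qed
  then show "\<exists>C. \<forall>s\<in>{a..b}. \<forall>t\<in>{a..b}. norm (p (y t) (z t) - p (y s) (z s)) \<le> C * (norm (y t - y s) + norm (z t - z s))"
    by blast
qed

lemmas loc_abs_continuous_mult = loc_abs_continuous_bilinear[OF bounded_bilinear_mult]

lemma loc_abs_continuous_inverse:
  fixes y :: "real \<Rightarrow> 'a::real_normed_field"
  assumes y: "loc_abs_continuous y" and nz: "\<And>x. y x \<noteq> 0"
  shows "loc_abs_continuous (\<lambda>x. inverse (y x))"
proof (rule loc_abs_continuous_dominated1[OF _ y])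
  fix a b :: real
  have "continuous_on {a..b} (\<lambda>x. inverse (y x))"
    using loc_abs_continuous_imp_continuous[OF y] nz by (intro continuous_on_inverse) auto
  then have "bounded ((\<lambda>x. inverse (y x)) ` {a..b})"
    by (intro compact_imp_bounded compact_continuous_image) auto
  then obtain B where B: "B > 0" "\<And>x. x \<in> {a..b} \<Longrightarrow> norm (inverse (y x)) \<le> B"
    unfolding bounded_pos by auto
  have "norm (inverse (y t) - inverse (y s)) \<le> B * B * norm (y t - y s)"
    if "s \<in> {a..b}" "t \<in> {a..b}" for s t
  proof -
    have "norm (inverse (y t) - inverse (y s)) = norm (inverse (y t)) * norm (inverse (y s)) * norm (y t - y s)"
      using nz by (simp add: inverse_diff_inverse norm_mult)
    also have "\<dots> \<le> B * B * norm (y t - y s)"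
      using B that by (intro mult_right_mono mult_mono) (auto simp: less_imp_le)
    finally show ?thesis .
  qed
  then show "\<exists>C. \<forall>s\<in>{a..b}. \<forall>t\<in>{a..b}. norm (inverse (y t) - inverse (y s)) \<le> C * norm (y t - y s)"
    by blast
qed

text \<open>Both values lie in a disc of radius \<open>B\<close>, where the derivative of
  \<open>exp\<close> has modulus at most \<open>exp B\<close>; the mean value inequality on this
  convex set gives the Lipschitz constant.\<close>

lemma loc_abs_continuous_exp:
  fixes y :: "real \<Rightarrow> complex"
  assumes y: "loc_abs_continuous y"
  shows "loc_abs_continuous (\<lambda>x. exp (y x))"
proof (rule loc_abs_continuous_dominated1[OF _ y])
  fix a b :: real
  obtain B where B: "B \<ge> 0" "\<And>x. x \<in> {a..b} \<Longrightarrow> norm (y x) \<le> B"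
    by (rule loc_abs_continuous_bounded[OF y, of a b]) blast
  have "norm (exp (y t) - exp (y s)) \<le> exp B * norm (y t - y s)"
    if "s \<in> {a..b}" "t \<in> {a..b}" for s t
  proof (rule field_differentiable_bound[of "cball 0 B"])
    show "(exp has_field_derivative exp z) (at z within cball 0 B)" for z :: complex
      by (rule DERIV_subset[OF DERIV_exp]) auto
    show "norm (exp z) \<le> exp B" if "z \<in> cball 0 B" for z :: complex
      using norm_exp[of z] that by (auto intro: order_trans)
  qed (use B that in auto)
  then show "\<exists>C. \<forall>s\<in>{a..b}. \<forall>t\<in>{a..b}. norm (exp (y t) - exp (y s)) \<le> C * norm (y t - y s)"
    by blast
qed

section \<open>Differentiation of indefinite integrals\<close>

text \<open>The bad intervals form a Vitali covering of the set. A finite disjoint selection, tagged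
  at bad endpoints and fine for a Henstock gauge, has total error below \<open>c * e\<close>; each
  error exceeds \<open>c\<close> times the length, so the selected lengths add up to at most
  \<open>e\<close>.\<close>

lemma negligible_large_difference_quotient_error:
  fixes f :: "real \<Rightarrow> 'a::euclidean_space"
  assumes f: "f integrable_on {a..b}" and c: "c > 0"
  defines "bad \<equiv> \<lambda>x l r. a \<le> l \<and> l < r \<and> r \<le> b \<and> (x = l \<or> x = r) \<and>
      norm (integral {l..r} f - (r - l) *\<^sub>R f x) > c * (r - l)"
  shows "negligible {x. \<forall>d>0. \<exists>l r. bad x l r \<and> r - l < d}" (is "negligible ?S")
  unfolding negligible_outer_le
proof (intro allI impI)
  fix e :: real
  assume "e > 0"
  then have "c * e > 0" using c by simp
  obtain \<gamma> where "gauge \<gamma>" and \<gamma>: "\<And>p. \<lbrakk>p tagged_partial_division_of (cbox a b); \<gamma> fine p\<rbrakk> \<Longrightarrow>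
             sum (\<lambda>(x,k). norm(measure lborel k *\<^sub>R f x - integral k f)) p < c * e"
    by (rule Henstock_lemma[OF f[folded cbox_interval] \<open>c * e > 0\<close>]) (rule that)
  \<comment> \<open>Intervals that fit into the gauge at one of their bad endpoints.
    \<open>m\<close> and \<open>\<rho>\<close> recast them as balls, the form in which the Vitali
    theorem is applied.\<close>
  define K where "K = {(l, r). \<exists>x. bad x l r \<and> {l..r} \<subseteq> \<gamma> x}"
  define m where "m = (\<lambda>(l, r). (l + r) / 2 :: real)"
  define \<rho> where "\<rho> = (\<lambda>(l, r). (r - l) / 2 :: real)"
  have cb: "cball (m i) (\<rho> i) = {fst i..snd i}" for i
    by (cases i) (auto simp: m_def \<rho>_def cball_eq_atLeastAtMost field_simps)
  have 1: "0 < \<rho> i" if "i \<in> K" for i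
    using that by (auto simp: K_def \<rho>_def bad_def)
  have 2: "\<exists>i. i \<in> K \<and> x \<in> cball (m i) (\<rho> i) \<and> \<rho> i < d" if x: "x \<in> ?S" and d: "d > 0" for x d
  proof -
    obtain q where q: "q > 0" "ball x q \<subseteq> \<gamma> x"
      using \<open>gauge \<gamma>\<close> unfolding gauge_def by (meson open_contains_ball)
    obtain l r where lr: "bad x l r" "r - l < min d q"
      using x q d by (auto dest!: spec[of _ "min d q"])
    then have "{l..r} \<subseteq> ball x q"
      by (auto simp: bad_def dist_real_def)
    then have "(l, r) \<in> K" using lr q by (auto simp: K_def)
    moreover have "x \<in> cball (m (l, r)) (\<rho> (l, r))"
      using lr unfolding cb by (auto simp: bad_def)
    moreover have "\<rho> (l, r) < d" using lr by (auto simp: \<rho>_def bad_def)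
    ultimately show ?thesis by blast
  qed
  obtain C where C: "countable C" "C \<subseteq> K"
     "pairwise (\<lambda>i j. disjnt (cball (m i) (\<rho> i)) (cball (m j) (\<rho> j))) C"
     "negligible(?S - (\<Union>i \<in> C. cball (m i) (\<rho> i)))"
    using Vitali_covering_theorem_cballs[of K \<rho> ?S m, OF 1 2] by blast
  let ?I = "\<lambda>i. {fst i..snd i}"
  have fin: "measure lebesgue (\<Union>i\<in>C'. ?I i) \<le> e" if "C' \<subseteq> C" "finite C'" for C'
  proof -
    have "\<forall>i\<in>C'. \<exists>x. bad x (fst i) (snd i) \<and> ?I i \<subseteq> \<gamma> x"
      using that C(2) unfolding K_def by fastforce
    then obtain \<tau> where \<tau>: "\<And>i. i \<in> C' \<Longrightarrow> bad (\<tau> i) (fst i) (snd i) \<and> ?I i \<subseteq> \<gamma> (\<tau> i)"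
      by metis
    define p where "p = (\<lambda>i. (\<tau> i, ?I i)) ` C'"
    have disj: "disjnt (?I i) (?I j)" if "i \<in> C'" "j \<in> C'" "i \<noteq> j" for i j
      using C(3) that \<open>C' \<subseteq> C\<close> unfolding pairwise_def cb by blast
    have "p tagged_partial_division_of (cbox a b)"
      unfolding tagged_partial_division_of_def
    proof (intro conjI allI impI)
      show "finite p" using that by (simp add: p_def)
      fix x k assume "(x, k) \<in> p"
      then obtain i where i: "i \<in> C'" "x = \<tau> i" "k = ?I i" by (auto simp: p_def)
      then show "x \<in> k" "k \<subseteq> cbox a b" using \<tau>[of i] by (auto simp: bad_def)
      show "\<exists>a b. k = cbox a b" using i by auto
    next
      fix x1 K1 x2 K2 assume "(x1, K1) \<in> p \<and> (x2, K2) \<in> p \<and> (x1, K1) \<noteq> (x2, K2)"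
      then obtain i j where "i \<in> C'" "j \<in> C'" "i \<noteq> j" "K1 = ?I i" "K2 = ?I j"
        by (auto simp: p_def)
      then show "interior K1 \<inter> interior K2 = {}"
        using disj[of i j] interior_subset by (metis Int_mono disjnt_def subset_empty)
    qed
    moreover have "\<gamma> fine p"
      using \<tau> by (auto simp: fine_def p_def)
    ultimately have less: "(\<Sum>(x,k)\<in>p. norm(measure lborel k *\<^sub>R f x - integral k f)) < c * e"
      by (rule \<gamma>)
    have inj: "inj_on (\<lambda>i. (\<tau> i, ?I i)) C'"
    proof (rule inj_onI)
      fix i j assume "i \<in> C'" "j \<in> C'" "(\<tau> i, ?I i) = (\<tau> j, ?I j)"
      moreover have "?I i \<noteq> {}" using \<tau>[OF \<open>i \<in> C'\<close>] by (auto simp: bad_def)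
      ultimately show "i = j"
        using disj[of i j] by (auto simp: disjnt_def)
    qed
    have "measure lebesgue (\<Union>i\<in>C'. ?I i) \<le> (\<Sum>i\<in>C'. measure lebesgue (?I i))"
      using that by (intro measure_UNION_le) auto
    also have "\<dots> = (\<Sum>i\<in>C'. snd i - fst i)"
    proof (intro sum.cong refl)
      fix i assume "i \<in> C'"
      then show "measure lebesgue (?I i) = snd i - fst i"
        using \<tau>[of i] by (simp add: bad_def)
    qed
    \<comment> \<open>Badness enters here: \<open>c\<close> times each length is below the Henstock
      error at its tag.\<close>
    also have "c * \<dots> \<le> (\<Sum>i\<in>C'. norm ((snd i - fst i) *\<^sub>R f (\<tau> i) - integral (?I i) f))"
      unfolding sum_distrib_left
      using \<tau> by (intro sum_mono) (auto simp: bad_def norm_minus_commute less_imp_le)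
    also have "\<dots> = (\<Sum>(x,k)\<in>p. norm(measure lborel k *\<^sub>R f x - integral k f))"
      unfolding p_def sum.reindex[OF inj]
    proof (intro sum.cong refl)
      fix i assume "i \<in> C'"
      then show "norm ((snd i - fst i) *\<^sub>R f (\<tau> i) - integral (?I i) f) =
          ((\<lambda>(x,k). norm(measure lborel k *\<^sub>R f x - integral k f)) \<circ> (\<lambda>i. (\<tau> i, ?I i))) i"
        using \<tau>[of i] by (simp add: bad_def)
    qed
    also have "\<dots> < c * e" by fact
    finally show ?thesis using c by simp
  qed
  let ?T = "\<Union>i\<in>C. ?I i"
  have T: "?T \<in> lmeasurable" "measure lebesgue ?T \<le> e"
    using fmeasurable_UN_bound[of C ?I lebesgue e] measure_UN_bound[of C ?I lebesgue e] C(1) fin by auto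
  show "\<exists>T. ?S \<subseteq> T \<and> T \<in> lmeasurable \<and> measure lebesgue T \<le> e"
  proof (intro exI conjI)
    let ?N = "?S - (\<Union>i \<in> C. cball (m i) (\<rho> i))"
    show "?S \<subseteq> ?T \<union> ?N" unfolding cb by blast
    show "?T \<union> ?N \<in> lmeasurable"
      using T C(4) negligible_imp_measurable by blast
    have "measure lebesgue (?T \<union> ?N) \<le> measure lebesgue ?T + measure lebesgue ?N"
      using T C(4) negligible_imp_measurable by (intro measure_Un_le) auto
    then show "measure lebesgue (?T \<union> ?N) \<le> e"
      using T C(4) negligible_imp_measure0 by force
  qed
qed

text \<open>Outside the exceptional sets for the thresholds 1/(n+1), every short interval with
  endpoint \<open>x\<close> has a small relative error. Since \<open>bad\<close> allows
  \<open>x\<close> as left or right endpoint, both one-sided difference quotients are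
  controlled.\<close>

lemma indefinite_integral_has_vector_derivative_ae:
  fixes f :: "real \<Rightarrow> 'a::euclidean_space"
  assumes f: "f integrable_on {a..b}"
  shows "negligible {x \<in> {a<..<b}. \<not> ((\<lambda>x. integral {a..x} f) has_vector_derivative f x) (at x)}"
proof -
  define bad where "bad \<equiv> \<lambda>c x l r. a \<le> l \<and> l < r \<and> r \<le> b \<and> (x = l \<or> x = r) \<and>
      norm (integral {l..r} f - (r - l) *\<^sub>R f x) > c * (r - l)"
  define S where "S = (\<lambda>n. {x. \<forall>d>0. \<exists>l r. bad (inverse (real (Suc n))) x l r \<and> r - l < d})"
  have "negligible (S n)" for n
    unfolding S_def bad_def using negligible_large_difference_quotient_error[OF f, of "inverse (real (Suc n))"] by simp
  then have "negligible (\<Union>n. S n)" by blast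
  moreover have "((\<lambda>x. integral {a..x} f) has_vector_derivative f x) (at x)"
    if x: "x \<in> {a<..<b}" and nS: "x \<notin> (\<Union>n. S n)" for x
    unfolding has_vector_derivative_def has_derivative_at_alt
  proof (intro conjI allI impI)
    show "bounded_linear (\<lambda>h. h *\<^sub>R f x)" by (rule bounded_linear_scaleR_left)
    fix e :: real assume "e > 0"
    then obtain n where n: "inverse (real (Suc n)) < e" using reals_Archimedean by blast
    have "x \<notin> S n" using nS by blast
    then have "\<exists>d>0. \<forall>l r. bad (inverse (real (Suc n))) x l r \<longrightarrow> \<not> r - l < d"
      by (simp add: S_def)
    then obtain d where d: "d > 0" "\<forall>l r. bad (inverse (real (Suc n))) x l r \<longrightarrow> \<not> r - l < d"
      by blast
    have good: "norm (integral {l..r} f - (r - l) *\<^sub>R f x) \<le> e * (r - l)"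
      if "a \<le> l" "l < r" "r \<le> b" "x = l \<or> x = r" "r - l < d" for l r
    proof -
      have "norm (integral {l..r} f - (r - l) *\<^sub>R f x) \<le> inverse (real (Suc n)) * (r - l)"
        using d(2)[rule_format, of l r] that unfolding bad_def by linarith
      also have "\<dots> \<le> e * (r - l)" using n that by (intro mult_right_mono) auto
      finally show ?thesis .
    qed
    \<comment> \<open>The distances to \<open>a\<close> and \<open>b\<close> keep the interval
      between \<open>x\<close> and \<open>y\<close> inside \<open>{a..b}\<close>, where
      \<open>good\<close> applies.\<close>
    define \<delta> where "\<delta> = min d (min (x - a) (b - x))"
    have comb: "integral {a..l} f + integral {l..r} f = integral {a..r} f" if "a \<le> l" "l \<le> r" "r \<le> b" for l r
      using that by (intro Henstock_Kurzweil_Integration.integral_combine integrable_subinterval_real[OF f]) auto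
    show "\<exists>\<delta>>0. \<forall>y. norm (y - x) < \<delta> \<longrightarrow>
        norm (integral {a..y} f - integral {a..x} f - (y - x) *\<^sub>R f x) \<le> e * norm (y - x)"
    proof (intro exI[of _ \<delta>] conjI allI impI)
      show "\<delta> > 0" using d x by (simp add: \<delta>_def)
      fix y assume y: "norm (y - x) < \<delta>"
      consider "y = x" | "x < y" | "y < x" by linarith
      then show "norm (integral {a..y} f - integral {a..x} f - (y - x) *\<^sub>R f x) \<le> e * norm (y - x)"
      proof cases
        case 2
        have *: "integral {a..y} f - integral {a..x} f - (y - x) *\<^sub>R f x = integral {x..y} f - (y - x) *\<^sub>R f x"
          using comb[of x y, symmetric] x y 2 by (simp add: \<delta>_def)
        show ?thesis unfolding * using good[of x y] x y 2 by (simp add: \<delta>_def)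
      next
        case 3
        have *: "integral {a..y} f - integral {a..x} f - (y - x) *\<^sub>R f x = - (integral {y..x} f - (x - y) *\<^sub>R f x)"
          using comb[of y x] x y 3 by (simp add: \<delta>_def algebra_simps)
        show ?thesis unfolding * norm_minus_cancel using good[of y x] x y 3 by (simp add: \<delta>_def)
      qed simp
    qed
  qed
  ultimately show ?thesis
    by (elim negligible_subset) blast
qed

section \<open>Absolutely continuous functions as indefinite integrals\<close>

text \<open>Non-overlapping intervals meet in negligible sets, so lengths add. This allows smallness
  of total length to be checked by comparing measures of unions, for instance when a family is
  refined or lies in a small open set.\<close>

lemma sum_length_division:
  fixes D :: "real set set"
  assumes "D division_of \<Union>D"
  shows "(\<Sum>K\<in>D. Sup K - Inf K) = measure lebesgue (\<Union>D)" "\<Union>D \<in> lmeasurable"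
proof -
  have K: "K = {Inf K..Sup K}" "Inf K \<le> Sup K" if "K \<in> D" for K
    using division_of_real_interval[OF assms that] .
  have lm: "K \<in> lmeasurable" if "K \<in> D" for K
    by (subst K[OF that]) auto
  have "pairwise (\<lambda>S T. negligible (S \<inter> T)) D"
  proof (rule pairwiseI)
    fix S T assume *: "S \<in> D" "T \<in> D" "S \<noteq> T"
    then have "interior S \<inter> interior T = {}" using division_ofD(5)[OF assms] by blast
    moreover have "convex (S \<inter> T)"
      by (intro convex_Int) (metis K convex_real_interval(5) *)+
    ultimately show "negligible (S \<inter> T)"
      by (simp add: negligible_convex_interior)
  qed
  then have "measure lebesgue (\<Union>D) = (\<Sum>K\<in>D. measure lebesgue K)"
    using measure_negligible_finite_Union[of D] division_ofD(1)[OF assms] lm by blast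
  also have "\<dots> = (\<Sum>K\<in>D. Sup K - Inf K)"
  proof (intro sum.cong refl)
    fix k assume "k \<in> D"
    then have "measure lebesgue {Inf k..Sup k} = Sup k - Inf k" using K(2) by simp
    then show "measure lebesgue k = Sup k - Inf k" using K(1)[OF \<open>k \<in> D\<close>] by simp
  qed
  finally show "(\<Sum>K\<in>D. Sup K - Inf K) = measure lebesgue (\<Union>D)" by simp
  show "\<Union>D \<in> lmeasurable" using division_ofD(1)[OF assms] lm by blast
qed

text \<open>Absolute continuity on a single interval, for increments that are summed without absolute
  values: for a monotone function this is the usual notion, and for the positive variation it can
  be verified directly.\<close>

definition ac_increments :: "real \<Rightarrow> real \<Rightarrow> (real \<Rightarrow> real) \<Rightarrow> bool" where
  "ac_increments a b y \<longleftrightarrow>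
     (\<forall>\<epsilon>>0. \<exists>\<delta>>0. \<forall>D. D division_of \<Union>D \<and> \<Union>D \<subseteq> {a..b} \<and> (\<Sum>K\<in>D. Sup K - Inf K) < \<delta>
        \<longrightarrow> (\<Sum>K\<in>D. y (Sup K) - y (Inf K)) < \<epsilon>)"

lemma ac_incrementsE:
  assumes "ac_increments a b y" "\<epsilon> > 0"
  obtains \<delta> where "\<delta> > 0"
    "\<And>D. \<lbrakk>D division_of \<Union>D; \<Union>D \<subseteq> {a..b}; (\<Sum>K\<in>D. Sup K - Inf K) < \<delta>\<rbrakk>
        \<Longrightarrow> (\<Sum>K\<in>D. y (Sup K) - y (Inf K)) < \<epsilon>"
proof -
  obtain \<delta> where "\<delta> > 0" "\<forall>D. D division_of \<Union>D \<and> \<Union>D \<subseteq> {a..b} \<and> (\<Sum>K\<in>D. Sup K - Inf K) < \<delta>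
        \<longrightarrow> (\<Sum>K\<in>D. y (Sup K) - y (Inf K)) < \<epsilon>"
    using assms(1)[unfolded ac_increments_def, THEN spec[of _ \<epsilon>], THEN mp, OF assms(2)] by (elim exE conjE)
  then show thesis by (intro that[of \<delta>]) auto
qed

lemma ac_increments_add:
  assumes "ac_increments a b y" "ac_increments a b z"
  shows "ac_increments a b (\<lambda>x. y x + z x)"
  unfolding ac_increments_def
proof (intro allI impI)
  fix \<epsilon> :: real assume "\<epsilon> > 0"
  then have e: "\<epsilon> / 2 > 0" by simp
  obtain d1 where d1: "d1 > 0" "\<And>D. \<lbrakk>D division_of \<Union>D; \<Union>D \<subseteq> {a..b}; (\<Sum>K\<in>D. Sup K - Inf K) < d1\<rbrakk>
        \<Longrightarrow> (\<Sum>K\<in>D. y (Sup K) - y (Inf K)) < \<epsilon> / 2"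
    by (rule ac_incrementsE[OF assms(1) e]) blast
  obtain d2 where d2: "d2 > 0" "\<And>D. \<lbrakk>D division_of \<Union>D; \<Union>D \<subseteq> {a..b}; (\<Sum>K\<in>D. Sup K - Inf K) < d2\<rbrakk>
        \<Longrightarrow> (\<Sum>K\<in>D. z (Sup K) - z (Inf K)) < \<epsilon> / 2"
    by (rule ac_incrementsE[OF assms(2) e]) blast
  show "\<exists>\<delta>>0. \<forall>D. D division_of \<Union>D \<and> \<Union>D \<subseteq> {a..b} \<and> (\<Sum>K\<in>D. Sup K - Inf K) < \<delta>
        \<longrightarrow> (\<Sum>K\<in>D. y (Sup K) + z (Sup K) - (y (Inf K) + z (Inf K))) < \<epsilon>"
  proof (intro exI[of _ "min d1 d2"] conjI allI impI)
    fix D :: "real set set"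
    assume D: "D division_of \<Union>D \<and> \<Union>D \<subseteq> {a..b} \<and> (\<Sum>K\<in>D. Sup K - Inf K) < min d1 d2"
    have "(\<Sum>K\<in>D. y (Sup K) + z (Sup K) - (y (Inf K) + z (Inf K))) =
       (\<Sum>K\<in>D. y (Sup K) - y (Inf K)) + (\<Sum>K\<in>D. z (Sup K) - z (Inf K))"
      by (simp add: sum.distrib[symmetric] algebra_simps)
    then show "(\<Sum>K\<in>D. y (Sup K) + z (Sup K) - (y (Inf K) + z (Inf K))) < \<epsilon>"
      using d1(2)[of D] d2(2)[of D] D by simp
  qed (use d1 d2 in auto)
qed

lemma loc_abs_continuous_imp_ac_increments:
  fixes y :: "real \<Rightarrow> real"
  assumes "loc_abs_continuous y"
  shows "ac_increments a b y"
  unfolding ac_increments_def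
proof (intro allI impI)
  fix \<epsilon> :: real assume "\<epsilon> > 0"
  obtain d where d: "d > 0" "\<And>D. \<lbrakk>D division_of \<Union>D; \<Union>D \<subseteq> {a..b}; (\<Sum>K\<in>D. Sup K - Inf K) < d\<rbrakk>
        \<Longrightarrow> (\<Sum>K\<in>D. norm (y (Sup K) - y (Inf K))) < \<epsilon>"
    by (rule loc_abs_continuousE[OF assms \<open>\<epsilon> > 0\<close>, of a b]) blast
  show "\<exists>\<delta>>0. \<forall>D. D division_of \<Union>D \<and> \<Union>D \<subseteq> {a..b} \<and> (\<Sum>K\<in>D. Sup K - Inf K) < \<delta>
        \<longrightarrow> (\<Sum>K\<in>D. y (Sup K) - y (Inf K)) < \<epsilon>"
  proof (intro exI[of _ d] conjI allI impI)
    fix D :: "real set set"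
    assume D: "D division_of \<Union>D \<and> \<Union>D \<subseteq> {a..b} \<and> (\<Sum>K\<in>D. Sup K - Inf K) < d"
    have "(\<Sum>K\<in>D. y (Sup K) - y (Inf K)) \<le> (\<Sum>K\<in>D. norm (y (Sup K) - y (Inf K)))"
      by (intro sum_mono) simp
    also have "\<dots> < \<epsilon>" using d D by blast
    finally show "(\<Sum>K\<in>D. y (Sup K) - y (Inf K)) < \<epsilon>" .
  qed (use d in auto)
qed

abbreviation increment_sum :: "(real \<Rightarrow> real) \<Rightarrow> real set set \<Rightarrow> real" where
  "increment_sum y D \<equiv> (\<Sum>K\<in>D. y (Sup K) - y (Inf K))"

abbreviation interval_family :: "real \<Rightarrow> real \<Rightarrow> real set set \<Rightarrow> bool" where
  "interval_family a b D \<equiv> D division_of \<Union>D \<and> \<Union>D \<subseteq> {a..b}"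

lemma interval_family_memD:
  assumes "interval_family a b D" "K \<in> D"
  shows "K = {Inf K..Sup K}" "Inf K \<le> Sup K" "a \<le> Inf K" "Sup K \<le> b"
proof -
  show K: "K = {Inf K..Sup K}" "Inf K \<le> Sup K"
    using division_of_real_interval[of D "\<Union>D" K] assms by auto
  have "{Inf K..Sup K} \<subseteq> {a..b}" using assms K(1) by auto
  then show "a \<le> Inf K" "Sup K \<le> b" using K(2) by auto
qed

lemma interval_family_disjoint:
  assumes "interval_family a b D" "K \<in> D" "L \<in> D" "K \<noteq> L"
  shows "interior K \<inter> interior L = {}"
  using assms division_ofD(5) by blast

section \<open>Monotone functions: Stieltjes measure and Radon-Nikodym density\<close>

text \<open>Absolute continuity of \<open>R\<close> makes its Stieltjes measure absolutely
  continuous with respect to \<open>lborel\<close>; the density is then the integrand. One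
  \<open>r\<close> works for all intervals to the right of \<open>a\<close>.\<close>

lemma monotone_ac_imp_integral:
  fixes R :: "real \<Rightarrow> real"
  assumes mono: "\<And>s t. a \<le> s \<Longrightarrow> s \<le> t \<Longrightarrow> R s \<le> R t"
    and ac: "\<And>b. ac_increments a b R"
  shows "\<exists>r. \<forall>s t. a \<le> s \<longrightarrow> s \<le> t \<longrightarrow> r absolutely_integrable_on {s..t} \<and> (r has_integral (R t - R s)) {s..t}"
proof -
  \<comment> \<open>The Stieltjes measure needs a monotone function on the whole line. Freezing
    \<open>R\<close> to the left of \<open>a\<close> provides one and puts no mass on the left
    half-line.\<close>
  define R' where "R' = (\<lambda>x. R (max a x))"
  have mono': "R' s \<le> R' t" if "s \<le> t" for s t
    unfolding R'_def using that by (intro mono) auto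
  have "\<exists>d>0. \<forall>x'. dist x' x < d \<longrightarrow> dist (R' x') (R' x) < e" if "e > 0" for x e
  proof -
    obtain d where d: "d > 0" "\<And>D. \<lbrakk>D division_of \<Union>D; \<Union>D \<subseteq> {a..x+1}; (\<Sum>K\<in>D. Sup K - Inf K) < d\<rbrakk>
        \<Longrightarrow> (\<Sum>K\<in>D. R (Sup K) - R (Inf K)) < e"
      by (rule ac_incrementsE[OF ac \<open>e > 0\<close>, of "x+1"]) blast
    have *: "R' t - R' s < e" if "s \<le> t" "t - s < d" "t \<le> x + 1" for s t
    proof (cases "a \<le> t")
      case True
      have "{{max a s..t}} division_of \<Union>{{max a s..t}}"
        using that(1) True division_of_self[of "max a s" t] by simp
      from d(2)[OF this] show ?thesis using that True by (auto simp: R'_def)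
    next
      case False
      then show ?thesis using that \<open>e > 0\<close> by (simp add: R'_def)
    qed
    show ?thesis
    proof (intro exI[of _ "min d 1"] conjI allI impI)
      fix x' assume "dist x' x < min d 1"
      then show "dist (R' x') (R' x) < e"
        using *[of x x'] *[of x' x] mono'[of x x'] mono'[of x' x]
        by (cases "x \<le> x'") (auto simp: dist_real_def)
    qed (use d in auto)
  qed
  then have cont: "isCont R' x" for x
    unfolding continuous_at_eps_delta by blast
  then have cont_R: "continuous (at_right x) R'" for x
    using continuous_at_imp_continuous_at_within by blast
  have cont_on: "continuous_on UNIV R'"
    using cont by (simp add: continuous_at_imp_continuous_on)
  define \<mu> where "\<mu> = interval_measure R'"
  have sets\<mu>[simp, measurable_cong]: "sets \<mu> = sets borel" by (simp add: \<mu>_def)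
  have Ioc: "emeasure \<mu> {s<..t} = ennreal (R' t - R' s)" if "s \<le> t" for s t
    unfolding \<mu>_def by (rule emeasure_interval_measure_Ioc[OF that mono' cont_R])
  have Icc: "emeasure \<mu> {s..t} = ennreal (R' t - R' s)" if "s \<le> t" for s t
    unfolding \<mu>_def by (rule emeasure_interval_measure_Icc[OF that mono' cont_on])
  \<comment> \<open>A null set is enclosed in an open set of length below \<open>d\<close> and
    covered by non-overlapping intervals inside it. Every finite subfamily then has increments of
    \<open>R\<close>, that is \<open>\<mu>\<close>-mass, below \<open>e\<close>.\<close>
  have small: "\<exists>T. N \<subseteq> T \<and> T \<in> fmeasurable \<mu> \<and> measure \<mu> T \<le> e"
    if N: "N \<in> null_sets lborel" "N \<subseteq> {a..b}" and "a < b" and "e > 0" for N b and e :: real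
  proof -
    obtain d where d: "d > 0" "\<And>D. \<lbrakk>D division_of \<Union>D; \<Union>D \<subseteq> {a..b}; (\<Sum>K\<in>D. Sup K - Inf K) < d\<rbrakk>
        \<Longrightarrow> (\<Sum>K\<in>D. R (Sup K) - R (Inf K)) < e"
      by (rule ac_incrementsE[OF ac \<open>e > 0\<close>, of b]) blast
    have Nl: "N \<in> null_sets lebesgue"
      using N(1) null_sets_completionI by blast
    obtain U where U: "open U" "N \<subseteq> U" "U - N \<in> lmeasurable" "emeasure lebesgue (U - N) < ennreal d"
      using sets_lebesgue_outer_open[of N d] Nl d(1) by blast
    have Ueq: "U = (U - N) \<union> N" using U by blast
    have Ul: "U \<in> lmeasurable"
      using Ueq U(3) Nl by (metis fmeasurable.Un fmeasurableI_null_sets)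
    have "emeasure lebesgue U = emeasure lebesgue (U - N)"
      using Nl U(3) by (subst Ueq, subst emeasure_Un_null_set) (auto simp: fmeasurableD)
    then have "ennreal (measure lebesgue U) < ennreal d"
      using U(4) emeasure_eq_measure2[OF Ul] by simp
    then have Um: "measure lebesgue U < d"
      by (subst (asm) ennreal_less_iff) auto
    \<comment> \<open>Each covering interval is contained in \<open>g x\<close> for some
      \<open>x\<close> in \<open>N\<close>; as \<open>N\<close> lies in \<open>U\<close>, this gauge
      confines all of them to \<open>U\<close>.\<close>
    define g where "g = (\<lambda>x. if x \<in> U then U else UNIV)"
    have "gauge g" using U(1) by (auto simp: g_def gauge_def)
    obtain D where D: "countable D" "\<Union>D \<subseteq> cbox a b"
      "\<And>K. K \<in> D \<Longrightarrow> interior K \<noteq> {} \<and> (\<exists>c d. K = cbox c d)"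
      "pairwise (\<lambda>A B. interior A \<inter> interior B = {}) D"
      "\<And>K. K \<in> D \<Longrightarrow> \<exists>x \<in> N \<inter> K. K \<subseteq> g x"
      "\<And>u v. cbox u v \<in> D \<Longrightarrow> \<exists>n. \<forall>i \<in> Basis. v \<bullet> i - u \<bullet> i = (b \<bullet> i - a \<bullet> i) / 2^n"
      "N \<subseteq> \<Union>D"
    proof (rule covering_lemma[of N a b g])
      show "N \<subseteq> cbox a b" "box a b \<noteq> {}" "gauge g"
        using N(2) \<open>a < b\<close> \<open>gauge g\<close> by auto
    qed (rule that)
    have DU: "K \<subseteq> U" if "K \<in> D" for K
    proof -
      obtain x where x: "x \<in> N \<inter> K" "K \<subseteq> g x" using D(5)[OF \<open>K \<in> D\<close>] by (elim bexE)
      then have "x \<in> U" using U(2) by blast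
      then show ?thesis using x(2) by (simp add: g_def)
    qed
    have Kfm: "K \<in> fmeasurable \<mu>" if "K \<in> D" for K
    proof -
      have int: "interior K \<noteq> {}" and "\<exists>c d. K = cbox c d" using D(3)[OF that] by auto
      then obtain c d' where K: "K = cbox c d'" by (elim exE)
      then have "{c..d'} \<noteq> {}" using int by force
      with K have "K = {c..d'}" "c \<le> d'" by auto
      then show ?thesis using Icc by (intro fmeasurableI) auto
    qed
    have bound: "measure \<mu> (\<Union>K\<in>D0. K) \<le> e" if D0: "D0 \<subseteq> D" "finite D0" for D0
    proof -
      have div: "D0 division_of \<Union>D0"
        unfolding division_of_def
      proof (intro conjI ballI impI)
        fix K assume "K \<in> D0"
        then have K: "interior K \<noteq> {}" "\<exists>c d. K = cbox c d" using D(3)[of K] D0(1) by auto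
        then show "\<exists>c d. K = cbox c d" by simp
        show "K \<noteq> {}" using K(1) by auto
        show "K \<subseteq> \<Union>D0" using \<open>K \<in> D0\<close> by blast
      next
        fix K L assume "K \<in> D0" "L \<in> D0" "K \<noteq> L"
        then show "interior K \<inter> interior L = {}"
          using pairwiseD[OF D(4), of K L] D0(1) by auto
      qed (use D0 in auto)
      have "\<Union>D0 \<subseteq> U" using DU D0 by blast
      then have "measure lebesgue (\<Union>D0) \<le> measure lebesgue U"
        using sum_length_division(2)[OF div] Ul
        by (intro measure_mono_fmeasurable) (auto simp: fmeasurableD)
      then have "(\<Sum>K\<in>D0. Sup K - Inf K) < d"
        using Um sum_length_division(1)[OF div] by simp
      moreover have sub: "\<Union>D0 \<subseteq> {a..b}" using D(2) D0 by auto
      ultimately have less: "(\<Sum>K\<in>D0. R (Sup K) - R (Inf K)) < e" using d(2)[OF div] by simp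
      have "measure \<mu> (\<Union>K\<in>D0. K) \<le> (\<Sum>K\<in>D0. measure \<mu> K)"
        using D0 Kfm by (intro measure_UNION_le fmeasurableD) auto
      also have "\<dots> = (\<Sum>K\<in>D0. R (Sup K) - R (Inf K))"
      proof (intro sum.cong refl)
        fix K assume K: "K \<in> D0"
        have K': "K = {Inf K..Sup K}" "Inf K \<le> Sup K" "a \<le> Inf K"
          using interval_family_memD(1-3)[OF conjI[OF div sub] K] .
        then have "measure \<mu> {Inf K..Sup K} = R (Sup K) - R (Inf K)"
          using Icc[OF K'(2)] mono[of "Inf K" "Sup K"] K'(2) by (simp add: measure_def R'_def max_def)
        then show "measure \<mu> K = R (Sup K) - R (Inf K)" using K' by simp
      qed
      finally show ?thesis using less by simp
    qed
    have "(\<Union>K\<in>D. K) \<in> fmeasurable \<mu>" "measure \<mu> (\<Union>K\<in>D. K) \<le> e"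
      using fmeasurable_UN_bound[OF D(1) Kfm bound] measure_UN_bound[OF D(1) Kfm bound] by auto
    then show ?thesis using D(7) by auto
  qed
  have null_piece: "N \<in> null_sets \<mu>" if N: "N \<in> null_sets lborel" "N \<subseteq> {a..b}" "a < b" for N b
  proof -
    have "N \<in> sets \<mu>" using N(1) by auto
    moreover have "emeasure \<mu> N \<le> 0 + ennreal e" if e: "e > 0" for e
    proof -
      obtain T where T: "N \<subseteq> T" "T \<in> fmeasurable \<mu>" "measure \<mu> T \<le> e"
        using small[OF N e] by blast
      have "emeasure \<mu> N \<le> emeasure \<mu> T" using T by (intro emeasure_mono) (auto simp: fmeasurableD)
      also have "\<dots> \<le> ennreal e" using T by (simp add: emeasure_eq_measure2 ennreal_leI)
      finally show ?thesis by simp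
    qed
    then have "emeasure \<mu> N \<le> 0" using ennreal_le_epsilon by blast
    ultimately show ?thesis by (auto intro: null_setsI)
  qed
  have "absolutely_continuous lborel \<mu>"
    unfolding absolutely_continuous_def
  proof
    fix N :: "real set" assume N: "N \<in> null_sets lborel"
    have "N \<inter> {a..a + real (Suc n)} \<in> null_sets \<mu>" for n
      by (intro null_piece[of _ "a + real (Suc n)"]) (auto intro: null_set_Int2 N)
    then have "(\<Union>n. N \<inter> {a..a + real (Suc n)}) \<in> null_sets \<mu>" by blast
    moreover have "{a - real n<..a} \<in> null_sets \<mu>" for n
      using Ioc[of "a - real n" a] by (intro null_setsI) (auto simp: R'_def max_def)
    then have "(\<Union>n. {a - real n<..a}) \<in> null_sets \<mu>" by blast
    ultimately have *: "(\<Union>n. N \<inter> {a..a + real (Suc n)}) \<union> (\<Union>n. {a - real n<..a}) \<in> null_sets \<mu>"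
      by blast
    have "N \<subseteq> (\<Union>n. N \<inter> {a..a + real (Suc n)}) \<union> (\<Union>n. {a - real n<..a})"
    proof
      fix x assume "x \<in> N"
      obtain n where "\<bar>x - a\<bar> < real n" using reals_Archimedean2[of "\<bar>x - a\<bar>"] by (elim exE)
      then have "x \<in> {a..a + real (Suc n)} \<or> x \<in> {a - real n<..a}" by auto
      then show "x \<in> (\<Union>n. N \<inter> {a..a + real (Suc n)}) \<union> (\<Union>n. {a - real n<..a})"
        using \<open>x \<in> N\<close> by blast
    qed
    then show "N \<in> null_sets \<mu>"
      using null_sets_subset[OF *] N by auto
  qed
  then obtain f where f[measurable]: "f \<in> borel_measurable lborel" and dens: "density lborel f = \<mu>"
    using sigma_finite_measure.Radon_Nikodym[OF sigma_finite_lborel, of \<mu>] by auto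
  \<comment> \<open>\<open>f\<close> takes extended values and infinity is sent to 0 here. The
    integral of \<open>f\<close> over \<open>{s..t}\<close> is finite, so on that interval this
    alters \<open>f\<close> only on a null set.\<close>
  define r where "r = (\<lambda>x. enn2real (f x))"
  have [measurable]: "r \<in> borel_measurable borel" using f unfolding r_def by measurable
  have "r absolutely_integrable_on {s..t} \<and> (r has_integral (R t - R s)) {s..t}" if st: "a \<le> s" "s \<le> t" for s t
  proof -
    have eq: "(\<integral>\<^sup>+x. f x * indicator {s..t} x \<partial>lborel) = ennreal (R t - R s)"
      using Icc[OF st(2)] st unfolding dens[symmetric]
      by (subst (asm) emeasure_density) (auto simp: R'_def)
    then have "AE x in lborel. f x * indicator {s..t} x \<noteq> \<infinity>"
      by (intro nn_integral_PInf_AE) auto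
    then have "(\<integral>\<^sup>+x. ennreal (r x * indicator {s..t} x) \<partial>lborel) = (\<integral>\<^sup>+x. f x * indicator {s..t} x \<partial>lborel)"
      by (intro nn_integral_cong_AE) (auto elim!: eventually_mono split: split_indicator simp: r_def less_top)
    with eq have "((\<lambda>x. r x * indicator {s..t} x) has_integral (R t - R s)) UNIV"
      using mono[OF st] by (intro nn_integral_has_integral) (auto simp: r_def split: split_indicator)
    then have "((\<lambda>x. if x \<in> {s..t} then r x else 0) has_integral (R t - R s)) UNIV"
      by (rule has_integral_cong[THEN iffD1, rotated]) (auto split: split_indicator)
    then have hi: "(r has_integral (R t - R s)) {s..t}"
      by (simp only: has_integral_restrict_UNIV)
    then show ?thesis
      by (intro conjI nonnegative_absolutely_integrable_1) (auto simp: r_def)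
  qed
  then show ?thesis by blast
qed


section \<open>Finiteness of the positive variation and the Jordan decomposition\<close>

text \<open>Intervals straddling \<open>c\<close> are split there and their increments telescope.
  This is the additivity behind both the finiteness of the variation and its comparison on adjacent
  intervals.\<close>

lemma interval_family_cut:
  assumes D: "interval_family a b D" and c: "a \<le> c" "c \<le> b"
  obtains D1 D2 where "interval_family a c D1" "interval_family c b D2"
    "increment_sum y D = increment_sum y D1 + increment_sum y D2"
proof -
  note m = interval_family_memD[OF D]
  have fin: "finite D" using D by blast
  \<comment> \<open>A straddling interval belongs to both \<open>A1\<close> and \<open>A2\<close>. A
    degenerate interval at \<open>c\<close> belongs to neither, and its increment is 0.\<close>
  define A1 where "A1 = {K\<in>D. Inf K < c}"
  define A2 where "A2 = {K\<in>D. c < Sup K}"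
  define f1 where "f1 = (\<lambda>K. {Inf K..min (Sup K) c})"
  define f2 where "f2 = (\<lambda>K. {max (Inf K) c..Sup K})"
  have f1: "f1 K \<subseteq> K" "f1 K \<noteq> {}" "Inf (f1 K) = Inf K" "Sup (f1 K) = min (Sup K) c"
    "f1 K \<subseteq> {a..c}" "\<exists>u v. f1 K = cbox u v" if "K \<in> A1" for K
  proof -
    have K: "K \<in> D" "Inf K < c" using that by (auto simp: A1_def)
    have "{Inf K..min (Sup K) c} \<subseteq> {Inf K..Sup K}" by auto
    then show "f1 K \<subseteq> K" unfolding f1_def using m(1)[OF K(1)] by simp
    show "f1 K \<noteq> {}" "Inf (f1 K) = Inf K" "Sup (f1 K) = min (Sup K) c" "f1 K \<subseteq> {a..c}"
      using m(2,3)[OF K(1)] K(2) by (auto simp: f1_def)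
    show "\<exists>u v. f1 K = cbox u v" by (auto simp: f1_def)
  qed
  have f2: "f2 K \<subseteq> K" "f2 K \<noteq> {}" "Inf (f2 K) = max (Inf K) c" "Sup (f2 K) = Sup K"
    "f2 K \<subseteq> {c..b}" "\<exists>u v. f2 K = cbox u v" if "K \<in> A2" for K
  proof -
    have K: "K \<in> D" "c < Sup K" using that by (auto simp: A2_def)
    have "{max (Inf K) c..Sup K} \<subseteq> {Inf K..Sup K}" by auto
    then show "f2 K \<subseteq> K" unfolding f2_def using m(1)[OF K(1)] by simp
    show "f2 K \<noteq> {}" "Inf (f2 K) = max (Inf K) c" "Sup (f2 K) = Sup K" "f2 K \<subseteq> {c..b}"
      using m(2,4)[OF K(1)] K(2) by (auto simp: f2_def)
    show "\<exists>u v. f2 K = cbox u v" by (auto simp: f2_def)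
  qed
  have disj: "interior (f K) \<inter> interior (f L) = {}"
    if "K \<in> D" "L \<in> D" "K \<noteq> L" "f K \<subseteq> K" "f L \<subseteq> L" for f :: "real set \<Rightarrow> real set" and K L
    using interval_family_disjoint[OF D that(1-3)] interior_mono[OF that(4)] interior_mono[OF that(5)] by blast
  have div1: "interval_family a c (f1 ` A1)"
  proof
    show "f1 ` A1 division_of \<Union>(f1 ` A1)"
      unfolding division_of_def
    proof (intro conjI ballI impI)
      show "finite (f1 ` A1)" using fin by (simp add: A1_def)
      fix K1 K2 assume "K1 \<in> f1 ` A1" "K2 \<in> f1 ` A1" "K1 \<noteq> K2"
      then obtain K L where KL: "K \<in> A1" "L \<in> A1" "K1 = f1 K" "K2 = f1 L" "K \<noteq> L" by blast
      then show "interior K1 \<inter> interior K2 = {}"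
        using disj[of K L f1] f1(1) by (auto simp: A1_def)
    qed (use f1 in auto)
    show "\<Union>(f1 ` A1) \<subseteq> {a..c}" using f1(5) by blast
  qed
  have div2: "interval_family c b (f2 ` A2)"
  proof
    show "f2 ` A2 division_of \<Union>(f2 ` A2)"
      unfolding division_of_def
    proof (intro conjI ballI impI)
      show "finite (f2 ` A2)" using fin by (simp add: A2_def)
      fix K1 K2 assume "K1 \<in> f2 ` A2" "K2 \<in> f2 ` A2" "K1 \<noteq> K2"
      then obtain K L where KL: "K \<in> A2" "L \<in> A2" "K1 = f2 K" "K2 = f2 L" "K \<noteq> L" by blast
      then show "interior K1 \<inter> interior K2 = {}"
        using disj[of K L f2] f2(1) by (auto simp: A2_def)
    qed (use f2 in auto)
    show "\<Union>(f2 ` A2) \<subseteq> {c..b}" using f2(5) by blast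
  qed
  \<comment> \<open>If two members had the same image under \<open>f1\<close> or \<open>f2\<close>,
    interior-disjointness would shrink that image to a point, with increment 0. This is the
    condition that \<open>sum.reindex_nontrivial\<close> asks for.\<close>
  have degen: "Inf J = Sup J" if "J = {u..v}" "u \<le> v" "interior J = {}" for J and u v :: real
  proof -
    have "u = v" using that by (auto simp: interior_atLeastAtMost_real)
    then show ?thesis using that by simp
  qed
  have s1: "increment_sum y (f1 ` A1) = (\<Sum>K\<in>A1. y (min (Sup K) c) - y (Inf K))"
  proof -
    have "increment_sum y (f1 ` A1) = sum ((\<lambda>K. y (Sup K) - y (Inf K)) \<circ> f1) A1"
    proof (rule sum.reindex_nontrivial)
      show "finite A1" using fin by (simp add: A1_def)
      fix K L assume KL: "K \<in> A1" "L \<in> A1" "K \<noteq> L" "f1 K = f1 L"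
      then have "interior (f1 K) = {}" using disj[of K L f1] f1(1) by (auto simp: A1_def)
      then have "Inf (f1 K) = Sup (f1 K)"
        using degen[of "f1 K" "Inf K" "min (Sup K) c"] f1(2)[OF KL(1)] by (auto simp: f1_def)
      then show "y (Sup (f1 K)) - y (Inf (f1 K)) = 0" by simp
    qed
    then show ?thesis using f1(3,4) by simp
  qed
  have s2: "increment_sum y (f2 ` A2) = (\<Sum>K\<in>A2. y (Sup K) - y (max (Inf K) c))"
  proof -
    have "increment_sum y (f2 ` A2) = sum ((\<lambda>K. y (Sup K) - y (Inf K)) \<circ> f2) A2"
    proof (rule sum.reindex_nontrivial)
      show "finite A2" using fin by (simp add: A2_def)
      fix K L assume KL: "K \<in> A2" "L \<in> A2" "K \<noteq> L" "f2 K = f2 L"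
      then have "interior (f2 K) = {}" using disj[of K L f2] f2(1) by (auto simp: A2_def)
      then have "Inf (f2 K) = Sup (f2 K)"
        using degen[of "f2 K" "max (Inf K) c" "Sup K"] f2(2)[OF KL(1)] by (auto simp: f2_def)
      then show "y (Sup (f2 K)) - y (Inf (f2 K)) = 0" by simp
    qed
    then show ?thesis using f2(3,4) by simp
  qed
  have "increment_sum y D = (\<Sum>K\<in>D. (if Inf K < c then y (min (Sup K) c) - y (Inf K) else 0)
        + (if c < Sup K then y (Sup K) - y (max (Inf K) c) else 0))"
  proof (intro sum.cong refl)
    fix K assume "K \<in> D"
    have "Inf K = Sup K" if "c \<le> Inf K" "Sup K \<le> c"
      using that m(2)[OF \<open>K \<in> D\<close>] by linarith
    then show "y (Sup K) - y (Inf K) = (if Inf K < c then y (min (Sup K) c) - y (Inf K) else 0)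
        + (if c < Sup K then y (Sup K) - y (max (Inf K) c) else 0)"
      by (cases "Inf K < c"; cases "c < Sup K") (auto simp: min_def max_def not_less)
  qed
  also have "\<dots> = increment_sum y (f1 ` A1) + increment_sum y (f2 ` A2)"
    unfolding s1 s2 using fin by (simp add: A1_def A2_def sum.distrib sum.inter_filter)
  finally show ?thesis using that[OF div1 div2] by blast
qed

text \<open>On an interval shorter than \<open>d\<close> the increments sum to less than 1, so the
  bound is the number of steps of length \<open>d / 2\<close> needed to cross
  \<open>{a..b}\<close>.\<close>

lemma increment_sum_bounded:
  fixes y :: "real \<Rightarrow> real"
  assumes ac: "ac_increments a b y" and ab: "a \<le> b"
  shows "\<exists>B. \<forall>D. interval_family a b D \<longrightarrow> increment_sum y D \<le> B"
proof -
  obtain d where d: "d > 0" "\<And>D. \<lbrakk>D division_of \<Union>D; \<Union>D \<subseteq> {a..b}; (\<Sum>K\<in>D. Sup K - Inf K) < d\<rbrakk>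
        \<Longrightarrow> increment_sum y D < 1"
    by (rule ac_incrementsE[OF ac, of 1]) auto
  have *: "\<forall>D. interval_family a c D \<longrightarrow> increment_sum y D \<le> real n"
    if "a \<le> c" "c \<le> b" "c - a \<le> real n * (d / 2)" for n c
    using that
  proof (induction n arbitrary: c)
    case 0
    then have "c = a" by simp
    show ?case
    proof (intro allI impI)
      fix D assume D: "interval_family a c D"
      have "y (Sup K) - y (Inf K) = 0" if "K \<in> D" for K
      proof -
        have "Inf K = Sup K" using interval_family_memD(2-4)[OF D that] \<open>c = a\<close> by linarith
        then show ?thesis by simp
      qed
      then show "increment_sum y D \<le> real 0" by simp
    qed
  next
    case (Suc n)
    \<comment> \<open>A step of \<open>d / 2\<close> rather than \<open>d\<close> keeps the last
      piece strictly shorter than \<open>d\<close>; the maximum stops the walk at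
      \<open>a\<close>.\<close>
    define c' where "c' = max a (c - d / 2)"
    have c': "a \<le> c'" "c' \<le> c" "c' \<le> b" using Suc.prems d(1) by (auto simp: c'_def)
    have "c' - a \<le> real n * (d / 2)" using Suc.prems d(1) by (auto simp: c'_def max_def algebra_simps)
    note IH = Suc.IH[OF c'(1,3) this]
    show ?case
    proof (intro allI impI)
      fix D assume D: "interval_family a c D"
      obtain D1 D2 where D12: "interval_family a c' D1" "interval_family c' c D2"
        "increment_sum y D = increment_sum y D1 + increment_sum y D2"
        using interval_family_cut[OF D c'(1,2), of y thesis] by blast
      have "(\<Sum>K\<in>D2. Sup K - Inf K) = measure lebesgue (\<Union>D2)"
        using sum_length_division D12(2) by blast
      also have "\<dots> \<le> measure lebesgue {c'..c}"
        using sum_length_division(2)[of D2] D12(2)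
        by (intro measure_mono_fmeasurable) (auto simp: fmeasurableD)
      also have "\<dots> < d" using c' d(1) by (auto simp: c'_def)
      finally have "increment_sum y D2 < 1"
        using D12(2) c' Suc.prems by (intro d(2)) auto
      then show "increment_sum y D \<le> real (Suc n)"
        using IH[rule_format, OF D12(1)] D12(3) by simp
    qed
  qed
  obtain n :: nat where "(b - a) / (d / 2) \<le> real n" using real_arch_simple[of "(b - a) / (d / 2)"] by (elim exE)
  then have "b - a \<le> real n * (d / 2)" using d(1) by (simp add: field_simps)
  from *[OF ab order_refl this] show ?thesis by (rule exI)
qed

text \<open>The third conclusion says that \<open>P - y\<close> is also increasing, so
  \<open>y\<close> is the difference of two monotone functions. Signed increments are enough for
  this, and absolute continuity of \<open>P\<close> follows by refining a given division with nearly
  optimal families.\<close>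

lemma jordan_decomposition_ac:
  fixes y :: "real \<Rightarrow> real"
  assumes y: "loc_abs_continuous y"
  obtains P where "\<And>s t. a \<le> s \<Longrightarrow> s \<le> t \<Longrightarrow> P s \<le> P t" "\<And>b. ac_increments a b P"
    "\<And>s t. a \<le> s \<Longrightarrow> s \<le> t \<Longrightarrow> y t - y s \<le> P t - P s"
proof -
  note acy = loc_abs_continuous_imp_ac_increments[OF y]
  define V where "V = (\<lambda>x. {increment_sum y D |D. interval_family a x D})"
  define P where "P = (\<lambda>x. Sup (V x))" \<comment> \<open>the positive variation of \<open>y\<close> on \<open>{a..x}\<close>\<close>
  have bdd: "bdd_above (V x)" if "a \<le> x" for x
    using increment_sum_bounded[OF acy that] unfolding V_def bdd_above_def by blast
  have memV: "increment_sum y D \<in> V x" if "interval_family a x D" for D x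
    using that unfolding V_def by blast
  have "interval_family a x {}" for x by (simp add: division_of_def)
  then have ne: "V x \<noteq> {}" for x using memV by blast
  have upper: "increment_sum y D \<le> P x" if "interval_family a x D" "a \<le> x" for D x
    unfolding P_def using memV[OF that(1)] bdd[OF that(2)] by (rule cSup_upper)
  have near: "\<exists>D. interval_family a x D \<and> P x - e < increment_sum y D" if "e > 0" "a \<le> x" for e x
  proof -
    have "P x - e < Sup (V x)" using that by (simp add: P_def)
    then obtain v where "v \<in> V x" "P x - e < v"
      using less_cSup_iff[OF ne bdd[OF \<open>a \<le> x\<close>]] by blast
    then show ?thesis unfolding V_def by blast
  qed
  have P_mono: "P s \<le> P t" if "a \<le> s" "s \<le> t" for s t
    unfolding P_def
  proof (rule cSup_subset_mono[OF ne bdd])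
    have "interval_family a t D" if "interval_family a s D" for D
      using that \<open>s \<le> t\<close> by (auto intro: order_trans)
    then show "V s \<subseteq> V t" unfolding V_def by blast
  qed (use that in auto)
  \<comment> \<open>Appending \<open>{s..t}\<close> to a nearly optimal family on
    \<open>{a..s}\<close> gives a competitor for \<open>P t\<close>.\<close>
  have P_ge: "y t - y s \<le> P t - P s" if st: "a \<le> s" "s \<le> t" for s t
  proof (rule field_le_epsilon)
    fix e :: real assume "e > 0"
    obtain D where D: "interval_family a s D" "P s - e < increment_sum y D"
      using near[OF \<open>e > 0\<close> st(1)] by blast
    show "y t - y s \<le> P t - P s + e"
    proof (cases "s = t")
      case False
      then have "s < t" using st by simp
      have sub: "interior (\<Union>D) \<inter> interior {s..t} = {}"
      proof -
        have "interior (\<Union>D) \<subseteq> interior {a..s}" using D(1) by (intro interior_mono) blast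
        then show ?thesis by (auto simp: interior_atLeastAtMost_real)
      qed
      have "D \<union> {{s..t}} division_of (\<Union>D \<union> {s..t})"
        using D(1) division_of_self[of s t] st(2) by (intro division_disjoint_union sub) auto
      moreover have "\<Union>D \<union> {s..t} = \<Union>(D \<union> {{s..t}})" by auto
      moreover have "\<Union>(D \<union> {{s..t}}) \<subseteq> {a..t}" using D(1) st by force
      ultimately have fam: "interval_family a t (D \<union> {{s..t}})" by metis
      have "{s..t} \<notin> D"
      proof
        assume "{s..t} \<in> D"
        then have "{s..t} \<subseteq> {a..s}" using D(1) by blast
        then show False using \<open>s < t\<close> by auto
      qed
      moreover have "finite D" using D(1) by blast
      ultimately have "increment_sum y (D \<union> {{s..t}}) = increment_sum y D + (y t - y s)"
        using st(2) by simp
      then show ?thesis using upper[OF fam] st D(2) by linarith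
    qed (use \<open>e > 0\<close> in auto)
  qed
  \<comment> \<open>Conversely, a nearly optimal family on \<open>{a..t}\<close> is cut at
    \<open>s\<close>; its left part contributes at most \<open>P s\<close>.\<close>
  have P_le: "\<exists>D. interval_family s t D \<and> P t - P s \<le> increment_sum y D + e"
    if st: "a \<le> s" "s \<le> t" and e: "e > 0" for s t e
  proof -
    have "a \<le> t" using st by simp
    obtain D where D: "interval_family a t D" "P t - e < increment_sum y D"
      using near[OF e \<open>a \<le> t\<close>] by blast
    obtain D1 D2 where D12: "interval_family a s D1" "interval_family s t D2"
        "increment_sum y D = increment_sum y D1 + increment_sum y D2"
      using interval_family_cut[OF D(1) st, of y thesis] by blast
    show ?thesis
      using D12 D(2) upper[OF D12(1) st(1)] by (intro exI[of _ D2]) auto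
  qed
  have P_ac: "ac_increments a b P" for b
    unfolding ac_increments_def
  proof (intro allI impI)
    fix \<epsilon> :: real assume "\<epsilon> > 0"
    then have "\<epsilon> / 2 > 0" by simp
    obtain d where d: "d > 0" "\<And>D. \<lbrakk>D division_of \<Union>D; \<Union>D \<subseteq> {a..b}; (\<Sum>K\<in>D. Sup K - Inf K) < d\<rbrakk>
        \<Longrightarrow> increment_sum y D < \<epsilon> / 2"
      by (rule ac_incrementsE[OF acy \<open>\<epsilon> / 2 > 0\<close>, of a b]) auto
    show "\<exists>\<delta>>0. \<forall>D. D division_of \<Union>D \<and> \<Union>D \<subseteq> {a..b} \<and> (\<Sum>K\<in>D. Sup K - Inf K) < \<delta>
        \<longrightarrow> increment_sum P D < \<epsilon>"
    proof (intro exI[of _ d] conjI allI impI)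
      fix D :: "real set set"
      assume "D division_of \<Union>D \<and> \<Union>D \<subseteq> {a..b} \<and> (\<Sum>K\<in>D. Sup K - Inf K) < d"
      then have D: "interval_family a b D" and len: "(\<Sum>K\<in>D. Sup K - Inf K) < d" by auto
      note m = interval_family_memD[OF D]
      have fin: "finite D" using D by blast
      \<comment> \<open>One error \<open>\<eta>\<close> is spent on each member of \<open>D\<close>,
        so together they cost at most half of \<epsilon>. The added 1 covers the empty
        division.\<close>
      define \<eta> where "\<eta> = \<epsilon> / (2 * (real (card D) + 1))"
      have "\<eta> > 0" using \<open>\<epsilon> > 0\<close> by (simp add: \<eta>_def)
      have "\<forall>K\<in>D. \<exists>E. interval_family (Inf K) (Sup K) E \<and> P (Sup K) - P (Inf K) \<le> increment_sum y E + \<eta>"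
        by (intro ballI P_le m \<open>\<eta> > 0\<close>)
      then obtain E where E: "\<forall>K\<in>D. interval_family (Inf K) (Sup K) (E K) \<and>
          P (Sup K) - P (Inf K) \<le> increment_sum y (E K) + \<eta>"
        by (subst (asm) bchoice_iff) (elim exE)
      then have fam: "interval_family (Inf K) (Sup K) (E K)"
        and le: "P (Sup K) - P (Inf K) \<le> increment_sum y (E K) + \<eta>" if "K \<in> D" for K
        using that by auto
      have sub: "J \<subseteq> K" if "K \<in> D" "J \<in> E K" for J K
        using fam[OF that(1)] that(2) m(1)[OF that(1)] by blast
      have finE: "finite (E K)" if "K \<in> D" for K using fam[OF that] by blast
      have disj: "interior J \<inter> interior J' = {}"
        if "K \<in> D" "L \<in> D" "J \<in> E K" "J' \<in> E L" "K \<noteq> L" for J J' K L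
        using interval_family_disjoint[OF D that(1,2,5)]
          interior_mono[OF sub[OF that(1,3)]] interior_mono[OF sub[OF that(2,4)]] by blast
      \<comment> \<open>The nearly optimal families inside the members of \<open>D\<close> form one
        family whose total length is still below \<open>d\<close>, so the absolute continuity of
        \<open>y\<close> applies to it.\<close>
      define U where "U = (\<Union>K\<in>D. E K)"
      have famU: "interval_family a b U"
      proof
        show "U division_of \<Union>U"
          unfolding division_of_def
        proof (intro conjI ballI impI)
          show "finite U" using fin finE by (auto simp: U_def)
          fix J assume "J \<in> U"
          then obtain K where K: "K \<in> D" "J \<in> E K" by (auto simp: U_def)
          show "J \<subseteq> \<Union>U" using \<open>J \<in> U\<close> by blast
          show "J \<noteq> {}" "\<exists>u v. J = cbox u v"
            using division_ofD(3,4)[of "E K" "\<Union>(E K)" J] fam[OF K(1)] K(2) by auto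
        next
          fix J J' assume "J \<in> U" "J' \<in> U" "J \<noteq> J'"
          then obtain K L where KL: "K \<in> D" "L \<in> D" "J \<in> E K" "J' \<in> E L" by (auto simp: U_def)
          show "interior J \<inter> interior J' = {}"
          proof (cases "K = L")
            case True
            then show ?thesis
              using interval_family_disjoint[OF fam[OF KL(1)]] KL \<open>J \<noteq> J'\<close> by blast
          next
            case False
            then show ?thesis using disj[OF KL] by blast
          qed
        qed simp
        show "\<Union>U \<subseteq> {a..b}" using sub D unfolding U_def by blast
      qed
      have "(\<Sum>K\<in>U. Sup K - Inf K) = measure lebesgue (\<Union>U)"
        using sum_length_division famU by blast
      also have "\<dots> \<le> measure lebesgue (\<Union>D)"
        using sum_length_division(2)[of U] sum_length_division(2)[of D] famU D sub
        by (intro measure_mono_fmeasurable) (auto simp: fmeasurableD U_def)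
      also have "\<dots> < d" using len sum_length_division(1)[of D] D by simp
      finally have "increment_sum y U < \<epsilon> / 2" using famU by (intro d(2)) auto
      moreover have "increment_sum y U = (\<Sum>K\<in>D. increment_sum y (E K))"
      proof -
        \<comment> \<open>Neighbouring families may share a one-point interval, so the union need
          not be disjoint as a set of intervals. Shared members have empty interior and increment
          0.\<close>
        have "U = snd ` Sigma D E" by (force simp: U_def)
        have "increment_sum y (snd ` Sigma D E) = sum ((\<lambda>K. y (Sup K) - y (Inf K)) \<circ> snd) (Sigma D E)"
        proof (rule sum.reindex_nontrivial)
          show "finite (Sigma D E)" using fin finE by auto
          fix p q assume pq: "p \<in> Sigma D E" "q \<in> Sigma D E" "p \<noteq> q" "snd p = snd q"
          then have "interior (snd p) = {}"
            using disj[of "fst p" "fst q" "snd p" "snd q"] by (auto simp: prod_eq_iff mem_Times_iff)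
          moreover have "snd p = {Inf (snd p)..Sup (snd p)}" "Inf (snd p) \<le> Sup (snd p)"
            using interval_family_memD[OF fam[of "fst p"], of "snd p"] pq(1) by auto
          ultimately have "Inf (snd p) = Sup (snd p)"
            by (metis antisym_conv2 greaterThanLessThan_empty_iff interior_atLeastAtMost_real not_le)
          then show "y (Sup (snd p)) - y (Inf (snd p)) = 0" by simp
        qed
        also have "\<dots> = (\<Sum>K\<in>D. increment_sum y (E K))"
          using fin finE by (subst sum.Sigma) (auto simp: split_def)
        finally show ?thesis using \<open>U = snd ` Sigma D E\<close> by simp
      qed
      moreover have "increment_sum P D \<le> (\<Sum>K\<in>D. increment_sum y (E K) + \<eta>)"
        using le by (intro sum_mono)
      moreover have "(\<Sum>K\<in>D. increment_sum y (E K) + \<eta>) = (\<Sum>K\<in>D. increment_sum y (E K)) + real (card D) * \<eta>"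
        by (simp add: sum.distrib)
      moreover have "real (card D) * \<eta> \<le> \<epsilon> / 2"
        using \<open>\<epsilon> > 0\<close> by (simp add: \<eta>_def field_simps)
      ultimately show "increment_sum P D < \<epsilon>" by linarith
    qed (use d in auto)
  qed
  show ?thesis by (rule that[OF P_mono P_ac P_ge])
qed

section \<open>The fundamental theorem of calculus for absolutely continuous functions\<close>

text \<open>With \<open>P\<close> from the Jordan decomposition, both \<open>P\<close> and
  \<open>P - y\<close> are monotone with the required increment condition; the difference of their
  densities is a density for \<open>y\<close>.\<close>

lemma loc_abs_continuous_imp_integral_real:
  fixes y :: "real \<Rightarrow> real"
  assumes y: "loc_abs_continuous y"
  shows "\<exists>r. \<forall>s t. a \<le> s \<longrightarrow> s \<le> t \<longrightarrow> r absolutely_integrable_on {s..t} \<and> (r has_integral (y t - y s)) {s..t}"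
proof -
  obtain P where P: "\<And>s t. a \<le> s \<Longrightarrow> s \<le> t \<Longrightarrow> P s \<le> P t" "\<And>b. ac_increments a b P"
    "\<And>s t. a \<le> s \<Longrightarrow> s \<le> t \<Longrightarrow> y t - y s \<le> P t - P s"
    by (rule jordan_decomposition_ac[OF y, of a thesis]) (rule that)
  have "loc_abs_continuous (\<lambda>x. - y x)"
    using loc_abs_continuous_diff[OF loc_abs_continuous_const[of 0] y] by simp
  then have "ac_increments a b (\<lambda>x. P x + (- y x))" for b
    by (intro ac_increments_add P(2) loc_abs_continuous_imp_ac_increments)
  moreover have "P s + (- y s) \<le> P t + (- y t)" if "a \<le> s" "s \<le> t" for s t using P(3)[OF that] by simp
  ultimately obtain q where q: "\<forall>s t. a \<le> s \<longrightarrow> s \<le> t \<longrightarrow> q absolutely_integrable_on {s..t} \<and>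
      (q has_integral (P t + (- y t) - (P s + (- y s)))) {s..t}"
    using monotone_ac_imp_integral[of a "\<lambda>x. P x + (- y x)"] by blast
  obtain p where p: "\<forall>s t. a \<le> s \<longrightarrow> s \<le> t \<longrightarrow> p absolutely_integrable_on {s..t} \<and>
      (p has_integral (P t - P s)) {s..t}"
    using monotone_ac_imp_integral[of a P, OF P(1,2)] by blast
  show ?thesis
  proof (intro exI[of _ "\<lambda>x. p x - q x"] allI impI conjI)
    fix s t assume st: "a \<le> s" "s \<le> t"
    show "(\<lambda>x. p x - q x) absolutely_integrable_on {s..t}" using p q st by (intro set_integral_diff) auto
    show "((\<lambda>x. p x - q x) has_integral (y t - y s)) {s..t}"
      using has_integral_diff[of p "P t - P s" "{s..t}" q "P t + (- y t) - (P s + (- y s))"] p q st by simp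
  qed
qed

lemma AE_lebesgue_iff_negligible: "(AE x in lebesgue. P x) \<longleftrightarrow> negligible {x. \<not> P x}"
  unfolding eventually_ae_filter_negligible using negligible_subset by blast

abbreviation (input) vderiv :: "(real \<Rightarrow> 'a::real_normed_vector) \<Rightarrow> real \<Rightarrow> 'a" where
  "vderiv y \<equiv> \<lambda>x. vector_derivative y (at x)"

lemma loc_abs_continuous_imp_integral:
  fixes y :: "real \<Rightarrow> complex"
  assumes y: "loc_abs_continuous y"
  shows "\<exists>r. \<forall>s t. a \<le> s \<longrightarrow> s \<le> t \<longrightarrow> r absolutely_integrable_on {s..t} \<and> (r has_integral (y t - y s)) {s..t}"
proof -
  obtain p where p: "\<forall>s t. a \<le> s \<longrightarrow> s \<le> t \<longrightarrow> p absolutely_integrable_on {s..t} \<and>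
      (p has_integral (Re (y t) - Re (y s))) {s..t}"
    using loc_abs_continuous_imp_integral_real[OF loc_abs_continuous_linear[OF bounded_linear_Re y], of a]
    by (elim exE)
  obtain q where q: "\<forall>s t. a \<le> s \<longrightarrow> s \<le> t \<longrightarrow> q absolutely_integrable_on {s..t} \<and>
      (q has_integral (Im (y t) - Im (y s))) {s..t}"
    using loc_abs_continuous_imp_integral_real[OF loc_abs_continuous_linear[OF bounded_linear_Im y], of a]
    by (elim exE)
  show ?thesis
  proof (intro exI[of _ "\<lambda>x. complex_of_real (p x) + \<i> * complex_of_real (q x)"] allI impI conjI)
    fix s t assume st: "a \<le> s" "s \<le> t"
    have 1: "(\<lambda>x. complex_of_real (p x)) absolutely_integrable_on {s..t}"
    proof -
      have "p absolutely_integrable_on {s..t}" using p st by simp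
      from absolutely_integrable_linear[OF this bounded_linear_of_real] show ?thesis unfolding o_def .
    qed
    have 2: "(\<lambda>x. \<i> * complex_of_real (q x)) absolutely_integrable_on {s..t}"
    proof -
      have "q absolutely_integrable_on {s..t}" using q st by simp
      from absolutely_integrable_linear[OF this bounded_linear_const_mult[OF bounded_linear_of_real]]
      show ?thesis unfolding o_def .
    qed
    show "(\<lambda>x. complex_of_real (p x) + \<i> * complex_of_real (q x)) absolutely_integrable_on {s..t}"
      using 1 2 by (rule set_integral_add)
    have p': "(p has_integral (Re (y t) - Re (y s))) {s..t}" and q': "(q has_integral (Im (y t) - Im (y s))) {s..t}"
      using p q st by auto
    have eq: "y t - y s = complex_of_real (Re (y t) - Re (y s)) + \<i> * complex_of_real (Im (y t) - Im (y s))"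
      by (simp add: complex_eq_iff)
    show "((\<lambda>x. complex_of_real (p x) + \<i> * complex_of_real (q x)) has_integral (y t - y s)) {s..t}"
      unfolding eq
      by (rule has_integral_add[OF has_integral_linear[OF p' bounded_linear_of_real, unfolded o_def]
            has_integral_linear[OF q' bounded_linear_const_mult[OF bounded_linear_of_real], unfolded o_def]])
  qed
qed

lemma has_vector_derivative_of_integral_ae:
  fixes y :: "real \<Rightarrow> complex"
  assumes r: "\<And>s t. a \<le> s \<Longrightarrow> s \<le> t \<Longrightarrow> t \<le> b \<Longrightarrow> (r has_integral (y t - y s)) {s..t}"
  shows "negligible {x \<in> {a<..<b}. \<not> (y has_vector_derivative r x) (at x)}"
proof (cases "a < b")
  case True
  have int: "r integrable_on {a..b}"
    using r[of a b] True by auto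
  show ?thesis
  proof (rule negligible_subset[OF indefinite_integral_has_vector_derivative_ae[OF int]], intro subsetI)
    fix x assume x: "x \<in> {x \<in> {a<..<b}. \<not> (y has_vector_derivative r x) (at x)}"
    have "(y has_vector_derivative r x) (at x)"
      if d: "((\<lambda>x. integral {a..x} r) has_vector_derivative r x) (at x)"
    proof -
      have "((\<lambda>x. integral {a..x} r + y a) has_vector_derivative r x) (at x)"
        using d by (intro derivative_eq_intros) auto
      then show ?thesis
      proof (rule has_vector_derivative_transform_within_open[of _ _ _ "{a<..<b}"])
        fix z assume "z \<in> {a<..<b}"
        then have "integral {a..z} r = y z - y a"
          using r[of a z] by (intro integral_unique) auto
        then show "integral {a..z} r + y a = y z" by simp
      qed (use x in auto)
    qed
    then show "x \<in> {x \<in> {a<..<b}. \<not> ((\<lambda>x. integral {a..x} r) has_vector_derivative r x) (at x)}"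
      using x by blast
  qed
qed (auto simp: not_less)

text \<open>The integrands found so far depend on a left starting point. Those for the starting
  points -n all agree with \<open>vector_derivative\<close> off negligible sets, which gives a
  single integrand on the whole line.\<close>

lemma loc_abs_continuous_derivative:
  fixes y :: "real \<Rightarrow> complex"
  assumes y: "loc_abs_continuous y"
  shows "AE x in lebesgue. (y has_vector_derivative vderiv y x) (at x)"
    and "locally_integrable (vderiv y)"
    and "\<And>s t. s \<le> t \<Longrightarrow> (vderiv y has_integral (y t - y s)) {s..t}"
proof -
  have "\<forall>n. \<exists>r. \<forall>s t. - real n \<le> s \<longrightarrow> s \<le> t \<longrightarrow> r absolutely_integrable_on {s..t} \<and> (r has_integral (y t - y s)) {s..t}"
    using loc_abs_continuous_imp_integral[OF y] by blast
  then obtain r where r: "\<forall>n. \<forall>s t. - real n \<le> s \<longrightarrow> s \<le> t \<longrightarrow>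
      r n absolutely_integrable_on {s..t} \<and> (r n has_integral (y t - y s)) {s..t}"
    by (subst (asm) choice_iff) (elim exE)
  define N where "N = (\<lambda>n. {x \<in> {- real n<..<real n}. \<not> (y has_vector_derivative r n x) (at x)})"
  have N: "negligible (N n)" for n
    unfolding N_def using r by (intro has_vector_derivative_of_integral_ae) auto
  have good: "(y has_vector_derivative vderiv y x) (at x)" "vderiv y x = r n x"
    if "x \<in> {- real n<..<real n}" "x \<notin> N n" for n x
  proof -
    have d: "(y has_vector_derivative r n x) (at x)" using that by (auto simp: N_def)
    then show "vderiv y x = r n x" by (rule vector_derivative_at)
    with d show "(y has_vector_derivative vderiv y x) (at x)" by simp
  qed
  have "negligible {x. \<not> (y has_vector_derivative vderiv y x) (at x)}"
  proof (rule negligible_subset)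
    show "negligible (\<Union>n. N n)" using N by blast
    show "{x. \<not> (y has_vector_derivative vderiv y x) (at x)} \<subseteq> (\<Union>n. N n)"
    proof
      fix x assume x: "x \<in> {x. \<not> (y has_vector_derivative vderiv y x) (at x)}"
      obtain n where "\<bar>x\<bar> < real n" using reals_Archimedean2[of "\<bar>x\<bar>"] by (elim exE)
      then have "x \<in> {- real n<..<real n}" by auto
      then have "x \<in> N n" using good(1)[of x n] x by blast
      then show "x \<in> (\<Union>n. N n)" by blast
    qed
  qed
  then show "AE x in lebesgue. (y has_vector_derivative vderiv y x) (at x)"
    by (simp add: AE_lebesgue_iff_negligible)
  have piece: "vderiv y absolutely_integrable_on {s..t} \<and> (vderiv y has_integral (y t - y s)) {s..t}" if "s \<le> t" for s t
  proof -
    obtain n where n: "max \<bar>s\<bar> \<bar>t\<bar> < real n" using reals_Archimedean2[of "max \<bar>s\<bar> \<bar>t\<bar>"] by (elim exE)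
    have eq: "vderiv y x = r n x" if "x \<in> {s..t} - N n" for x
      using that n by (intro good) auto
    have "- real n \<le> s" using n by auto
    then have "r n absolutely_integrable_on {s..t}" "(r n has_integral (y t - y s)) {s..t}"
      using r that by auto
    from absolutely_integrable_spike[OF this(1) N eq] has_integral_spike[OF N eq this(2)]
    show ?thesis ..
  qed
  then show "\<And>s t. s \<le> t \<Longrightarrow> (vderiv y has_integral (y t - y s)) {s..t}" by blast
  show "locally_integrable (vderiv y)"
    unfolding locally_integrable_def
  proof (intro allI)
    fix s t :: real
    show "vderiv y absolutely_integrable_on {s..t}"
      using piece[of s t] by (cases "s \<le> t") auto
  qed
qed

text \<open>Differentiability almost everywhere would not suffice, as the Cantor function shows;
  absolute continuity enters by recovering \<open>y\<close> as the integral of its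
  derivative.\<close>

lemma loc_abs_continuous_zero_derivative_const:
  fixes y :: "real \<Rightarrow> complex"
  assumes y: "loc_abs_continuous y" and 0: "AE x in lebesgue. (y has_vector_derivative 0) (at x)"
  shows "y x = y 0"
proof -
  have neg: "negligible {x. \<not> (y has_vector_derivative 0) (at x)}"
    using 0 by (simp add: AE_lebesgue_iff_negligible)
  have "y t - y s = 0" if "s \<le> t" for s t
  proof -
    have "((\<lambda>x. 0) has_integral (y t - y s)) {s..t}"
      by (rule has_integral_spike[OF neg _ loc_abs_continuous_derivative(3)[OF y that]])
        (simp add: vector_derivative_at)
    then show ?thesis using has_integral_0_eq by blast
  qed
  from this[of 0 x] this[of x 0] show ?thesis by (cases "0 \<le> x") auto
qed

section \<open>The primitive of a locally integrable function\<close>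

lemma locally_integrableD: "locally_integrable u \<Longrightarrow> u absolutely_integrable_on {a..b}"
  by (simp add: locally_integrable_def)

lemma locally_integrable_integrable: "locally_integrable u \<Longrightarrow> u integrable_on {a..b}"
  by (simp add: locally_integrable_def absolutely_integrable_on_def)

lemma set_integral_open_interval:
  fixes u :: "real \<Rightarrow> complex"
  assumes "u absolutely_integrable_on {a..b}"
  shows "(LINT t:{a<..<b}|lebesgue. u t) = integral {a..b} u"
  using assms set_lebesgue_integral_eq_integral(2)[of "{a<..<b}" u]
  by (simp add: integral_open_interval_real absolutely_integrable_on_Icc_iff_Ioo)

lemma prim_eq_integral:
  assumes "locally_integrable u"
  shows "prim u x = (if 0 \<le> x then integral {0..x} u else - integral {x..0} u)"
  using set_integral_open_interval[OF locally_integrableD[OF assms]]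
  by (simp add: prim_def interval_lebesgue_integral_def zero_ereal_def)

lemma prim_diff:
  assumes u: "locally_integrable u" and st: "s \<le> t"
  shows "(u has_integral (prim u t - prim u s)) {s..t}"
proof -
  have c: "integral {a..b} u + integral {b..c} u = integral {a..c} u" if "a \<le> b" "b \<le> c" for a b c
    using that by (intro Henstock_Kurzweil_Integration.integral_combine locally_integrable_integrable u)
  have "prim u t - prim u s = integral {s..t} u"
    unfolding prim_eq_integral[OF u] using st c[of 0 s t] c[of s 0 t] c[of s t 0]
    by (auto simp: algebra_simps)
  then show ?thesis
    using locally_integrable_integrable[OF u, of s t] by (simp add: integrable_integral)
qed

lemma prim_0: "prim u 0 = 0"
  by (simp add: prim_def interval_lebesgue_integral_def zero_ereal_def set_lebesgue_integral_def)

text \<open>Truncation at height \<open>k\<close>: the norm of \<open>u\<close> is at most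
  \<open>k\<close> plus the excess \<open>f k\<close>, whose integral over \<open>{a..b}\<close>
  tends to 0 by dominated convergence. The excess costs less than half of \<epsilon> and the bounded
  part at most half once the total length is below
  \<open>\<epsilon> / (2 * (k + 1))\<close>.\<close>

lemma loc_abs_continuous_prim:
  assumes u: "locally_integrable u"
  shows "loc_abs_continuous (prim u)"
  unfolding loc_abs_continuous_def
proof (intro allI impI)
  fix a b \<epsilon> :: real assume "\<epsilon> > 0"
  define f where "f = (\<lambda>k::nat. \<lambda>x. max (norm (u x) - real k) 0)"
  have nu: "(\<lambda>x. norm (u x)) absolutely_integrable_on {a..b}"
    using absolutely_integrable_norm[OF locally_integrableD[OF u, of a b]] unfolding o_def .
  have f_abs: "f k absolutely_integrable_on {a..b}" for k
    unfolding f_def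
    by (intro absolutely_integrable_max_1 set_integral_diff nu)
      (auto intro: absolutely_integrable_on_const)
  have f_int: "f k integrable_on {a..b}" for k
    using f_abs absolutely_integrable_on_def by blast
  have "(\<lambda>k. integral {a..b} (f k)) \<longlonglongrightarrow> integral {a..b} (\<lambda>x. 0 :: real)"
  proof (rule dominated_convergence(2))
    show "f k integrable_on {a..b}" for k by (rule f_int)
    show "(\<lambda>x. norm (u x)) integrable_on {a..b}" using nu absolutely_integrable_on_def by blast
    show "norm (f k x) \<le> norm (u x)" for k x by (auto simp: f_def)
    show "(\<lambda>k. f k x) \<longlonglongrightarrow> 0" for x
    proof (rule tendsto_eventually)
      obtain m :: nat where m: "norm (u x) \<le> real m" using real_arch_simple[of "norm (u x)"] by (elim exE)
      show "\<forall>\<^sub>F k in sequentially. f k x = 0"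
      proof (rule eventually_mono[OF eventually_ge_at_top[of m]])
        fix k assume "m \<le> k"
        then have "norm (u x) \<le> real k" using m by linarith
        then show "f k x = 0" by (simp add: f_def)
      qed
    qed
  qed
  then have "(\<lambda>k. integral {a..b} (f k)) \<longlonglongrightarrow> 0" by simp
  then have "\<forall>\<^sub>F k in sequentially. integral {a..b} (f k) < \<epsilon> / 2"
    using \<open>\<epsilon> > 0\<close> by (intro order_tendstoD(2)[where y=0]) auto
  then obtain k where k: "integral {a..b} (f k) < \<epsilon> / 2"
    using eventually_happens'[OF sequentially_bot] by blast
  show "\<exists>\<delta>>0. \<forall>D. D division_of \<Union>D \<and> \<Union>D \<subseteq> {a..b} \<and> (\<Sum>K\<in>D. Sup K - Inf K) < \<delta>
        \<longrightarrow> (\<Sum>K\<in>D. norm (prim u (Sup K) - prim u (Inf K))) < \<epsilon>"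
  proof (intro exI[of _ "\<epsilon> / (2 * (real k + 1))"] conjI allI impI)
    show "\<epsilon> / (2 * (real k + 1)) > 0" using \<open>\<epsilon> > 0\<close> by simp
    fix D :: "real set set"
    assume "D division_of \<Union>D \<and> \<Union>D \<subseteq> {a..b} \<and> (\<Sum>K\<in>D. Sup K - Inf K) < \<epsilon> / (2 * (real k + 1))"
    then have div: "D division_of \<Union>D" and sub: "\<Union>D \<subseteq> {a..b}"
      and len: "(\<Sum>K\<in>D. Sup K - Inf K) < \<epsilon> / (2 * (real k + 1))" by auto
    note m = interval_family_memD[OF conjI[OF div sub]]
    have "(\<Sum>K\<in>D. norm (prim u (Sup K) - prim u (Inf K))) \<le> (\<Sum>K\<in>D. real k * (Sup K - Inf K) + integral K (f k))"
    proof (intro sum_mono)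
      fix K assume K: "K \<in> D"
      have fK: "f k integrable_on {Inf K..Sup K}"
        using f_int by (rule integrable_subinterval_real) (use m(3,4)[OF K] in auto)
      have ci: "((\<lambda>x. real k) has_integral real k * (Sup K - Inf K)) {Inf K..Sup K}"
        using has_integral_const_real[of "real k" "Inf K" "Sup K"] m(2)[OF K] by (simp add: mult.commute)
      have "norm (prim u (Sup K) - prim u (Inf K)) = norm (integral {Inf K..Sup K} u)"
        using prim_diff[OF u m(2)[OF K]] by (simp add: integral_unique)
      also have "\<dots> \<le> integral {Inf K..Sup K} (\<lambda>x. real k + f k x)"
      proof (rule integral_norm_bound_integral)
        show "u integrable_on {Inf K..Sup K}" by (rule locally_integrable_integrable[OF u])
        show "(\<lambda>x. real k + f k x) integrable_on {Inf K..Sup K}" using fK ci by (intro integrable_add) auto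
        show "norm (u x) \<le> real k + f k x" for x by (auto simp: f_def)
      qed
      also have "\<dots> = real k * (Sup K - Inf K) + integral {Inf K..Sup K} (f k)"
        using integral_unique[OF ci] fK ci
        by (subst Henstock_Kurzweil_Integration.integral_add) auto
      also have "{Inf K..Sup K} = K" using m(1)[OF K] by simp
      finally show "norm (prim u (Sup K) - prim u (Inf K)) \<le> real k * (Sup K - Inf K) + integral K (f k)" .
    qed
    also have "\<dots> = real k * (\<Sum>K\<in>D. Sup K - Inf K) + (\<Sum>K\<in>D. integral K (f k))"
      by (simp add: sum.distrib sum_distrib_left)
    also have "(\<Sum>K\<in>D. integral K (f k)) \<le> integral {a..b} (f k)"
    proof -
      have hi: "(f k has_integral (\<Sum>K\<in>D. integral K (f k))) (\<Union>D)"
        by (rule has_integral_combine_division_topdown[OF f_int div sub])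
      then have "(\<Sum>K\<in>D. integral K (f k)) = integral (\<Union>D) (f k)" by (simp add: integral_unique)
      also have "\<dots> \<le> integral {a..b} (f k)"
        using hi f_int sub by (intro integral_subset_le) (auto simp: f_def)
      finally show ?thesis .
    qed
    also have "real k * (\<Sum>K\<in>D. Sup K - Inf K) \<le> (real k + 1) * (\<epsilon> / (2 * (real k + 1)))"
      using len m(2) by (intro mult_mono) (auto intro: sum_nonneg)
    also have "\<dots> = \<epsilon> / 2" by (simp add: field_simps)
    finally show "(\<Sum>K\<in>D. norm (prim u (Sup K) - prim u (Inf K))) < \<epsilon>"
      using k by linarith
  qed
qed

lemma prim_has_vector_derivative_ae:
  assumes u: "locally_integrable u"
  shows "AE x in lebesgue. (prim u has_vector_derivative u x) (at x)"
proof -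
  define N where "N = (\<lambda>n. {x \<in> {- real n<..<real n}. \<not> (prim u has_vector_derivative u x) (at x)})"
  have "negligible (N n)" for n
    unfolding N_def by (intro has_vector_derivative_of_integral_ae prim_diff u)
  then have "negligible (\<Union>n. N n)" by blast
  moreover have "{x. \<not> (prim u has_vector_derivative u x) (at x)} \<subseteq> (\<Union>n. N n)"
  proof
    fix x assume x: "x \<in> {x. \<not> (prim u has_vector_derivative u x) (at x)}"
    obtain n where "\<bar>x\<bar> < real n" using reals_Archimedean2[of "\<bar>x\<bar>"] by (elim exE)
    then have "x \<in> N n" using x by (auto simp: N_def)
    then show "x \<in> (\<Union>n. N n)" by blast
  qed
  ultimately show ?thesis
    unfolding AE_lebesgue_iff_negligible by (rule negligible_subset)
qed

section \<open>Closure properties of local integrability\<close>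

lemma locally_integrable_mult:
  assumes y: "loc_abs_continuous y" and u: "locally_integrable u"
  shows "locally_integrable (\<lambda>x. y x * u x)"
  unfolding locally_integrable_def
proof (intro allI)
  fix a b :: real
  show "(\<lambda>x. y x * u x) absolutely_integrable_on {a..b}"
  proof (rule absolutely_integrable_bounded_measurable_product[where h="(*)"])
    have cont: "continuous_on {a..b} y" by (rule loc_abs_continuous_imp_continuous[OF y])
    then show "y \<in> borel_measurable (lebesgue_on {a..b})"
      by (intro continuous_imp_measurable_on_sets_lebesgue) auto
    show "bounded (y ` {a..b})"
      using cont by (intro compact_imp_bounded compact_continuous_image) auto
    show "bilinear ((*) :: complex \<Rightarrow> complex \<Rightarrow> complex)"
      by (simp add: bilinear_conv_bounded_bilinear bounded_bilinear_mult)
  qed (use locally_integrableD[OF u] in auto)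
qed

lemma locally_integrable_add:
  assumes "locally_integrable u" "locally_integrable v"
  shows "locally_integrable (\<lambda>x. u x + v x)"
  using assms unfolding locally_integrable_def by (auto intro: set_integral_add)

lemma locally_integrable_cmult:
  assumes "locally_integrable u"
  shows "locally_integrable (\<lambda>x. c * u x)"
  using locally_integrable_mult[OF loc_abs_continuous_const assms] .

lemma locally_integrable_uminus:
  assumes "locally_integrable u"
  shows "locally_integrable (\<lambda>x. - u x)"
  using locally_integrable_cmult[OF assms, of "-1"] by simp

lemma locally_integrable_diff:
  assumes "locally_integrable u" "locally_integrable v"
  shows "locally_integrable (\<lambda>x. u x - v x)"
  using locally_integrable_add[OF assms(1) locally_integrable_uminus[OF assms(2)]] by simp

lemma locally_integrable_norm:
  assumes "locally_integrable u"
  shows "locally_integrable (\<lambda>x. complex_of_real (norm (u x)))"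
  unfolding locally_integrable_def
proof (intro allI)
  fix a b :: real
  show "(\<lambda>x. complex_of_real (norm (u x))) absolutely_integrable_on {a..b}"
    using absolutely_integrable_linear[OF absolutely_integrable_norm[OF locally_integrableD[OF assms, of a b]] bounded_linear_of_real]
    unfolding o_def .
qed

section \<open>The simplex integrals as iterated primitives\<close>

text \<open>The integral A_j with its last variable integrated outermost. Factor number j+1 is
  \<open>u\<close> exactly when j is even, and the orientation of \<open>prim\<close> accounts for
  the sign (-1)^j to the left of 0.\<close>

primrec biexp_iter :: "(real \<Rightarrow> complex) \<Rightarrow> (real \<Rightarrow> complex) \<Rightarrow> nat \<Rightarrow> real \<Rightarrow> complex" where
  "biexp_iter u v 0 = (\<lambda>x. 1)"
| "biexp_iter u v (Suc j) = prim (\<lambda>t. biexp_iter u v j t * (if even j then u t else v t))"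

lemma locally_integrable_if: "locally_integrable u \<Longrightarrow> locally_integrable v \<Longrightarrow> locally_integrable (\<lambda>t. if b then u t else v t)"
  by (cases b) auto

lemma loc_abs_continuous_biexp_iter:
  assumes "locally_integrable u" "locally_integrable v"
  shows "loc_abs_continuous (biexp_iter u v j)"
proof (induction j)
  case (Suc j)
  then show ?case
    using assms by (auto intro!: loc_abs_continuous_prim locally_integrable_mult locally_integrable_if)
qed (simp add: loc_abs_continuous_const)

lemma biexp_iter_integrand:
  assumes "locally_integrable u" "locally_integrable v"
  shows "locally_integrable (\<lambda>t. biexp_iter u v j t * (if even j then u t else v t))"
  using assms by (intro locally_integrable_mult loc_abs_continuous_biexp_iter locally_integrable_if)

lemma sigma_finite_lebesgue: "sigma_finite_measure (lebesgue :: 'a::euclidean_space measure)"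
proof
  show "\<exists>A::'a set set. countable A \<and> A \<subseteq> sets lebesgue \<and> \<Union>A = space lebesgue \<and> (\<forall>a\<in>A. emeasure lebesgue a \<noteq> \<infinity>)"
  proof (intro exI conjI ballI)
    show "countable (range (\<lambda>n::nat. cball (0::'a) (real n)))" by simp
    show "\<Union>(range (\<lambda>n::nat. cball (0::'a) (real n))) = space lebesgue"
      using real_arch_simple by (auto simp: dist_norm)
    show "emeasure lebesgue a \<noteq> \<infinity>" if a: "a \<in> range (\<lambda>n::nat. cball (0::'a) (real n))" for a
    proof -
      have "a \<in> lmeasurable" using a by auto
      then show ?thesis using fmeasurableD2 by (metis infinity_ennreal_def)
    qed
  qed auto
qed

interpretation lebesgue_prod: product_sigma_finite "\<lambda>_::nat. lebesgue :: real measure"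
  by standard (rule sigma_finite_measure.sigma_finite_countable[OF sigma_finite_lebesgue])

text \<open>The sign \<open>\<sigma> = 1\<close> or \<open>\<sigma> = -1\<close> selects the increasing simplex between \<open>0\<close> and \<open>x\<close> or the
  decreasing one.\<close>

definition ordered_simplex :: "real \<Rightarrow> nat \<Rightarrow> real \<Rightarrow> (nat \<Rightarrow> real) set" where
  "ordered_simplex \<sigma> j x = {s. monotone_on {1..j} (<) (\<lambda>a b. \<sigma> * a < \<sigma> * b) s \<and>
      (\<forall>i\<in>{1..j}. 0 < \<sigma> * s i \<and> \<sigma> * s i < \<sigma> * x)}"

text \<open>The last coordinate lies furthest from 0, so it alone has to be compared with
  \<open>x\<close> and takes over the role of \<open>x\<close> for the others.\<close>

lemma ordered_simplex_Suc:
  "s \<in> ordered_simplex \<sigma> (Suc j) x \<longleftrightarrow>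
     0 < \<sigma> * s (Suc j) \<and> \<sigma> * s (Suc j) < \<sigma> * x \<and> s \<in> ordered_simplex \<sigma> j (s (Suc j))"
proof
  assume "s \<in> ordered_simplex \<sigma> (Suc j) x"
  then show "0 < \<sigma> * s (Suc j) \<and> \<sigma> * s (Suc j) < \<sigma> * x \<and> s \<in> ordered_simplex \<sigma> j (s (Suc j))"
    by (auto simp: ordered_simplex_def monotone_on_def)
next
  assume *: "0 < \<sigma> * s (Suc j) \<and> \<sigma> * s (Suc j) < \<sigma> * x \<and> s \<in> ordered_simplex \<sigma> j (s (Suc j))"
  have b: "0 < \<sigma> * s i \<and> \<sigma> * s i < \<sigma> * x" if "i \<in> {1..Suc j}" for i
  proof (cases "i = Suc j")
    case False
    then have "i \<in> {1..j}" using that by auto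
    then have "0 < \<sigma> * s i" "\<sigma> * s i < \<sigma> * s (Suc j)" using * by (auto simp: ordered_simplex_def)
    then show ?thesis using * by auto
  qed (use * in auto)
  have m: "\<sigma> * s i < \<sigma> * s k" if "i \<in> {1..Suc j}" "k \<in> {1..Suc j}" "i < k" for i k
  proof (cases "k = Suc j")
    case True
    then have "i \<in> {1..j}" using that by auto
    then show ?thesis using * True by (auto simp: ordered_simplex_def)
  next
    case False
    then have "i \<in> {1..j}" "k \<in> {1..j}" using that by auto
    then show ?thesis using * that(3) by (auto simp: ordered_simplex_def monotone_on_def)
  qed
  show "s \<in> ordered_simplex \<sigma> (Suc j) x"
    unfolding ordered_simplex_def monotone_on_def using b m by blast
qed

lemma ordered_simplex_cong:
  assumes "\<And>i. i \<in> {1..j} \<Longrightarrow> s i = t i"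
  shows "s \<in> ordered_simplex \<sigma> j x \<longleftrightarrow> t \<in> ordered_simplex \<sigma> j x"
  unfolding ordered_simplex_def monotone_on_def using assms by simp

lemma lebesgue_component_measurable:
  assumes "i \<in> I"
  shows "(\<lambda>s. s i) \<in> borel_measurable (Pi\<^sub>M I (\<lambda>_. lebesgue :: real measure))"
proof -
  have "(\<lambda>x::real. x) \<in> borel_measurable lebesgue" by (rule measurable_completion) simp
  from measurable_compose[OF measurable_component_singleton[OF assms, of "\<lambda>_. lebesgue :: real measure"] this]
  show ?thesis .
qed

lemma ordered_simplex_measurable:
  "ordered_simplex \<sigma> j x \<inter> space (Pi\<^sub>M {1..j} (\<lambda>_. lebesgue)) \<in> sets (Pi\<^sub>M {1..j} (\<lambda>_. lebesgue))"
proof -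
  let ?M = "Pi\<^sub>M {1..j} (\<lambda>_. lebesgue :: real measure)"
  have eq: "ordered_simplex \<sigma> j x \<inter> space ?M =
      {s\<in>space ?M. (\<forall>i\<in>{1..j}. \<forall>k\<in>{1..j}. i < k \<longrightarrow> \<sigma> * s i < \<sigma> * s k) \<and>
        (\<forall>i\<in>{1..j}. 0 < \<sigma> * s i \<and> \<sigma> * s i < \<sigma> * x)}"
    by (auto simp: ordered_simplex_def monotone_on_def)
  have m: "(\<lambda>s. \<sigma> * s i) \<in> borel_measurable ?M" if "i \<in> {1..j}" for i
    by (intro borel_measurable_times borel_measurable_const lebesgue_component_measurable that)
  show ?thesis
    unfolding eq
  proof (intro sets.sets_Collect_conj sets.sets_Collect_finite_All)
    fix i k assume "i \<in> {1..j}" "k \<in> {1..j}"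
    show "{s \<in> space ?M. i < k \<longrightarrow> \<sigma> * s i < \<sigma> * s k} \<in> sets ?M"
      by (cases "i < k") (auto intro!: borel_measurable_less m \<open>i \<in> {1..j}\<close> \<open>k \<in> {1..j}\<close> simp del: One_nat_def)
  qed (auto intro!: borel_measurable_less m simp del: One_nat_def)
qed

text \<open>On the simplex every coordinate lies in \<open>{-\<bar>x\<bar>..\<bar>x\<bar>}\<close>.
  Inserting these indicators turns the integrand into a restriction of a product of integrable
  functions of one variable.\<close>

lemma integrable_ordered_simplex:
  fixes w :: "nat \<Rightarrow> real \<Rightarrow> complex"
  assumes \<sigma>: "\<bar>\<sigma>\<bar> = 1" and w: "\<And>i. locally_integrable (w i)"
  shows "integrable (Pi\<^sub>M {1..j} (\<lambda>_. lebesgue))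
     (\<lambda>s. indicator (ordered_simplex \<sigma> j x) s *\<^sub>R (\<Prod>i\<in>{1..j}. w i (s i)))"
proof -
  let ?M = "Pi\<^sub>M {1..j} (\<lambda>_. lebesgue :: real measure)"
  have 1: "integrable ?M (\<lambda>s. \<Prod>i\<in>{1..j}. indicat_real {-\<bar>x\<bar>..\<bar>x\<bar>} (s i) *\<^sub>R w i (s i))"
    using locally_integrableD[OF w]
    by (intro lebesgue_prod.product_integrable_prod) (auto simp: set_integrable_def)
  have 2: "integrable ?M (\<lambda>s. indicator (ordered_simplex \<sigma> j x \<inter> space ?M) s *\<^sub>R
      (\<Prod>i\<in>{1..j}. indicat_real {-\<bar>x\<bar>..\<bar>x\<bar>} (s i) *\<^sub>R w i (s i)))"
    by (rule integrable_mult_indicator[OF ordered_simplex_measurable 1])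
  show ?thesis
  proof (rule Bochner_Integration.integrable_cong[THEN iffD1, OF refl _ 2])
    fix s assume s: "s \<in> space ?M"
    show "indicator (ordered_simplex \<sigma> j x \<inter> space ?M) s *\<^sub>R
      (\<Prod>i\<in>{1..j}. indicat_real {-\<bar>x\<bar>..\<bar>x\<bar>} (s i) *\<^sub>R w i (s i)) =
      indicator (ordered_simplex \<sigma> j x) s *\<^sub>R (\<Prod>i\<in>{1..j}. w i (s i))"
    proof (cases "s \<in> ordered_simplex \<sigma> j x")
      case True
      have "indicat_real {-\<bar>x\<bar>..\<bar>x\<bar>} (s i) = 1" if "i \<in> {1..j}" for i
      proof -
        have "0 < \<sigma> * s i" "\<sigma> * s i < \<sigma> * x" using True that by (auto simp: ordered_simplex_def)
        moreover have "\<sigma> = 1 \<or> \<sigma> = -1" using \<sigma> by linarith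
        ultimately show ?thesis by (auto simp: indicator_def)
      qed
      then have "(\<Prod>i\<in>{1..j}. indicat_real {-\<bar>x\<bar>..\<bar>x\<bar>} (s i) *\<^sub>R w i (s i)) = (\<Prod>i\<in>{1..j}. w i (s i))"
        by (intro prod.cong) auto
      then show ?thesis using True s by simp
    qed simp
  qed
qed

text \<open>Fubini with the coordinate \<open>Suc j\<close> outermost. The inner integral has to be
  known only for \<open>0 < \<sigma> * z\<close>, because the outer indicator vanishes
  elsewhere.\<close>

lemma simplex_integral_Suc:
  fixes w :: "nat \<Rightarrow> real \<Rightarrow> complex"
  assumes \<sigma>: "\<bar>\<sigma>\<bar> = 1" and w: "\<And>i. locally_integrable (w i)"
    and G: "locally_integrable (\<lambda>z. G z * w (Suc j) z)"
    and J: "\<And>z. 0 < \<sigma> * z \<Longrightarrow>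
      (LINT s:ordered_simplex \<sigma> j z|Pi\<^sub>M {1..j} (\<lambda>_. lebesgue). \<Prod>i\<in>{1..j}. w i (s i)) = G z"
  shows "(LINT s:ordered_simplex \<sigma> (Suc j) x|Pi\<^sub>M {1..Suc j} (\<lambda>_. lebesgue). \<Prod>i\<in>{1..Suc j}. w i (s i))
    = (LINT z:{z. 0 < \<sigma> * z \<and> \<sigma> * z < \<sigma> * x}|lebesgue. G z * w (Suc j) z)"
proof -
  let ?S = "{z. 0 < \<sigma> * z \<and> \<sigma> * z < \<sigma> * x}"
  let ?f = "\<lambda>s. indicator (ordered_simplex \<sigma> (Suc j) x) s *\<^sub>R (\<Prod>i\<in>{1..Suc j}. w i (s i)) :: complex"
  let ?g = "\<lambda>z s. indicator (ordered_simplex \<sigma> j z) s *\<^sub>R (\<Prod>i\<in>{1..j}. w i (s i)) :: complex"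
  have ins: "{1..Suc j} = {Suc j} \<union> {1..j}" by auto
  have merge: "?f (merge {Suc j} {1..j} (p, s)) = (indicator ?S (p (Suc j)) *\<^sub>R w (Suc j) (p (Suc j))) * ?g (p (Suc j)) s"
    for p s
  proof -
    let ?m = "merge {Suc j} {1..j} (p, s)"
    have m1: "?m (Suc j) = p (Suc j)" by (simp add: merge_def)
    have m2: "?m i = s i" if "i \<in> {1..j}" for i using that by (simp add: merge_def)
    have "?m \<in> ordered_simplex \<sigma> (Suc j) x \<longleftrightarrow> p (Suc j) \<in> ?S \<and> s \<in> ordered_simplex \<sigma> j (p (Suc j))"
      unfolding ordered_simplex_Suc m1 using ordered_simplex_cong[of j ?m s, OF m2] by auto
    then have "indicat_real (ordered_simplex \<sigma> (Suc j) x) ?m =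
        indicat_real ?S (p (Suc j)) * indicat_real (ordered_simplex \<sigma> j (p (Suc j))) s"
      by (simp only: indicator_def) (simp only: of_bool_conj)
    moreover have "(\<Prod>i\<in>{1..Suc j}. w i (?m i)) = w (Suc j) (p (Suc j)) * (\<Prod>i\<in>{1..j}. w i (s i))"
    proof -
      have "(\<Prod>i\<in>{1..Suc j}. w i (?m i)) = (\<Prod>i\<in>{1..j}. w i (?m i)) * w (Suc j) (?m (Suc j))"
        by (simp add: prod.nat_ivl_Suc')
      also have "(\<Prod>i\<in>{1..j}. w i (?m i)) = (\<Prod>i\<in>{1..j}. w i (s i))"
        using m2 by (intro prod.cong) auto
      finally show ?thesis using m1 by (simp add: mult.commute)
    qed
    ultimately show ?thesis by (simp only: scaleR_conv_of_real of_real_mult mult_ac)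
  qed
  have "(LINT s:ordered_simplex \<sigma> (Suc j) x|Pi\<^sub>M {1..Suc j} (\<lambda>_. lebesgue). \<Prod>i\<in>{1..Suc j}. w i (s i))
      = integral\<^sup>L (Pi\<^sub>M ({Suc j} \<union> {1..j}) (\<lambda>_. lebesgue)) ?f"
    unfolding set_lebesgue_integral_def ins ..
  also have "\<dots> = (\<integral>p. (\<integral>s. ?f (merge {Suc j} {1..j} (p, s)) \<partial>Pi\<^sub>M {1..j} (\<lambda>_. lebesgue)) \<partial>Pi\<^sub>M {Suc j} (\<lambda>_. lebesgue))"
  proof (rule lebesgue_prod.product_integral_fold)
    show "integrable (Pi\<^sub>M ({Suc j} \<union> {1..j}) (\<lambda>_. lebesgue)) ?f"
      unfolding ins[symmetric] by (rule integrable_ordered_simplex[where w=w, OF \<sigma> w])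
  qed auto
  also have "\<dots> = (\<integral>p. indicator ?S (p (Suc j)) *\<^sub>R (G (p (Suc j)) * w (Suc j) (p (Suc j))) \<partial>Pi\<^sub>M {Suc j} (\<lambda>_. lebesgue))"
  proof (intro Bochner_Integration.integral_cong refl)
    fix p :: "nat \<Rightarrow> real"
    have "(\<integral>s. ?f (merge {Suc j} {1..j} (p, s)) \<partial>Pi\<^sub>M {1..j} (\<lambda>_. lebesgue)) =
        (indicator ?S (p (Suc j)) *\<^sub>R w (Suc j) (p (Suc j))) * (\<integral>s. ?g (p (Suc j)) s \<partial>Pi\<^sub>M {1..j} (\<lambda>_. lebesgue))"
      unfolding merge by (rule integral_mult_right_zero)
    also have "\<dots> = indicator ?S (p (Suc j)) *\<^sub>R (G (p (Suc j)) * w (Suc j) (p (Suc j)))"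
      using J[of "p (Suc j)"] by (simp add: indicator_def set_lebesgue_integral_def)
    finally show "(\<integral>s. ?f (merge {Suc j} {1..j} (p, s)) \<partial>Pi\<^sub>M {1..j} (\<lambda>_. lebesgue)) =
        indicator ?S (p (Suc j)) *\<^sub>R (G (p (Suc j)) * w (Suc j) (p (Suc j)))" .
  qed
  also have "\<dots> = (\<integral>z. indicator ?S z *\<^sub>R (G z * w (Suc j) z) \<partial>lebesgue)"
  proof (rule lebesgue_prod.product_integral_singleton[of "\<lambda>z. indicator ?S z *\<^sub>R (G z * w (Suc j) z)" "Suc j"])
    have S: "?S = {0<..<x} \<or> ?S = {x<..<0}"
    proof -
      have "\<sigma> = 1 \<or> \<sigma> = -1" using \<sigma> by linarith
      then show ?thesis by auto
    qed
    have "set_integrable lebesgue {a<..<b} (\<lambda>z. G z * w (Suc j) z)" for a b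
      using locally_integrableD[OF G, of a b] by (simp add: absolutely_integrable_on_Icc_iff_Ioo)
    then have "set_integrable lebesgue ?S (\<lambda>z. G z * w (Suc j) z)" using S by auto
    then show "(\<lambda>z. indicator ?S z *\<^sub>R (G z * w (Suc j) z)) \<in> borel_measurable lebesgue"
      unfolding set_integrable_def by (rule borel_measurable_integrable)
  qed
  finally show ?thesis unfolding set_lebesgue_integral_def .
qed

text \<open>Unoriented integrals on the left, oriented primitives on the right: each of the j
  integrations contributes one factor \<sigma>.\<close>

lemma simplex_integral_eq_iter:
  assumes u: "locally_integrable u" and v: "locally_integrable v" and \<sigma>: "\<bar>\<sigma>\<bar> = 1" and x: "0 \<le> \<sigma> * x"
  shows "(LINT s:ordered_simplex \<sigma> j x|Pi\<^sub>M {1..j} (\<lambda>_. lebesgue). alternating_prod u v j s)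
     = complex_of_real \<sigma> ^ j * biexp_iter u v j x"
  using x
proof (induction j arbitrary: x)
  case 0
  \<comment> \<open>With no coordinates the product space is a single point of mass 1, and the empty
    product is 1.\<close>
  have "space (Pi\<^sub>M {} (\<lambda>_::nat. lebesgue :: real measure)) = {\<lambda>k. undefined}"
    by (simp add: space_PiM)
  then show ?case
    by (simp add: set_lebesgue_integral_def alternating_prod_def ordered_simplex_def
        monotone_on_def PiM_empty lebesgue_integral_count_space_finite)
next
  case (Suc j)
  define w where "w = (\<lambda>i::nat. if odd i then u else v)"
  have w: "locally_integrable (w i)" for i using u v by (simp add: w_def)
  have ap: "alternating_prod u v i s = (\<Prod>k\<in>{1..i}. w k (s k))" for i s
    unfolding alternating_prod_def w_def by (intro prod.cong) auto
  have \<sigma>1: "\<sigma> = 1 \<or> \<sigma> = -1" using \<sigma> by linarith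
  define g where "g = (\<lambda>t. biexp_iter u v j t * (if even j then u t else v t))"
  have g: "locally_integrable g" unfolding g_def by (rule biexp_iter_integrand[OF u v])
  have gw: "complex_of_real \<sigma> ^ j * biexp_iter u v j z * w (Suc j) z = complex_of_real \<sigma> ^ j * g z" for z
    by (simp add: g_def w_def)
  have "(LINT s:ordered_simplex \<sigma> (Suc j) x|Pi\<^sub>M {1..Suc j} (\<lambda>_. lebesgue). alternating_prod u v (Suc j) s)
    = (LINT z:{z. 0 < \<sigma> * z \<and> \<sigma> * z < \<sigma> * x}|lebesgue. complex_of_real \<sigma> ^ j * biexp_iter u v j z * w (Suc j) z)"
    unfolding ap
  proof (rule simplex_integral_Suc[OF \<sigma> w])
    show "locally_integrable (\<lambda>z. complex_of_real \<sigma> ^ j * biexp_iter u v j z * w (Suc j) z)"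
      unfolding gw by (rule locally_integrable_cmult[OF g])
    show "(LINT s:ordered_simplex \<sigma> j z|Pi\<^sub>M {1..j} (\<lambda>_. lebesgue). \<Prod>i\<in>{1..j}. w i (s i)) =
        complex_of_real \<sigma> ^ j * biexp_iter u v j z" if "0 < \<sigma> * z" for z
      using Suc.IH[of z] that unfolding ap by simp
  qed
  also have "\<dots> = complex_of_real \<sigma> ^ j * (LINT z:{z. 0 < \<sigma> * z \<and> \<sigma> * z < \<sigma> * x}|lebesgue. g z)"
    unfolding gw by (rule set_integral_mult_right)
  \<comment> \<open>To the left of 0, \<open>prim\<close> is minus the integral over
    \<open>{x<..<0}\<close>; this is the new factor \<sigma>.\<close>
  also have "(LINT z:{z. 0 < \<sigma> * z \<and> \<sigma> * z < \<sigma> * x}|lebesgue. g z) = complex_of_real \<sigma> * prim g x"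
    using \<sigma>1
  proof
    assume "\<sigma> = 1"
    then have S: "{z. 0 < \<sigma> * z \<and> \<sigma> * z < \<sigma> * x} = {0<..<x}" "0 \<le> x" using Suc.prems by auto
    then show ?thesis
      using \<open>\<sigma> = 1\<close> set_integral_open_interval[OF locally_integrableD[OF g], of 0 x] by (simp add: prim_eq_integral[OF g])
  next
    assume "\<sigma> = -1"
    then have S: "{z. 0 < \<sigma> * z \<and> \<sigma> * z < \<sigma> * x} = {x<..<0}" "x \<le> 0" using Suc.prems by auto
    show ?thesis
      unfolding S(1) using \<open>\<sigma> = -1\<close> S(2) set_integral_open_interval[OF locally_integrableD[OF g], of x 0]
      by (cases "x = 0") (auto simp: prim_eq_integral[OF g])
  qed
  finally show ?case by (simp add: g_def mult.assoc)
qed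

lemma biexp_term_eq_iter:
  assumes u: "locally_integrable u" and v: "locally_integrable v"
  shows "biexp_term u v j x = biexp_iter u v j x"
proof -
  consider "j = 0" | "j > 0" "0 \<le> x" | "j > 0" "x < 0" by linarith
  then show ?thesis
  proof cases
    case 2
    have "{s. strict_mono_on {1..j} s \<and> (\<forall>i\<in>{1..j}. 0 < s i \<and> s i < x)} = ordered_simplex 1 j x"
      by (simp add: ordered_simplex_def)
    then show ?thesis
      using 2 simplex_integral_eq_iter[OF u v, of 1 x j] by (simp add: biexp_term_def)
  next
    case 3
    have "{s. strict_antimono_on {1..j} s \<and> (\<forall>i\<in>{1..j}. x < s i \<and> s i < 0)} = ordered_simplex (-1) j x"
      by (auto simp: ordered_simplex_def)
    then show ?thesis
      using 3 simplex_integral_eq_iter[OF u v, of "-1" x j]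
      by (simp add: biexp_term_def mult.assoc[symmetric] power_mult_distrib[symmetric])
  qed (simp add: biexp_term_def)
qed

section \<open>Convergence of the bivariate exponential\<close>

lemma prim_scaled:
  assumes "locally_integrable f"
  shows "prim (\<lambda>t. c * f t) x = c * prim f x"
  using locally_integrable_integrable[OF assms]
  by (simp add: prim_eq_integral[OF assms] prim_eq_integral[OF locally_integrable_cmult[OF assms]])

lemma has_vector_derivative_power_ae:
  assumes k: "locally_integrable k"
  shows "AE x in lebesgue. ((\<lambda>x. prim k x ^ Suc j / fact (Suc j)) has_vector_derivative
     k x * (prim k x ^ j / fact j)) (at x)"
  using prim_has_vector_derivative_ae[OF k]
proof (rule eventually_mono)
  fix x assume d: "(prim k has_vector_derivative k x) (at x)"
  have "((\<lambda>z::complex. z ^ Suc j / fact (Suc j)) has_field_derivative (prim k x ^ j / fact j)) (at (prim k x))"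
  proof -
    have "((\<lambda>z::complex. z ^ Suc j) has_field_derivative of_nat (Suc j) * prim k x ^ j) (at (prim k x))"
      by (auto intro!: derivative_eq_intros simp del: power_Suc)
    from DERIV_cdivide[OF this, of "fact (Suc j)"] show ?thesis
      by (simp add: fact_Suc del: power_Suc of_nat_Suc)
  qed
  from field_vector_diff_chain_at[OF d this]
  show "((\<lambda>x. prim k x ^ Suc j / fact (Suc j)) has_vector_derivative k x * (prim k x ^ j / fact j)) (at x)"
    by (simp add: o_def)
qed

lemma loc_abs_continuous_power:
  fixes y :: "real \<Rightarrow> complex"
  assumes "loc_abs_continuous y"
  shows "loc_abs_continuous (\<lambda>x. y x ^ n)"
  by (induction n) (auto intro: loc_abs_continuous_const loc_abs_continuous_mult assms)

lemma has_integral_of_ae_derivative: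
  fixes y :: "real \<Rightarrow> complex"
  assumes y: "loc_abs_continuous y" and d: "AE x in lebesgue. (y has_vector_derivative f x) (at x)"
    and st: "s \<le> t"
  shows "(f has_integral (y t - y s)) {s..t}"
proof -
  have neg: "negligible {x. \<not> (y has_vector_derivative f x) (at x)}"
    using d by (simp add: AE_lebesgue_iff_negligible)
  show ?thesis
    by (rule has_integral_spike[OF neg _ loc_abs_continuous_derivative(3)[OF y st]])
      (auto dest: vector_derivative_at)
qed

lemma prim_norm_real:
  assumes "locally_integrable u"
  shows "prim (\<lambda>t. complex_of_real (norm (u t))) x
    = complex_of_real (Re (prim (\<lambda>t. complex_of_real (norm (u t))) x))"
proof -
  let ?k = "\<lambda>t. complex_of_real (norm (u t))"
  have k: "locally_integrable ?k" by (rule locally_integrable_norm[OF assms])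
  have "Im (integral {a..b} ?k) = integral {a..b} (\<lambda>t. 0)" for a b
    using integral_linear[OF locally_integrable_integrable[OF k] bounded_linear_Im, of a b] by (simp add: o_def)
  then show ?thesis by (simp add: prim_eq_integral[OF k] complex_eq_iff)
qed

text \<open>With \<open>W\<close> the primitive of the norm of \<open>k\<close>, the derivative of
  \<open>W ^ Suc j / fact (Suc j)\<close> is that norm times \<open>W ^ j / fact j\<close>. So each
  integration raises the exponent by one, and the factorials make the series converge like an
  exponential.\<close>

lemma norm_biexp_iter_le:
  assumes u: "locally_integrable u" and v: "locally_integrable v"
    and k: "locally_integrable k" and le: "\<And>t. norm (u t) \<le> norm (k t)" "\<And>t. norm (v t) \<le> norm (k t)"
  shows "norm (biexp_iter u v j x) \<le> norm (prim (\<lambda>t. complex_of_real (norm (k t))) x) ^ j / fact j"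
proof (induction j arbitrary: x)
  case (Suc j)
  let ?k = "\<lambda>t. complex_of_real (norm (k t))"
  define W where "W = (\<lambda>x. Re (prim ?k x))"
  have lk: "locally_integrable ?k" by (rule locally_integrable_norm[OF k])
  have V: "prim ?k x = complex_of_real (W x)" for x unfolding W_def by (rule prim_norm_real[OF k])
  have nV: "norm (prim ?k x) = \<bar>W x\<bar>" for x by (simp add: V)
  have W_int: "((\<lambda>t. norm (k t)) has_integral (W t - W s)) {s..t}" if "s \<le> t" for s t
    using has_integral_linear[OF prim_diff[OF lk that] bounded_linear_Re] by (simp add: o_def W_def)
  have W0: "W 0 = 0" by (simp add: W_def prim_0)
  have W_mono: "W s \<le> W t" if "s \<le> t" for s t
    using has_integral_nonneg[OF W_int[OF that]] by simp
  let ?g = "\<lambda>t. biexp_iter u v j t * (if even j then u t else v t)"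
  have g: "locally_integrable ?g" by (rule biexp_iter_integrand[OF u v])
  have bound: "norm (?g t) \<le> norm (k t) * (\<bar>W t\<bar> ^ j / fact j)" for t
  proof -
    have "norm (?g t) \<le> (\<bar>W t\<bar> ^ j / fact j) * norm (k t)"
      unfolding norm_mult using Suc.IH[of t] le by (intro mult_mono) (auto simp: nV)
    then show ?thesis by (simp add: mult.commute)
  qed
  have P: "((\<lambda>t. norm (k t) * (W t ^ j / fact j)) has_integral (W t ^ Suc j / fact (Suc j) - W s ^ Suc j / fact (Suc j))) {s..t}"
    if "s \<le> t" for s t
  proof -
    have lac: "loc_abs_continuous (\<lambda>x. prim ?k x ^ Suc j / fact (Suc j))"
      unfolding divide_inverse
      by (intro loc_abs_continuous_mult loc_abs_continuous_power loc_abs_continuous_prim[OF lk] loc_abs_continuous_const)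
    have "((\<lambda>x. ?k x * (prim ?k x ^ j / fact j)) has_integral
        (prim ?k t ^ Suc j / fact (Suc j) - prim ?k s ^ Suc j / fact (Suc j))) {s..t}"
      by (rule has_integral_of_ae_derivative[OF lac has_vector_derivative_power_ae[OF lk] that])
    from has_integral_linear[OF this bounded_linear_Re]
    have "((\<lambda>x. Re (complex_of_real (norm (k x) * (W x ^ j / fact j)))) has_integral
        Re (complex_of_real (W t ^ Suc j / fact (Suc j) - W s ^ Suc j / fact (Suc j)))) {s..t}"
      unfolding o_def V by (simp only: of_real_mult of_real_power of_real_divide of_real_fact of_real_diff)
    then show ?thesis by (simp only: Re_complex_of_real)
  qed
  show ?case
  proof (cases "0 \<le> x")
    case True
    have "norm (integral {0..x} ?g) \<le> integral {0..x} (\<lambda>t. norm (k t) * (W t ^ j / fact j))"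
    proof (rule integral_norm_bound_integral)
      show "?g integrable_on {0..x}" by (rule locally_integrable_integrable[OF g])
      show "(\<lambda>t. norm (k t) * (W t ^ j / fact j)) integrable_on {0..x}" using P[OF True] by blast
      fix t assume "t \<in> {0..x}"
      then have "0 \<le> W t" using W_mono[of 0 t] W0 by simp
      then show "norm (?g t) \<le> norm (k t) * (W t ^ j / fact j)" using bound[of t] by simp
    qed
    also have "\<dots> = W x ^ Suc j / fact (Suc j)" using integral_unique[OF P[OF True]] W0 by simp
    also have "\<dots> \<le> \<bar>W x\<bar> ^ Suc j / fact (Suc j)"
      by (intro divide_right_mono) (auto simp: power_abs[symmetric] simp del: power_Suc)
    finally show ?thesis using True by (simp add: prim_eq_integral[OF g] nV del: power_Suc fact_Suc)
  next
    case False
    then have x0: "x \<le> 0" by simp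
    \<comment> \<open>\<open>W\<close> is increasing with \<open>W 0 = 0\<close>, hence nonpositive
      here; the sign (-1)^j turns its j-th power into that of its absolute value, so that
      \<open>P\<close> still integrates the majorant.\<close>
    have "norm (integral {x..0} ?g) \<le> integral {x..0} (\<lambda>t. (-1) ^ j * (norm (k t) * (W t ^ j / fact j)))"
    proof (rule integral_norm_bound_integral)
      show "?g integrable_on {x..0}" by (rule locally_integrable_integrable[OF g])
      show "(\<lambda>t. (-1) ^ j * (norm (k t) * (W t ^ j / fact j))) integrable_on {x..0}"
        using has_integral_mult_right[OF P[OF x0]] by blast
      fix t assume "t \<in> {x..0}"
      then have "W t \<le> 0" using W_mono[of t 0] W0 by simp
      then have "\<bar>W t\<bar> ^ j = (-1) ^ j * W t ^ j" by (simp add: power_mult_distrib[symmetric])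
      then show "norm (?g t) \<le> (-1) ^ j * (norm (k t) * (W t ^ j / fact j))" using bound[of t] by (simp add: mult_ac)
    qed
    also have "\<dots> = (-1) ^ j * (0 - W x ^ Suc j / fact (Suc j))"
      using integral_unique[OF has_integral_mult_right[OF P[OF x0]]] W0 by simp
    also have "\<dots> = (- W x) ^ Suc j / fact (Suc j)"
      unfolding power_minus[of "W x"] by simp
    also have "\<dots> \<le> \<bar>W x\<bar> ^ Suc j / fact (Suc j)"
      using W_mono[OF x0] W0 by (intro divide_right_mono power_mono) auto
    finally show ?thesis using False by (simp add: prim_eq_integral[OF g] nV del: power_Suc fact_Suc)
  qed
qed simp

text \<open>Dominated convergence for the partial sums on compact intervals, with a multiple of the
  norm of \<open>g\<close> as majorant; the bound need only be uniform in \<open>n\<close>.\<close>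

lemma prim_sums:
  assumes f: "\<And>n. locally_integrable (f n)" and g: "locally_integrable g"
    and bound: "\<And>a b. \<exists>B. \<forall>n. \<forall>t\<in>{a..b}. norm (\<Sum>i<n. f i t) \<le> B * norm (g t)"
    and sums: "\<And>t. (\<lambda>n. f n t) sums F t"
  shows "locally_integrable F" and "(\<lambda>n. prim (f n) x) sums prim F x"
proof -
  have sum_li: "locally_integrable (\<lambda>t. \<Sum>i<n. f i t)" for n
  proof (induction n)
    case 0
    show ?case by (simp add: locally_integrable_def)
  qed (simp add: locally_integrable_add f)
  have sum_int: "integral {a..b} (\<lambda>t. \<Sum>i<n. f i t) = (\<Sum>i<n. integral {a..b} (f i))" for a b n
    by (intro integral_sum locally_integrable_integrable f) auto
  have dom: "F absolutely_integrable_on {a..b} \<and> (\<lambda>n. integral {a..b} (f n)) sums integral {a..b} F" for a b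
  proof
    obtain B where B: "\<forall>n. \<forall>t\<in>{a..b}. norm (\<Sum>i<n. f i t) \<le> B * norm (g t)" using bound by blast
    have h: "(\<lambda>t. B * norm (g t)) integrable_on {a..b}"
      using locally_integrableD[OF g, of a b]
      by (intro integrable_on_mult_right) (simp add: absolutely_integrable_on_def)
    show "F absolutely_integrable_on {a..b}"
    proof (rule dominated_convergence_absolutely_integrable)
      show "(\<lambda>t. \<Sum>i<n. f i t) absolutely_integrable_on {a..b}" for n
        by (rule locally_integrableD[OF sum_li])
      show lim: "(\<lambda>n. \<Sum>i<n. f i t) \<longlonglongrightarrow> F t" for t using sums[of t] by (simp add: sums_def)
      show "norm (F t) \<le> B * norm (g t)" if "t \<in> {a..b}" for t
        by (rule LIMSEQ_le_const2[OF tendsto_norm[OF lim]]) (use B that in auto)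
    qed (use h B in auto)
    have "(\<lambda>n. integral {a..b} (\<lambda>t. \<Sum>i<n. f i t)) \<longlonglongrightarrow> integral {a..b} F"
    proof (rule dominated_convergence(2))
      show "(\<lambda>t. \<Sum>i<n. f i t) integrable_on {a..b}" for n
        by (rule locally_integrable_integrable[OF sum_li])
      show "(\<lambda>n. \<Sum>i<n. f i t) \<longlonglongrightarrow> F t" for t using sums[of t] by (simp add: sums_def)
    qed (use h B in auto)
    then show "(\<lambda>n. integral {a..b} (f n)) sums integral {a..b} F"
      by (simp add: sums_def sum_int)
  qed
  show F: "locally_integrable F" using dom unfolding locally_integrable_def by blast
  show "(\<lambda>n. prim (f n) x) sums prim F x"
    using dom[of 0 x] dom[of x 0] by (auto simp: prim_eq_integral[OF F] prim_eq_integral[OF f] intro: sums_minus)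
qed

text \<open>The function \<open>k\<close> dominates both \<open>u\<close> and \<open>v\<close>, so
  the factorial bound compares the series with an exponential series, uniformly where the primitive
  of the norm of \<open>k\<close> is bounded.\<close>

lemma
  assumes u: "locally_integrable u" and v: "locally_integrable v"
  shows summable_biexp_iter: "summable (\<lambda>j. norm (biexp_iter u v j x))"
    and sum_biexp_iter_bounded: "\<exists>B. \<forall>x\<in>{a..b}. \<forall>n. (\<Sum>j<n. norm (biexp_iter u v j x)) \<le> B"
proof -
  define k where "k = (\<lambda>t. complex_of_real (norm (u t)) + complex_of_real (norm (v t)))"
  have k: "locally_integrable k"
    unfolding k_def by (intro locally_integrable_add locally_integrable_norm u v)
  have nk: "norm (k t) = norm (u t) + norm (v t)" for t
    unfolding k_def of_real_add[symmetric] norm_of_real by simp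
  define V where "V = prim (\<lambda>t. complex_of_real (norm (k t)))"
  have le: "norm (biexp_iter u v j x) \<le> norm (V x) ^ j / fact j" for j x
    unfolding V_def by (rule norm_biexp_iter_le[OF u v k]) (auto simp: nk)
  have sm: "summable (\<lambda>j. r ^ j / fact j)" for r :: real
    using summable_exp[of r] by (simp add: divide_inverse mult.commute)
  show "summable (\<lambda>j. norm (biexp_iter u v j x))"
    by (rule summable_comparison_test'[OF sm[of "norm (V x)"], of 0]) (use le in auto)
  have "loc_abs_continuous V" unfolding V_def by (intro loc_abs_continuous_prim locally_integrable_norm k)
  then obtain B where B: "B \<ge> 0" "\<And>x. x \<in> {a..b} \<Longrightarrow> norm (V x) \<le> B"
    by (rule loc_abs_continuous_bounded[of V a b]) blast
  show "\<exists>B. \<forall>x\<in>{a..b}. \<forall>n. (\<Sum>j<n. norm (biexp_iter u v j x)) \<le> B"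
  proof (intro exI[of _ "\<Sum>j. B ^ j / fact j"] ballI allI)
    fix x n assume x: "x \<in> {a..b}"
    have "(\<Sum>j<n. norm (biexp_iter u v j x)) \<le> (\<Sum>j<n. B ^ j / fact j)"
    proof (rule sum_mono)
      fix j
      have "norm (V x) ^ j / fact j \<le> B ^ j / fact j"
        using B x by (intro divide_right_mono power_mono) auto
      then show "norm (biexp_iter u v j x) \<le> B ^ j / fact j" using le order_trans by blast
    qed
    also have "\<dots> \<le> (\<Sum>j. B ^ j / fact j)"
      using B(1) by (intro sum_le_suminf sm) auto
    finally show "(\<Sum>j<n. norm (biexp_iter u v j x)) \<le> (\<Sum>j. B ^ j / fact j)" .
  qed
qed

text \<open>Negating both functions multiplies the term of order j by (-1)^j. Hence
  \<open>bicosh\<close> and \<open>bisinh\<close> collect the terms of even and odd order.\<close>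

lemma biexp_iter_uminus:
  assumes u: "locally_integrable u" and v: "locally_integrable v"
  shows "biexp_iter (\<lambda>t. - u t) (\<lambda>t. - v t) j = (\<lambda>x. (-1) ^ j * biexp_iter u v j x)"
proof (induction j)
  case (Suc j)
  have "(\<lambda>t. (-1) ^ j * biexp_iter u v j t * (if even j then - u t else - v t)) =
      (\<lambda>t. (-1) ^ Suc j * (biexp_iter u v j t * (if even j then u t else v t)))"
    by (auto simp: fun_eq_iff)
  then show ?case
    by (simp only: biexp_iter.simps Suc prim_scaled[OF biexp_iter_integrand[OF u v]])
qed simp

lemma biexp_eq_suminf_iter:
  assumes u: "locally_integrable u" and v: "locally_integrable v"
  shows "(\<lambda>j. biexp_iter u v j x) sums biexp u v x"
proof -
  have s: "summable (\<lambda>j. biexp_iter u v j x)"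
    by (rule summable_norm_cancel[OF summable_biexp_iter[OF u v]])
  have "biexp u v x = 1 + (\<Sum>j. biexp_iter u v (Suc j) x)"
    unfolding biexp_def biexp_term_eq_iter[OF u v] ..
  also have "\<dots> = (\<Sum>j. biexp_iter u v j x)"
    using suminf_split_head[OF s] by simp
  finally show ?thesis using s by (simp add: summable_sums)
qed

lemma
  assumes u: "locally_integrable u" and v: "locally_integrable v"
  shows bicosh_sums: "(\<lambda>j. if even j then biexp_iter u v j x else 0) sums bicosh u v x"
    and bisinh_sums: "(\<lambda>j. if odd j then biexp_iter u v j x else 0) sums bisinh u v x"
proof -
  have 1: "(\<lambda>j. biexp_iter u v j x) sums biexp u v x" by (rule biexp_eq_suminf_iter[OF u v])
  have 2: "(\<lambda>j. (-1) ^ j * biexp_iter u v j x) sums biexp (\<lambda>t. - u t) (\<lambda>t. - v t) x"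
    using biexp_eq_suminf_iter[OF locally_integrable_uminus[OF u] locally_integrable_uminus[OF v], of x]
    by (simp only: biexp_iter_uminus[OF u v])
  have e: "(\<lambda>j. (biexp_iter u v j x + (-1) ^ j * biexp_iter u v j x) / 2) = (\<lambda>j. if even j then biexp_iter u v j x else 0)"
    "(\<lambda>j. (biexp_iter u v j x - (-1) ^ j * biexp_iter u v j x) / 2) = (\<lambda>j. if odd j then biexp_iter u v j x else 0)"
    by (auto simp: fun_eq_iff)
  show "(\<lambda>j. if even j then biexp_iter u v j x else 0) sums bicosh u v x"
    using sums_divide[OF sums_add[OF 1 2], of 2] unfolding e bicosh_def .
  show "(\<lambda>j. if odd j then biexp_iter u v j x else 0) sums bisinh u v x"
    using sums_divide[OF sums_diff[OF 1 2], of 2] unfolding e bisinh_def .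
qed

text \<open>Termwise integration of a part of the series against \<open>g\<close>; below,
  \<open>P\<close> is a parity. The partial sums are bounded by a local bound for the norm series
  times the norm of \<open>g\<close>.\<close>

lemma biexp_part_prim_sums:
  assumes u: "locally_integrable u" and v: "locally_integrable v" and g: "locally_integrable g"
    and S: "\<And>t. (\<lambda>j. if P j then biexp_iter u v j t else 0) sums S t"
  shows "locally_integrable (\<lambda>t. S t * g t)"
    and "(\<lambda>j. if P j then prim (\<lambda>t. biexp_iter u v j t * g t) x else 0) sums prim (\<lambda>t. S t * g t) x"
proof -
  define f where "f = (\<lambda>j t. (if P j then biexp_iter u v j t else 0) * g t)"
  have f: "locally_integrable (f j)" for j
  proof (cases "P j")
    case True
    then show ?thesis
      unfolding f_def using locally_integrable_mult[OF loc_abs_continuous_biexp_iter[OF u v] g] by simp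
  qed (simp add: f_def locally_integrable_def)
  have bound: "\<exists>B. \<forall>n. \<forall>t\<in>{a..b}. norm (\<Sum>i<n. f i t) \<le> B * norm (g t)" for a b
  proof -
    obtain B where B: "\<forall>t\<in>{a..b}. \<forall>n. (\<Sum>j<n. norm (biexp_iter u v j t)) \<le> B"
      using sum_biexp_iter_bounded[OF u v] by blast
    have "norm (\<Sum>i<n. f i t) \<le> B * norm (g t)" if "t \<in> {a..b}" for n t
    proof -
      have "norm (\<Sum>i<n. f i t) = norm (\<Sum>i<n. if P i then biexp_iter u v i t else 0) * norm (g t)"
        unfolding f_def sum_distrib_right[symmetric] norm_mult ..
      also have "norm (\<Sum>i<n. if P i then biexp_iter u v i t else 0) \<le> (\<Sum>i<n. norm (if P i then biexp_iter u v i t else 0))"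
        by (rule norm_sum)
      also have "\<dots> \<le> (\<Sum>i<n. norm (biexp_iter u v i t))" by (intro sum_mono) auto
      also have "\<dots> \<le> B" using B that by blast
      finally show ?thesis by (simp add: mult_right_mono)
    qed
    then show ?thesis by blast
  qed
  have sums: "(\<lambda>n. f n t) sums (S t * g t)" for t
    unfolding f_def by (rule sums_mult2[OF S])
  show "locally_integrable (\<lambda>t. S t * g t)" by (rule prim_sums(1)[OF f g bound sums])
  have "prim (f j) x = (if P j then prim (\<lambda>t. biexp_iter u v j t * g t) x else 0)" for j
    by (simp add: f_def prim_def interval_lebesgue_integral_def set_lebesgue_integral_def)
  then show "(\<lambda>j. if P j then prim (\<lambda>t. biexp_iter u v j t * g t) x else 0) sums prim (\<lambda>t. S t * g t) x"
    using prim_sums(2)[OF f g bound sums, of x] by simp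
qed

text \<open>An index shift: integrating the even terms against \<open>u\<close> gives the odd ones,
  and integrating the odd terms against \<open>v\<close> gives the even ones except the term of
  order 0, which is 1.\<close>

lemma
  assumes u: "locally_integrable u" and v: "locally_integrable v"
  shows bisinh_eq_prim: "bisinh u v x = prim (\<lambda>t. bicosh u v t * u t) x"
    and bicosh_eq_prim: "bicosh u v x = 1 + prim (\<lambda>t. bisinh u v t * v t) x"
proof -
  have "(\<lambda>j. if even j then prim (\<lambda>t. biexp_iter u v j t * u t) x else 0) sums prim (\<lambda>t. bicosh u v t * u t) x"
    by (rule biexp_part_prim_sums(2)[OF u v u bicosh_sums[OF u v]])
  also have "(\<lambda>j. if even j then prim (\<lambda>t. biexp_iter u v j t * u t) x else 0) =
      (\<lambda>j. if odd (Suc j) then biexp_iter u v (Suc j) x else 0)"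
    by (auto simp: fun_eq_iff)
  finally have "(\<lambda>j. if odd j then biexp_iter u v j x else 0) sums (prim (\<lambda>t. bicosh u v t * u t) x + 0)"
    by (subst (asm) sums_Suc_iff) simp
  from sums_unique2[OF bisinh_sums[OF u v] this] show "bisinh u v x = prim (\<lambda>t. bicosh u v t * u t) x" by simp
next
  have "(\<lambda>j. if odd j then prim (\<lambda>t. biexp_iter u v j t * v t) x else 0) sums prim (\<lambda>t. bisinh u v t * v t) x"
    by (rule biexp_part_prim_sums(2)[OF u v v bisinh_sums[OF u v]])
  also have "(\<lambda>j. if odd j then prim (\<lambda>t. biexp_iter u v j t * v t) x else 0) =
      (\<lambda>j. if even (Suc j) then biexp_iter u v (Suc j) x else 0)"
    by (auto simp: fun_eq_iff)
  finally have "(\<lambda>j. if even j then biexp_iter u v j x else 0) sums (prim (\<lambda>t. bisinh u v t * v t) x + 1)"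
    by (subst (asm) sums_Suc_iff) simp
  from sums_unique2[OF bicosh_sums[OF u v] this]
  show "bicosh u v x = 1 + prim (\<lambda>t. bisinh u v t * v t) x" by simp
qed

lemma
  assumes u: "locally_integrable u" and v: "locally_integrable v"
  shows loc_abs_continuous_bicosh: "loc_abs_continuous (bicosh u v)"
    and loc_abs_continuous_bisinh: "loc_abs_continuous (bisinh u v)"
    and bicosh_0: "bicosh u v 0 = 1" and bisinh_0: "bisinh u v 0 = 0"
    and bicosh_derivative: "AE x in lebesgue. (bicosh u v has_vector_derivative v x * bisinh u v x) (at x)"
    and bisinh_derivative: "AE x in lebesgue. (bisinh u v has_vector_derivative u x * bicosh u v x) (at x)"
proof -
  have c: "bicosh u v = (\<lambda>x. 1 + prim (\<lambda>t. bisinh u v t * v t) x)"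
    and s: "bisinh u v = prim (\<lambda>t. bicosh u v t * u t)"
    by (rule ext, rule bicosh_eq_prim[OF u v]) (rule ext, rule bisinh_eq_prim[OF u v])
  have su: "locally_integrable (\<lambda>t. bicosh u v t * u t)"
    by (rule biexp_part_prim_sums(1)[OF u v u bicosh_sums[OF u v]])
  have cv: "locally_integrable (\<lambda>t. bisinh u v t * v t)"
    by (rule biexp_part_prim_sums(1)[OF u v v bisinh_sums[OF u v]])
  show "loc_abs_continuous (bicosh u v)"
    by (subst c) (intro loc_abs_continuous_add loc_abs_continuous_const loc_abs_continuous_prim cv)
  show "loc_abs_continuous (bisinh u v)"
    by (subst s) (intro loc_abs_continuous_prim su)
  show "bicosh u v 0 = 1" "bisinh u v 0 = 0"
    using bicosh_eq_prim[OF u v, of 0] bisinh_eq_prim[OF u v, of 0] by (simp_all add: prim_0)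
  show "AE x in lebesgue. (bicosh u v has_vector_derivative v x * bisinh u v x) (at x)"
    using prim_has_vector_derivative_ae[OF cv]
  proof (rule eventually_mono)
    fix x assume d: "(prim (\<lambda>t. bisinh u v t * v t) has_vector_derivative bisinh u v x * v x) (at x)"
    have "((\<lambda>x. 1 + prim (\<lambda>t. bisinh u v t * v t) x) has_vector_derivative v x * bisinh u v x) (at x)"
      using has_vector_derivative_add[OF has_vector_derivative_const[of 1] d] by (simp add: mult.commute)
    then show "(bicosh u v has_vector_derivative v x * bisinh u v x) (at x)" using c by simp
  qed
  show "AE x in lebesgue. (bisinh u v has_vector_derivative u x * bicosh u v x) (at x)"
    using prim_has_vector_derivative_ae[OF su]
  proof (rule eventually_mono)
    fix x assume "(prim (\<lambda>t. bicosh u v t * u t) has_vector_derivative bicosh u v x * u x) (at x)"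
    then show "(bisinh u v has_vector_derivative u x * bicosh u v x) (at x)"
      by (subst s) (simp add: mult.commute)
  qed
qed

section \<open>Two-by-two matrix functions\<close>

lemma mat2_nth [simp]:
  "mat2 a b c d $ 1 $ 1 = a" "mat2 a b c d $ 1 $ 2 = b" "mat2 a b c d $ 2 $ 1 = c" "mat2 a b c d $ 2 $ 2 = d"
  by (simp_all add: mat2_def vector_2)

lemma mat2_eta: "mat2 (N$1$1) (N$1$2) (N$2$1) (N$2$2) = N"
  by (simp add: vec_eq_iff forall_2)

lemma mat2_eq_iff: "M = N \<longleftrightarrow> M$1$1 = N$1$1 \<and> M$1$2 = N$1$2 \<and> M$2$1 = N$2$1 \<and> M$2$2 = N$2$2"
  for M N :: "complex^2^2"
  by (auto simp: vec_eq_iff forall_2)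

lemma mat2_mult_nth: "(A ** B) $ i $ j = A $ i $ 1 * B $ 1 $ j + A $ i $ 2 * B $ 2 $ j"
  for A B :: "complex^2^2"
  by (simp add: matrix_matrix_mult_def sum_2)

lemma bounded_linear_matrix_nth: "bounded_linear (\<lambda>N::complex^2^2. N $ i $ j)"
  by (rule bounded_linear_compose[OF bounded_linear_vec_nth bounded_linear_vec_nth])

lemma bounded_linear_mat2:
  "bounded_linear (\<lambda>z. mat2 z 0 0 0)" "bounded_linear (\<lambda>z. mat2 0 z 0 0)"
  "bounded_linear (\<lambda>z. mat2 0 0 z 0)" "bounded_linear (\<lambda>z. mat2 0 0 0 z)"
  unfolding linear_conv_bounded_linear[symmetric]
  by (auto intro!: linearI simp: mat2_eq_iff)

lemma mat2_sum: "mat2 a b c d = mat2 a 0 0 0 + mat2 0 b 0 0 + mat2 0 0 c 0 + mat2 0 0 0 d"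
  by (simp add: mat2_eq_iff)

lemma loc_abs_continuous_nth:
  "loc_abs_continuous M \<Longrightarrow> loc_abs_continuous (\<lambda>x. (M x :: complex^2^2) $ i $ j)"
  by (rule loc_abs_continuous_linear[OF bounded_linear_matrix_nth])

lemma loc_abs_continuous_mat2:
  assumes "loc_abs_continuous a" "loc_abs_continuous b" "loc_abs_continuous c" "loc_abs_continuous d"
  shows "loc_abs_continuous (\<lambda>x. mat2 (a x) (b x) (c x) (d x))"
  by (subst mat2_sum)
    (intro loc_abs_continuous_add bounded_linear_mat2[THEN loc_abs_continuous_linear] assms)

lemma has_vector_derivative_mat2_iff:
  "(N has_vector_derivative D) (at x) \<longleftrightarrow>
    ((\<lambda>x. N x $ 1 $ 1) has_vector_derivative D $ 1 $ 1) (at x) \<and>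
    ((\<lambda>x. N x $ 1 $ 2) has_vector_derivative D $ 1 $ 2) (at x) \<and>
    ((\<lambda>x. N x $ 2 $ 1) has_vector_derivative D $ 2 $ 1) (at x) \<and>
    ((\<lambda>x. N x $ 2 $ 2) has_vector_derivative D $ 2 $ 2) (at x)" (is "?L \<longleftrightarrow> ?R")
  for N :: "real \<Rightarrow> complex^2^2"
proof
  assume ?L
  then show ?R using bounded_linear.has_vector_derivative[OF bounded_linear_matrix_nth] by blast
next
  assume R: ?R
  have "((\<lambda>x. mat2 (N x $ 1 $ 1) 0 0 0 + mat2 0 (N x $ 1 $ 2) 0 0 + mat2 0 0 (N x $ 2 $ 1) 0 + mat2 0 0 0 (N x $ 2 $ 2))
    has_vector_derivative (mat2 (D $ 1 $ 1) 0 0 0 + mat2 0 (D $ 1 $ 2) 0 0 + mat2 0 0 (D $ 2 $ 1) 0 + mat2 0 0 0 (D $ 2 $ 2))) (at x)"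
    using R by (intro has_vector_derivative_add bounded_linear_mat2[THEN bounded_linear.has_vector_derivative]) auto
  then show ?L unfolding mat2_sum[symmetric] mat2_eta .
qed

section \<open>The linear system\<close>

text \<open>One column \<open>(n, m)\<close> of the matrix equation. Working by columns suits the
  Wronskians, and \<open>n / m\<close> is the Riccati solution sought.\<close>

definition system_solution ::
    "(real \<Rightarrow> complex) \<Rightarrow> (real \<Rightarrow> complex) \<Rightarrow> (real \<Rightarrow> complex) \<Rightarrow> (real \<Rightarrow> complex) \<Rightarrow> (real \<Rightarrow> complex) \<Rightarrow> bool" where
  "system_solution f g h n m \<longleftrightarrow>
     (AE x in lebesgue. (n has_vector_derivative g x / 2 * n x + h x * m x) (at x)
        \<and> (m has_vector_derivative - f x * n x - g x / 2 * m x) (at x))"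

abbreviation (input) matrix_solution ::
    "(real \<Rightarrow> complex) \<Rightarrow> (real \<Rightarrow> complex) \<Rightarrow> (real \<Rightarrow> complex) \<Rightarrow> (real \<Rightarrow> complex^2^2) \<Rightarrow> bool" where
  "matrix_solution f g h N \<equiv>
     AE x in lebesgue. (N has_vector_derivative mat2 (g x / 2) (h x) (- f x) (- g x / 2) ** N x) (at x)"

lemma matrix_solution_iff:
  "matrix_solution f g h N \<longleftrightarrow>
     system_solution f g h (\<lambda>x. N x $ 1 $ 1) (\<lambda>x. N x $ 2 $ 1) \<and>
     system_solution f g h (\<lambda>x. N x $ 1 $ 2) (\<lambda>x. N x $ 2 $ 2)"
  unfolding system_solution_def eventually_conj_iff[symmetric]
  by (rule eventually_cong) (auto simp: has_vector_derivative_mat2_iff mat2_mult_nth)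

text \<open>The system is trace-free, so the derivative of the determinant of two solutions cancels
  almost everywhere.\<close>

lemma system_solution_wronskian:
  assumes sol: "system_solution f g h n1 m1" "system_solution f g h n2 m2"
    and lac: "loc_abs_continuous n1" "loc_abs_continuous m1" "loc_abs_continuous n2" "loc_abs_continuous m2"
  shows "n1 x * m2 x - m1 x * n2 x = n1 0 * m2 0 - m1 0 * n2 0"
proof (rule loc_abs_continuous_zero_derivative_const)
  show "loc_abs_continuous (\<lambda>x. n1 x * m2 x - m1 x * n2 x)"
    by (intro loc_abs_continuous_diff loc_abs_continuous_mult lac)
  show "AE x in lebesgue. ((\<lambda>x. n1 x * m2 x - m1 x * n2 x) has_vector_derivative 0) (at x)"
    using sol unfolding system_solution_def
  proof eventually_elim
    case (elim x)
    then show ?case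
      by (auto intro!: derivative_eq_intros simp: algebra_simps)
  qed
qed

lemma system_solution_linear_combination:
  assumes "system_solution f g h n1 m1" "system_solution f g h n2 m2"
  shows "system_solution f g h (\<lambda>x. n1 x * z + n2 x) (\<lambda>x. m1 x * z + m2 x)"
  using assms unfolding system_solution_def
proof eventually_elim
  case (elim x)
  then show ?case
    by (auto intro!: derivative_eq_intros simp: algebra_simps)
qed

lemma SL2_pathsD:
  assumes "M \<in> SL2_paths"
  shows "loc_abs_continuous M" "M x $ 1 $ 1 * M x $ 2 $ 2 - M x $ 1 $ 2 * M x $ 2 $ 1 = 1"
    "M 0 $ 1 $ 1 = 1" "M 0 $ 1 $ 2 = 0" "M 0 $ 2 $ 1 = 0" "M 0 $ 2 $ 2 = 1"
  using assms by (auto simp: SL2_paths_def det_2 mat_def)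

text \<open>The determinant is the Wronskian of the two columns, equal to 1 at 0.\<close>

lemma matrix_solution_in_SL2_paths:
  assumes N: "loc_abs_continuous N" "matrix_solution f g h N" "N 0 = mat 1"
  shows "N \<in> SL2_paths"
proof -
  have "N x $ 1 $ 1 * N x $ 2 $ 2 - N x $ 2 $ 1 * N x $ 1 $ 2 = 1" for x
    using system_solution_wronskian[of f g h "\<lambda>x. N x $ 1 $ 1" "\<lambda>x. N x $ 2 $ 1" "\<lambda>x. N x $ 1 $ 2" "\<lambda>x. N x $ 2 $ 2" x]
      N(2)[unfolded matrix_solution_iff] N(3) loc_abs_continuous_nth[OF N(1)]
    by (simp add: mat_def)
  then show ?thesis using N by (simp add: SL2_paths_def det_2 mult.commute)
qed

text \<open>The Wronskians of the columns of \<open>M\<close> with those of \<open>N\<close> are, up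
  to sign and position, the entries of the inverse of \<open>M x\<close> times \<open>N x\<close>.
  They keep their values at 0, so this product stays the identity.\<close>

lemma matrix_solution_unique:
  assumes M: "loc_abs_continuous M" "matrix_solution f g h M" "M 0 = mat 1"
    and N: "loc_abs_continuous N" "matrix_solution f g h N" "N 0 = mat 1"
  shows "N = M"
proof
  fix x
  have det: "M x $ 1 $ 1 * M x $ 2 $ 2 - M x $ 1 $ 2 * M x $ 2 $ 1 = 1"
    by (rule SL2_pathsD(2)[OF matrix_solution_in_SL2_paths[OF M]])
  have W: "M x $ 1 $ i * N x $ 2 $ j - M x $ 2 $ i * N x $ 1 $ j = M 0 $ 1 $ i * N 0 $ 2 $ j - M 0 $ 2 $ i * N 0 $ 1 $ j"
    if "i = 1 \<or> i = 2" "j = 1 \<or> j = 2" for i j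
    using that M(2)[unfolded matrix_solution_iff] N(2)[unfolded matrix_solution_iff]
      loc_abs_continuous_nth[OF M(1)] loc_abs_continuous_nth[OF N(1)]
    by (intro system_solution_wronskian[of f g h "\<lambda>x. M x $ 1 $ i" "\<lambda>x. M x $ 2 $ i" "\<lambda>x. N x $ 1 $ j" "\<lambda>x. N x $ 2 $ j" x])
      auto
  have w: "M x $ 1 $ 1 * N x $ 2 $ 1 - M x $ 2 $ 1 * N x $ 1 $ 1 = 0"
    "M x $ 1 $ 2 * N x $ 2 $ 1 - M x $ 2 $ 2 * N x $ 1 $ 1 = -1"
    "M x $ 1 $ 1 * N x $ 2 $ 2 - M x $ 2 $ 1 * N x $ 1 $ 2 = 1"
    "M x $ 1 $ 2 * N x $ 2 $ 2 - M x $ 2 $ 2 * N x $ 1 $ 2 = 0"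
    using W[of 1 1] W[of 2 1] W[of 1 2] W[of 2 2] M(3) N(3) by (simp_all add: mat_def)
  have "N x $ 1 $ 1 = M x $ 1 $ 1" "N x $ 2 $ 1 = M x $ 2 $ 1" using det w(1,2) by algebra+
  moreover have "N x $ 1 $ 2 = M x $ 1 $ 2" "N x $ 2 $ 2 = M x $ 2 $ 2" using det w(3,4) by algebra+
  ultimately show "N x = M x" by (simp add: mat2_eq_iff)
qed

definition explicit_solution ::
    "(real \<Rightarrow> complex) \<Rightarrow> (real \<Rightarrow> complex) \<Rightarrow> (real \<Rightarrow> complex) \<Rightarrow> real \<Rightarrow> complex^2^2" where
  "explicit_solution f g h = (let F = (\<lambda>x. - exp (prim g x) * f x); H = (\<lambda>x. exp (- prim g x) * h x)
     in (\<lambda>x. mat2 (exp (prim g x / 2) * bicosh F H x) (exp (prim g x / 2) * bisinh H F x)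
                  (exp (- prim g x / 2) * bisinh F H x) (exp (- prim g x / 2) * bicosh H F x)))"

text \<open>The exponential factors produce the diagonal terms of the system. Moving them past the
  off-diagonal terms costs the factors exp(Pg) and exp(-Pg), which are built into \<open>F\<close>
  and \<open>H\<close>.\<close>

lemma explicit_solution_column:
  assumes g: "locally_integrable g"
    and F: "F = (\<lambda>x. - exp (prim g x) * f x)" and H: "H = (\<lambda>x. exp (- prim g x) * h x)"
    and d: "AE x in lebesgue. (p has_vector_derivative H x * q x) (at x)"
      "AE x in lebesgue. (q has_vector_derivative F x * p x) (at x)"
  shows "system_solution f g h (\<lambda>x. exp (prim g x / 2) * p x) (\<lambda>x. exp (- prim g x / 2) * q x)"
  unfolding system_solution_def
  using d prim_has_vector_derivative_ae[OF g]
proof eventually_elim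
  case (elim x)
  have e: "((\<lambda>x. exp (c * prim g x)) has_vector_derivative c * g x * exp (c * prim g x)) (at x)" for c
  proof -
    have "((\<lambda>z. exp (c * z)) has_field_derivative c * exp (c * prim g x)) (at (prim g x))"
      by (auto intro!: derivative_eq_intros)
    from field_vector_diff_chain_at[OF elim(3) this] show ?thesis by (simp add: o_def mult_ac)
  qed
  have e1: "((\<lambda>x. exp (prim g x / 2)) has_vector_derivative g x / 2 * exp (prim g x / 2)) (at x)"
    using e[of "1/2"] by simp
  have e2: "((\<lambda>x. exp (- prim g x / 2)) has_vector_derivative - g x / 2 * exp (- prim g x / 2)) (at x)"
    using e[of "-1/2"] by simp
  have h1: "exp (prim g x / 2) * exp (- prim g x) = exp (- prim g x / 2)"
    and h2: "exp (- prim g x / 2) * exp (prim g x) = exp (prim g x / 2)"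
    by (simp_all add: exp_add[symmetric])
  have A: "exp (prim g x / 2) * (H x * q x) = h x * (exp (- prim g x / 2) * q x)"
    unfolding H h1[symmetric] by simp
  have B: "exp (- prim g x / 2) * (F x * p x) = - f x * (exp (prim g x / 2) * p x)"
    unfolding F h2[symmetric] by simp
  show ?case
    using has_vector_derivative_mult[OF e1 elim(1)] has_vector_derivative_mult[OF e2 elim(2)]
    unfolding A B by (simp add: algebra_simps)
qed

lemma
  assumes f: "locally_integrable f" and g: "locally_integrable g" and h: "locally_integrable h"
  shows loc_abs_continuous_explicit_solution: "loc_abs_continuous (explicit_solution f g h)"
    and explicit_solution_0: "explicit_solution f g h 0 = mat 1"
    and matrix_solution_explicit_solution: "matrix_solution f g h (explicit_solution f g h)"
proof -
  define F where "F = (\<lambda>x. - exp (prim g x) * f x)"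
  define H where "H = (\<lambda>x. exp (- prim g x) * h x)"
  have ex: "explicit_solution f g h = (\<lambda>x. mat2 (exp (prim g x / 2) * bicosh F H x) (exp (prim g x / 2) * bisinh H F x)
                  (exp (- prim g x / 2) * bisinh F H x) (exp (- prim g x / 2) * bicosh H F x))"
    unfolding explicit_solution_def F_def H_def Let_def ..
  have Pg: "loc_abs_continuous (\<lambda>x. c * prim g x)" for c
    by (intro loc_abs_continuous_mult loc_abs_continuous_const loc_abs_continuous_prim g)
  have lac_exp: "loc_abs_continuous (\<lambda>x. exp (prim g x))" "loc_abs_continuous (\<lambda>x. exp (- prim g x))"
    "loc_abs_continuous (\<lambda>x. exp (prim g x / 2))" "loc_abs_continuous (\<lambda>x. exp (- prim g x / 2))"
    using loc_abs_continuous_exp[OF Pg, of 1] loc_abs_continuous_exp[OF Pg, of "-1"]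
      loc_abs_continuous_exp[OF Pg, of "1/2"] loc_abs_continuous_exp[OF Pg, of "-1/2"] by simp_all
  have "locally_integrable (\<lambda>x. - (exp (prim g x) * f x))"
    by (intro locally_integrable_uminus locally_integrable_mult lac_exp f)
  then have F: "locally_integrable F" by (simp add: F_def)
  have H: "locally_integrable H"
    unfolding H_def by (intro locally_integrable_mult lac_exp h)
  show "loc_abs_continuous (explicit_solution f g h)"
    unfolding ex by (intro loc_abs_continuous_mat2 loc_abs_continuous_mult lac_exp
        loc_abs_continuous_bicosh loc_abs_continuous_bisinh F H)
  show "explicit_solution f g h 0 = mat 1"
    by (simp add: ex mat2_eq_iff mat_def prim_0 bicosh_0 bisinh_0 F H)
  show "matrix_solution f g h (explicit_solution f g h)"
    unfolding matrix_solution_iff ex mat2_nth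
    by (intro conjI explicit_solution_column[OF g F_def H_def] bicosh_derivative bisinh_derivative F H)
qed

text \<open>As the determinant is 1, the inverse of \<open>M\<close> has rows (d, -b) and (-c, a);
  \<open>g / 2\<close>, \<open>h\<close> and \<open>-f\<close> are three entries of M' times this
  inverse. The fourth is \<open>-g / 2\<close> because differentiating the determinant gives trace
  0.\<close>

lemma
  assumes M: "M \<in> SL2_paths"
  defines "a \<equiv> \<lambda>x. M x $ 1 $ 1" and "b \<equiv> \<lambda>x. M x $ 1 $ 2" and "c \<equiv> \<lambda>x. M x $ 2 $ 1" and "d \<equiv> \<lambda>x. M x $ 2 $ 2"
  defines "f \<equiv> \<lambda>x. c x * vderiv d x - vderiv c x * d x"
    and "g \<equiv> \<lambda>x. 2 * (vderiv a x * d x - vderiv b x * c x)"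
    and "h \<equiv> \<lambda>x. a x * vderiv b x - vderiv a x * b x"
  shows SL2_path_coefficients_integrable: "locally_integrable f" "locally_integrable g" "locally_integrable h"
    and SL2_path_matrix_solution: "matrix_solution f g h M"
proof -
  have lac: "loc_abs_continuous a" "loc_abs_continuous b" "loc_abs_continuous c" "loc_abs_continuous d"
    unfolding a_def b_def c_def d_def by (intro loc_abs_continuous_nth SL2_pathsD(1)[OF M])+
  have det: "a x * d x - b x * c x = 1" for x
    unfolding a_def b_def c_def d_def by (rule SL2_pathsD(2)[OF M])
  note li = locally_integrable_mult[OF _ loc_abs_continuous_derivative(2)]
  have "locally_integrable (\<lambda>x. c x * vderiv d x - d x * vderiv c x)"
    by (intro locally_integrable_diff li lac)
  then show "locally_integrable f" by (simp add: f_def mult.commute)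
  have "locally_integrable (\<lambda>x. 2 * (d x * vderiv a x - c x * vderiv b x))"
    by (intro locally_integrable_cmult locally_integrable_diff li lac)
  then show "locally_integrable g" by (simp add: g_def mult.commute)
  have "locally_integrable (\<lambda>x. a x * vderiv b x - b x * vderiv a x)"
    by (intro locally_integrable_diff li lac)
  then show "locally_integrable h" by (simp add: h_def mult.commute)
  show "matrix_solution f g h M"
    unfolding matrix_solution_iff system_solution_def eventually_conj_iff[symmetric]
    using loc_abs_continuous_derivative(1)[OF lac(1)] loc_abs_continuous_derivative(1)[OF lac(2)]
      loc_abs_continuous_derivative(1)[OF lac(3)] loc_abs_continuous_derivative(1)[OF lac(4)]
  proof eventually_elim
    case (elim x)
    have "((\<lambda>x. a x * d x - b x * c x) has_vector_derivative
        (a x * vderiv d x + vderiv a x * d x - (b x * vderiv c x + vderiv b x * c x))) (at x)"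
      by (intro has_vector_derivative_diff has_vector_derivative_mult elim)
    moreover have "((\<lambda>x. a x * d x - b x * c x) has_vector_derivative 0) (at x)"
      unfolding det by (rule has_vector_derivative_const)
    \<comment> \<open>The trace relation; it is used only for the lower row, where
      \<open>-g / 2\<close> replaces the fourth entry.\<close>
    ultimately have tr: "a x * vderiv d x + vderiv a x * d x - (b x * vderiv c x + vderiv b x * c x) = 0"
      by (rule vector_derivative_unique_at)
    have "g x / 2 * a x + h x * c x = vderiv a x"
      using det[of x] unfolding g_def h_def by (simp, algebra)
    moreover have "g x / 2 * b x + h x * d x = vderiv b x"
      using det[of x] unfolding g_def h_def by (simp, algebra)
    moreover have "- f x * a x - g x / 2 * c x = vderiv c x"
      using det[of x] tr unfolding f_def g_def by (simp, algebra)
    moreover have "- f x * b x - g x / 2 * d x = vderiv d x"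
      using det[of x] tr unfolding f_def g_def by (simp, algebra)
    ultimately show ?case
      using elim by (simp add: a_def b_def c_def d_def)
  qed
qed

section \<open>Solution generators\<close>

text \<open>Reparametrised by \<open>V\<close>, the curve is a Lipschitz image of a subset of the
  real axis. The axis is negligible in the plane, and Lipschitz maps between spaces of equal
  dimension preserve negligible sets; hence the values of \<open>V\<close> are embedded in the
  complex plane.\<close>

lemma negligible_Lipschitz_curve:
  fixes \<gamma> :: "real \<Rightarrow> complex" and V :: "real \<Rightarrow> real"
  assumes lip: "\<And>s t. s \<in> S \<Longrightarrow> t \<in> S \<Longrightarrow> norm (\<gamma> t - \<gamma> s) \<le> K * \<bar>V t - V s\<bar>"
  shows "negligible (\<gamma> ` S)"
proof -
  define T where "T = complex_of_real ` V ` S"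
  \<comment> \<open>The choice is harmless: parameters with equal \<open>V\<close> have equal
    \<open>\<gamma>\<close> by the Lipschitz condition.\<close>
  define \<Gamma> where "\<Gamma> = (\<lambda>w. \<gamma> (SOME s. s \<in> S \<and> complex_of_real (V s) = w))"
  have \<Gamma>: "\<Gamma> (complex_of_real (V s)) = \<gamma> s" if "s \<in> S" for s
  proof -
    let ?t = "SOME t. t \<in> S \<and> complex_of_real (V t) = complex_of_real (V s)"
    have t: "?t \<in> S \<and> complex_of_real (V ?t) = complex_of_real (V s)"
      by (rule someI[of _ s]) (use that in auto)
    then have "norm (\<gamma> ?t - \<gamma> s) \<le> K * \<bar>V ?t - V s\<bar>" using lip[OF that, of ?t] by blast
    then show ?thesis using t by (simp add: \<Gamma>_def)
  qed
  have "negligible T"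
  proof (rule negligible_subset)
    show "negligible {z::complex. \<i> \<bullet> z = 0}" by (rule negligible_hyperplane) auto
    show "T \<subseteq> {z. \<i> \<bullet> z = 0}" by (auto simp: T_def inner_complex_def)
  qed
  then have "negligible (\<Gamma> ` T)"
  proof (rule negligible_locally_Lipschitz_image[rotated])
    fix w assume "w \<in> T"
    then obtain s where s: "s \<in> S" "w = complex_of_real (V s)" by (auto simp: T_def)
    have "norm (\<Gamma> z - \<Gamma> w) \<le> K * norm (z - w)" if z: "z \<in> T" for z
    proof -
      obtain t where t: "t \<in> S" "z = complex_of_real (V t)" using z by (auto simp: T_def)
      have "norm (\<gamma> t - \<gamma> s) \<le> K * norm (complex_of_real (V t - V s))"
        unfolding norm_of_real by (rule lip[OF s(1) t(1)])
      then show ?thesis using s t \<Gamma> by (simp del: norm_of_real)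
    qed
    then show "\<exists>U B. open U \<and> w \<in> U \<and> (\<forall>z\<in>T \<inter> U. norm (\<Gamma> z - \<Gamma> w) \<le> B * norm (z - w))"
      by (intro exI[of _ UNIV] exI[of _ K]) auto
  qed simp
  moreover have "\<Gamma> ` T = \<gamma> ` S" using \<Gamma> by (force simp: T_def image_image)
  ultimately show ?thesis by simp
qed

text \<open>\<open>V\<close> is a primitive of the norm of the derivative; its increments dominate
  those of \<open>y\<close>.\<close>

lemma loc_abs_continuous_norm_increment:
  fixes y :: "real \<Rightarrow> complex"
  assumes y: "loc_abs_continuous y"
  obtains V :: "real \<Rightarrow> real" where "\<And>s t. s \<le> t \<Longrightarrow> norm (y t - y s) \<le> V t - V s"
proof -
  let ?k = "\<lambda>t. complex_of_real (norm (vderiv y t))"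
  have k: "locally_integrable ?k"
    by (intro locally_integrable_norm loc_abs_continuous_derivative(2) y)
  define V where "V = (\<lambda>x. Re (prim ?k x))"
  have "norm (y t - y s) \<le> V t - V s" if st: "s \<le> t" for s t
  proof -
    have V: "((\<lambda>t. norm (vderiv y t)) has_integral (V t - V s)) {s..t}"
      using has_integral_linear[OF prim_diff[OF k st] bounded_linear_Re] by (simp add: o_def V_def)
    have d: "(vderiv y has_integral (y t - y s)) {s..t}" by (rule loc_abs_continuous_derivative(3)[OF y st])
    have "norm (integral {s..t} (vderiv y)) \<le> integral {s..t} (\<lambda>t. norm (vderiv y t))"
      using V d by (intro integral_norm_bound_integral) auto
    then show ?thesis using V d by (simp add: integral_unique)
  qed
  then show ?thesis by (rule that)
qed

text \<open>Zeros of \<open>c\<close> contribute no pole, since \<open>d\<close> does not vanish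
  there. Away from them -d/c is parametrised in countably many pieces, on each of which
  \<open>x\<close> is bounded and \<open>c\<close> is bounded away from 0, so that the quotient is
  Lipschitz in \<open>V\<close>.\<close>

lemma negligible_pole_curve:
  assumes c: "loc_abs_continuous c" and d: "loc_abs_continuous d" and nz: "\<And>x. c x \<noteq> 0 \<or> d x \<noteq> 0"
  shows "negligible {z. \<exists>x. c x * z + d x = (0::complex)}"
proof -
  define S where "S = (\<lambda>n. {x \<in> {- real n..real n}. 1 \<le> real n * norm (c x)})"
  obtain Vc where Vc: "\<And>s t. s \<le> t \<Longrightarrow> norm (c t - c s) \<le> Vc t - Vc s"
    by (rule loc_abs_continuous_norm_increment[OF c]) (rule that)
  obtain Vd where Vd: "\<And>s t. s \<le> t \<Longrightarrow> norm (d t - d s) \<le> Vd t - Vd s"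
    by (rule loc_abs_continuous_norm_increment[OF d]) (rule that)
  define V where "V = (\<lambda>x. Vc x + Vd x)"
  have "negligible ((\<lambda>x. - d x / c x) ` S n)" for n
  proof -
    obtain Bc where Bc: "Bc \<ge> 0" "\<And>x. x \<in> {- real n..real n} \<Longrightarrow> norm (c x) \<le> Bc"
      by (rule loc_abs_continuous_bounded[OF c, of "- real n" "real n"]) blast
    obtain Bd where Bd: "Bd \<ge> 0" "\<And>x. x \<in> {- real n..real n} \<Longrightarrow> norm (d x) \<le> Bd"
      by (rule loc_abs_continuous_bounded[OF d, of "- real n" "real n"]) blast
    \<comment> \<open>The square of \<open>n\<close> bounds the two reciprocals of \<open>c\<close>,
      while \<open>Bc + Bd\<close> bounds the coefficients of the increments in the numerator of the
      difference of quotients.\<close>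
    define K where "K = (real n)\<^sup>2 * (Bc + Bd)"
    have K: "K \<ge> 0" using Bc Bd by (simp add: K_def)
    have ord: "norm (- d t / c t - - d s / c s) \<le> K * (V t - V s)" if s: "s \<in> S n" and t: "t \<in> S n" and st: "s \<le> t" for s t
    proof -
      have inv: "norm (inverse (c x)) \<le> real n" "c x \<noteq> 0" if "x \<in> S n" for x
      proof -
        show cx: "c x \<noteq> 0" using that by (auto simp: S_def)
        have "1 \<le> real n * norm (c x)" using that by (simp add: S_def)
        then show "norm (inverse (c x)) \<le> real n"
          using cx unfolding norm_inverse by (simp add: field_simps)
      qed
      have "- d t / c t - - d s / c s = inverse (c t) * inverse (c s) * (d s * (c t - c s) - c s * (d t - d s))"
        using inv(2)[OF s] inv(2)[OF t] by (simp add: field_simps)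
      then have "norm (- d t / c t - - d s / c s) =
          norm (inverse (c t)) * norm (inverse (c s)) * norm (d s * (c t - c s) - c s * (d t - d s))"
        by (simp add: norm_mult)
      also have "\<dots> \<le> real n * real n * (Bd * norm (c t - c s) + Bc * norm (d t - d s))"
      proof (intro mult_mono inv s t)
        have "norm (d s * (c t - c s) - c s * (d t - d s)) \<le> norm (d s) * norm (c t - c s) + norm (c s) * norm (d t - d s)"
          by (metis norm_mult norm_triangle_ineq4)
        also have "\<dots> \<le> Bd * norm (c t - c s) + Bc * norm (d t - d s)"
          using s Bc(2)[of s] Bd(2)[of s] by (intro add_mono mult_right_mono) (auto simp: S_def)
        finally show "norm (d s * (c t - c s) - c s * (d t - d s)) \<le> Bd * norm (c t - c s) + Bc * norm (d t - d s)" .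
      qed auto
      also have "\<dots> \<le> real n * real n * ((Bc + Bd) * (Vc t - Vc s) + (Bc + Bd) * (Vd t - Vd s))"
        using Bc(1) Bd(1) Vc[OF st] Vd[OF st] by (intro mult_left_mono add_mono mult_mono) auto
      also have "\<dots> = K * (V t - V s)" by (simp add: K_def V_def power2_eq_square algebra_simps)
      finally show ?thesis .
    qed
    show ?thesis
    proof (rule negligible_Lipschitz_curve[of _ _ K V])
      fix s t assume st: "s \<in> S n" "t \<in> S n"
      show "norm (- d t / c t - - d s / c s) \<le> K * \<bar>V t - V s\<bar>"
      proof (cases "s \<le> t")
        case True
        have "K * (V t - V s) \<le> K * \<bar>V t - V s\<bar>" using K by (intro mult_left_mono) auto
        then show ?thesis using ord[OF st True] by linarith
      next
        case False
        then have "t \<le> s" by simp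
        have "K * (V s - V t) \<le> K * \<bar>V t - V s\<bar>" using K by (intro mult_left_mono) auto
        then show ?thesis using ord[OF st(2,1) \<open>t \<le> s\<close>] by (subst norm_minus_commute) linarith
      qed
    qed
  qed
  then have "negligible (\<Union>n. (\<lambda>x. - d x / c x) ` S n)" by blast
  moreover have "{z. \<exists>x. c x * z + d x = 0} \<subseteq> (\<Union>n. (\<lambda>x. - d x / c x) ` S n)"
  proof
    fix z assume "z \<in> {z. \<exists>x. c x * z + d x = 0}"
    then obtain x where x: "c x * z + d x = 0" by blast
    then have cx: "c x \<noteq> 0" using nz[of x] by auto
    obtain n :: nat where n: "max \<bar>x\<bar> (inverse (norm (c x))) \<le> real n"
      using real_arch_simple[of "max \<bar>x\<bar> (inverse (norm (c x)))"] by (elim exE)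
    have "1 \<le> real n * norm (c x)"
      using n cx by (simp add: field_simps)
    then have "x \<in> S n" using n by (auto simp: S_def)
    moreover have "z = - d x / c x" using x cx by (simp add: field_simps eq_neg_iff_add_eq_0)
    ultimately show "z \<in> (\<Union>n. (\<lambda>x. - d x / c x) ` S n)" by blast
  qed
  ultimately show ?thesis by (rule negligible_subset)
qed

section \<open>Equivalence classes of coefficients and quotients of system solutions\<close>

lemma l1loc_rel_refl: "locally_integrable f \<Longrightarrow> l1loc_rel f f"
  by (simp add: l1loc_rel_def)

lemma l1loc_exhaust:
  obtains f where "locally_integrable f" "q = abs_l1loc f"
  using Quotient3_abs_rep[OF Quotient3_l1loc, of q] Quotient3_rep_reflp[OF Quotient3_l1loc, of q]
  by (metis l1loc_rel_def)

lemma abs_l1loc_eqI: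
  assumes "locally_integrable f" "locally_integrable g" "AE x in lebesgue. f x = g x"
  shows "abs_l1loc f = abs_l1loc g"
  using assms by (intro Quotient3_rel_abs[OF Quotient3_l1loc]) (simp add: l1loc_rel_def)

lemma standard_solution_abs:
  assumes "locally_integrable f" "locally_integrable g" "locally_integrable h"
  shows "standard_solution (abs_l1loc f) (abs_l1loc g) (abs_l1loc h) y = riccati_solution f g h y"
  by (intro fun_cong[OF standard_solution.abs_eq] l1loc_rel_refl assms)

text \<open>In the quotient rule, numerator and denominator contribute \<open>g / 2\<close> each to
  the linear coefficient, and the term \<open>-f n\<close> in the derivative of \<open>m\<close>
  becomes the quadratic one.\<close>

lemma riccati_solution_quotient:
  assumes sol: "system_solution f g h n m" and lac: "loc_abs_continuous n" "loc_abs_continuous m"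
    and nz: "\<And>x. m x \<noteq> 0"
  shows "riccati_solution f g h (\<lambda>x. n x / m x)"
  unfolding riccati_solution_def
proof
  show "loc_abs_continuous (\<lambda>x. n x / m x)"
    unfolding divide_inverse by (intro loc_abs_continuous_mult loc_abs_continuous_inverse lac nz)
  show "AE x in lebesgue. ((\<lambda>x. n x / m x) has_vector_derivative f x * (n x / m x)\<^sup>2 + g x * (n x / m x) + h x) (at x)"
    using sol unfolding system_solution_def
  proof eventually_elim
    case (elim x)
    have "((\<lambda>z::complex. inverse z) has_field_derivative - (inverse (m x) ^ Suc (Suc 0))) (at (m x))"
      by (rule DERIV_inverse[OF nz])
    from field_vector_diff_chain_at[OF conjunct2[OF elim] this]
    have "((\<lambda>x. inverse (m x)) has_vector_derivative (- f x * n x - g x / 2 * m x) * - (inverse (m x) ^ Suc (Suc 0))) (at x)"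
      by (simp only: o_def)
    from has_vector_derivative_mult[OF conjunct1[OF elim] this]
    have d: "((\<lambda>x. n x / m x) has_vector_derivative
      (n x * ((- f x * n x - g x / 2 * m x) * - (inverse (m x) ^ Suc (Suc 0))) + (g x / 2 * n x + h x * m x) * inverse (m x))) (at x)"
      by (simp only: divide_inverse)
    have eq: "n x * ((- f x * n x - g x / 2 * m x) * - (inverse (m x) ^ Suc (Suc 0))) + (g x / 2 * n x + h x * m x) * inverse (m x)
        = f x * (n x / m x)\<^sup>2 + g x * (n x / m x) + h x"
      using nz[of x] by (simp add: field_simps power2_eq_square)
    show ?case using d unfolding eq .
  qed
qed

text \<open>Applying \<open>M x\<close> to the vector (z, 1) gives a solution of the system whose
  quotient is the Moebius image of \<open>z\<close>; its denominator has no zero for almost every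
  \<open>z\<close>.\<close>

lemma solution_generator_of_matrix_solution:
  assumes M: "M \<in> SL2_paths" and sol: "matrix_solution f g h M"
    and li: "locally_integrable f" "locally_integrable g" "locally_integrable h"
  shows "solution_generator (abs_l1loc f, abs_l1loc g, abs_l1loc h) (moebius_path M)"
  unfolding solution_generator_def prod.case
proof
  show "moebius_path M \<in> moebius_paths" using M by (simp add: moebius_paths_def)
  let ?n = "\<lambda>z x. M x $ 1 $ 1 * z + M x $ 1 $ 2" and ?m = "\<lambda>z x. M x $ 2 $ 1 * z + M x $ 2 $ 2"
  note lac = loc_abs_continuous_nth[OF SL2_pathsD(1)[OF M]]
  have "M x $ 2 $ 1 \<noteq> 0 \<or> M x $ 2 $ 2 \<noteq> 0" for x
    using SL2_pathsD(2)[OF M, of x] by auto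
  then have "negligible {z. \<exists>x. ?m z x = 0}"
    by (intro negligible_pole_curve lac)
  then have "AE z in lebesgue. \<forall>x. ?m z x \<noteq> 0"
    by (simp add: AE_lebesgue_iff_negligible)
  then show "AE y0 in lebesgue. \<exists>y. (\<forall>x. moebius_path M x (Fin y0) = Fin (y x)) \<and>
      standard_solution (abs_l1loc f) (abs_l1loc g) (abs_l1loc h) y"
  proof (rule eventually_mono)
    fix z assume nz: "\<forall>x. ?m z x \<noteq> 0"
    have "riccati_solution f g h (\<lambda>x. ?n z x / ?m z x)"
    proof (rule riccati_solution_quotient)
      show "system_solution f g h (?n z) (?m z)"
        using sol unfolding matrix_solution_iff
        by (elim conjE) (rule system_solution_linear_combination)
      show "loc_abs_continuous (?n z)" "loc_abs_continuous (?m z)"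
        by (intro loc_abs_continuous_add loc_abs_continuous_mult loc_abs_continuous_const lac)+
    qed (use nz in auto)
    moreover have "moebius_path M x (Fin z) = Fin (?n z x / ?m z x)" for x
      using nz by (simp add: moebius_path_def moebius_def)
    ultimately show "\<exists>y. (\<forall>x. moebius_path M x (Fin z) = Fin (y x)) \<and>
      standard_solution (abs_l1loc f) (abs_l1loc g) (abs_l1loc h) y"
      unfolding standard_solution_abs[OF li]
      by (intro exI[of _ "\<lambda>x. ?n z x / ?m z x"] conjI allI)
  qed
qed

section \<open>A path determines its equation\<close>

lemma quadratic_determined_by_three_values:
  fixes y1 y2 y3 :: complex
  assumes "y1 \<noteq> y2" "y1 \<noteq> y3" "y2 \<noteq> y3"
    and "f * y1\<^sup>2 + g * y1 + h = f' * y1\<^sup>2 + g' * y1 + h'"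
    and "f * y2\<^sup>2 + g * y2 + h = f' * y2\<^sup>2 + g' * y2 + h'"
    and "f * y3\<^sup>2 + g * y3 + h = f' * y3\<^sup>2 + g' * y3 + h'"
  shows "f = f'" "g = g'" "h = h'"
proof -
  have "(y1 - y2) * ((f - f') * (y1 + y2) + (g - g')) = 0" using assms(4,5) by algebra
  then have 1: "(f - f') * (y1 + y2) + (g - g') = 0" using assms(1) by simp
  have "(y1 - y3) * ((f - f') * (y1 + y3) + (g - g')) = 0" using assms(4,6) by algebra
  then have 2: "(f - f') * (y1 + y3) + (g - g') = 0" using assms(2) by simp
  have "(y2 - y3) * (f - f') = 0" using 1 2 by algebra
  then show f: "f = f'" using assms(3) by simp
  show g: "g = g'" using 1 f by simp
  show "h = h'" using assms(4) f g by simp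
qed

lemma sphere_moebius_inj:
  assumes det: "N$1$1 * N$2$2 - N$1$2 * N$2$1 = 1"
    and "sphere_moebius N (Fin z1) = Fin y" "sphere_moebius N (Fin z2) = Fin y"
  shows "z1 = z2"
proof -
  have 1: "N$2$1 * z1 + N$2$2 \<noteq> 0" "y = (N$1$1 * z1 + N$1$2) / (N$2$1 * z1 + N$2$2)"
    using assms(2) by (auto simp: moebius_def split: if_splits)
  have 2: "N$2$1 * z2 + N$2$2 \<noteq> 0" "y = (N$1$1 * z2 + N$1$2) / (N$2$1 * z2 + N$2$2)"
    using assms(3) by (auto simp: moebius_def split: if_splits)
  have "(N$1$1 * z1 + N$1$2) * (N$2$1 * z2 + N$2$2) = (N$1$1 * z2 + N$1$2) * (N$2$1 * z1 + N$2$2)"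
    using 1 2 by (simp add: frac_eq_eq)
  then show ?thesis using det by algebra
qed

lemma AE_three_points:
  assumes "AE z::complex in lebesgue. P z"
  obtains z1 z2 z3 where "z1 \<noteq> z2" "z1 \<noteq> z3" "z2 \<noteq> z3" "P z1" "P z2" "P z3"
proof -
  have neg: "negligible {z. \<not> P z}" using assms by (simp add: AE_lebesgue_iff_negligible)
  have "infinite {z. P z}"
  proof
    assume "finite {z. P z}"
    then have "negligible {z. P z}" by (rule negligible_finite)
    then have "negligible ({z. P z} \<union> {z. \<not> P z})" using neg by (rule negligible_Un)
    moreover have "{z. P z} \<union> {z. \<not> P z} = UNIV" by blast
    ultimately show False by simp
  qed
  then obtain T where T: "T \<subseteq> {z. P z}" "finite T" "card T = 3"
    using infinite_arbitrarily_large by blast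
  then show ?thesis using that by (auto simp: card_3_iff)
qed

text \<open>For almost every initial value the path yields one function solving both equations.
  Three of them equate the two quadratics at three distinct values, for almost every
  \<open>x\<close>.\<close>

lemma solution_generator_determines_equation:
  assumes M: "M \<in> SL2_paths"
    and li: "locally_integrable f" "locally_integrable g" "locally_integrable h"
    and li': "locally_integrable f'" "locally_integrable g'" "locally_integrable h'"
    and gen: "solution_generator (abs_l1loc f, abs_l1loc g, abs_l1loc h) (moebius_path M)"
    and gen': "solution_generator (abs_l1loc f', abs_l1loc g', abs_l1loc h') (moebius_path M)"
  shows "AE x in lebesgue. f x = f' x \<and> g x = g' x \<and> h x = h' x"
proof -
  define Q where "Q = (\<lambda>z y. (\<forall>x. moebius_path M x (Fin z) = Fin (y x)) \<and> riccati_solution f g h y \<and> riccati_solution f' g' h' y)"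
  have "AE z in lebesgue. \<exists>y. Q z y"
    using gen[unfolded solution_generator_def prod.case standard_solution_abs[OF li], THEN conjunct2]
      gen'[unfolded solution_generator_def prod.case standard_solution_abs[OF li'], THEN conjunct2]
  proof eventually_elim
    case (elim z)
    then obtain y y' where y: "\<forall>x. moebius_path M x (Fin z) = Fin (y x)" "riccati_solution f g h y"
      and y': "\<forall>x. moebius_path M x (Fin z) = Fin (y' x)" "riccati_solution f' g' h' y'" by blast
    then have "y = y'" by (simp add: fun_eq_iff)
    then show ?case using y y' unfolding Q_def by blast
  qed
  then obtain z1 z2 z3 where z: "z1 \<noteq> z2" "z1 \<noteq> z3" "z2 \<noteq> z3" "\<exists>y. Q z1 y" "\<exists>y. Q z2 y" "\<exists>y. Q z3 y"
    by (rule AE_three_points)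
  then obtain y1 y2 y3 where y: "Q z1 y1" "Q z2 y2" "Q z3 y3" by blast
  \<comment> \<open>Moebius transformations are injective, so distinct initial values stay distinct
    at every \<open>x\<close>, not merely at almost every one.\<close>
  have neq: "y x \<noteq> y' x" if "Q z y" "Q z' y'" "z \<noteq> z'" for z z' y y' x
    using that sphere_moebius_inj[OF SL2_pathsD(2)[OF M, of x], of z "y x" z']
    by (auto simp: Q_def moebius_path_def)
  have eq: "AE x in lebesgue. f x * (y x)\<^sup>2 + g x * y x + h x = f' x * (y x)\<^sup>2 + g' x * y x + h' x"
    if "Q z y" for z y
  proof -
    have "AE x in lebesgue. (y has_vector_derivative f x * (y x)\<^sup>2 + g x * y x + h x) (at x)"
      "AE x in lebesgue. (y has_vector_derivative f' x * (y x)\<^sup>2 + g' x * y x + h' x) (at x)"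
      using that by (auto simp: Q_def riccati_solution_def)
    then show ?thesis by eventually_elim (rule vector_derivative_unique_at)
  qed
  show ?thesis
    using eq[OF y(1)] eq[OF y(2)] eq[OF y(3)]
  proof eventually_elim
    case (elim x)
    show ?case
      using quadratic_determined_by_three_values[OF neq[OF y(1,2) z(1)] neq[OF y(1,3) z(2)] neq[OF y(2,3) z(3)] elim]
      by blast
  qed
qed

section \<open>Injectivity of the passage from matrix paths to Moebius paths\<close>

text \<open>Agreement at infinity, 0 and 1 already forces the matrices to be proportional; the
  determinants then leave only the factors 1 and -1.\<close>

lemma sphere_moebius_eq_imp:
  assumes M: "M$1$1 * M$2$2 - M$1$2 * M$2$1 = 1" and N: "N$1$1 * N$2$2 - N$1$2 * N$2$1 = 1"
    and eq: "sphere_moebius M = sphere_moebius N"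
  shows "N = M \<or> N = - M"
proof -
  have i: "M$1$1 * N$2$1 = N$1$1 * M$2$1"
    using fun_cong[OF eq, of Infty] by (auto simp: frac_eq_eq split: if_splits)
  have fin: "(M$1$1 * z + M$1$2) * (N$2$1 * z + N$2$2) = (N$1$1 * z + N$1$2) * (M$2$1 * z + M$2$2)" for z
    using fun_cong[OF eq, of "Fin z"] by (auto simp: moebius_def frac_eq_eq split: if_splits)
  have z: "M$1$2 * N$2$2 = N$1$2 * M$2$2" using fin[of 0] by simp
  have o: "(M$1$1 + M$1$2) * (N$2$1 + N$2$2) = (N$1$1 + N$1$2) * (M$2$1 + M$2$2)" using fin[of 1] by simp
  \<comment> \<open>The upper left entry of the inverse of \<open>M\<close> times \<open>N\<close>;
    the next line identifies it with the lower right entry, so the product is scalar.\<close>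
  define k where "k = M$2$2 * N$1$1 - M$1$2 * N$2$1"
  have k: "k = M$1$1 * N$2$2 - M$2$1 * N$1$2" unfolding k_def using i z o by algebra
  have e: "N$1$1 = k * M$1$1" "N$2$1 = k * M$2$1" unfolding k_def using M i by algebra+
  have e': "N$1$2 = k * M$1$2" "N$2$2 = k * M$2$2" unfolding k using M z by algebra+
  have "k\<^sup>2 = 1" using N M unfolding e e' by algebra
  then have "k = 1 \<or> k = -1" by (simp add: power2_eq_1_iff)
  then show ?thesis using e e' by (auto simp: mat2_eq_iff)
qed

text \<open>The pointwise sign ambiguity disappears because a continuous function with finitely many
  values on the connected line is constant, and both paths start at the identity.\<close>

lemma moebius_path_inj: "inj_on moebius_path SL2_paths"
proof (rule inj_onI)
  fix M N assume M: "M \<in> SL2_paths" and N: "N \<in> SL2_paths" and eq: "moebius_path M = moebius_path N"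
  have cases: "N x = M x \<or> N x = - M x" for x
    using sphere_moebius_eq_imp[OF SL2_pathsD(2)[OF M] SL2_pathsD(2)[OF N]] fun_cong[OF eq, of x]
    by (simp add: moebius_path_def)
  \<comment> \<open>\<open>k\<close> is the sign in \<open>N x = \<plusminus> M x\<close>, written as a continuous function of \<open>x\<close>.\<close>
  define k where "k = (\<lambda>x. M x$2$2 * N x$1$1 - M x$1$2 * N x$2$1)"
  have k: "k x = (if N x = M x then 1 else -1)" for x
    using cases[of x] SL2_pathsD(2)[OF M, of x] by (auto simp: k_def algebra_simps)
  have "loc_abs_continuous k"
    unfolding k_def
    by (intro loc_abs_continuous_diff loc_abs_continuous_mult loc_abs_continuous_nth SL2_pathsD(1) M N)
  then have cont: "continuous_on UNIV k" by (rule loc_abs_continuous_imp_continuous)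
  have "k ` UNIV \<subseteq> {1, -1}" using k by auto
  then have fin: "finite (k ` UNIV)" by (rule finite_subset) simp
  have "k constant_on UNIV"
    using continuous_finite_range_constant[OF connected_UNIV cont fin] .
  then obtain r where "\<forall>x\<in>UNIV. k x = r" unfolding constant_on_def by (elim exE)
  then have "k x = k 0" for x by simp
  moreover have "k 0 = 1" using SL2_pathsD(3-6)[OF M] SL2_pathsD(3-6)[OF N] by (simp add: k_def)
  ultimately have "k x = 1" for x by simp
  then have "N x = M x" for x using k[of x] by (metis one_neq_neg_one)
  then show "M = N" by (simp add: fun_eq_iff)
qed

lemma matrix_solution_cong:
  assumes "AE x in lebesgue. f x = f' x \<and> g x = g' x \<and> h x = h' x" and "matrix_solution f' g' h' M"
  shows "matrix_solution f g h M"
  using assms by eventually_elim simp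

section \<open>Generators as matrix solutions, and the Riccati map\<close>

text \<open>The path \<open>M\<close> solves the linear system with the coefficients read off from
  \<open>M\<close>, so it generates solutions for that equation too. As \<open>M\<close> determines
  its equation, those coefficients agree almost everywhere with the given ones.\<close>

lemma solution_generator_iff_matrix_solution:
  assumes M: "M \<in> SL2_paths"
    and li: "locally_integrable f" "locally_integrable g" "locally_integrable h"
  shows "solution_generator (abs_l1loc f, abs_l1loc g, abs_l1loc h) (moebius_path M) \<longleftrightarrow> matrix_solution f g h M"
proof
  assume gen: "solution_generator (abs_l1loc f, abs_l1loc g, abs_l1loc h) (moebius_path M)"
  note li' = SL2_path_coefficients_integrable[OF M] and sol' = SL2_path_matrix_solution[OF M]
  note gen' = solution_generator_of_matrix_solution[OF M sol' li']
  show "matrix_solution f g h M"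
    by (rule matrix_solution_cong[OF solution_generator_determines_equation[OF M li li' gen gen'] sol'])
qed (rule solution_generator_of_matrix_solution[OF M _ li])

lemma explicit_solution_in_SL2_paths:
  assumes "locally_integrable f" "locally_integrable g" "locally_integrable h"
  shows "explicit_solution f g h \<in> SL2_paths"
  using matrix_solution_in_SL2_paths[OF loc_abs_continuous_explicit_solution[OF assms]
      matrix_solution_explicit_solution[OF assms] explicit_solution_0[OF assms]] .

text \<open>Existence and uniqueness of the generator at once: any generator comes from a matrix
  solution, and the initial value problem has only the explicit one.\<close>

lemma solution_generator_iff_explicit_solution:
  assumes li: "locally_integrable f" "locally_integrable g" "locally_integrable h"
  shows "solution_generator (abs_l1loc f, abs_l1loc g, abs_l1loc h) \<phi> \<longleftrightarrow> \<phi> = moebius_path (explicit_solution f g h)"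
proof
  assume gen: "solution_generator (abs_l1loc f, abs_l1loc g, abs_l1loc h) \<phi>"
  then have "\<phi> \<in> moebius_paths" unfolding solution_generator_def by simp
  then obtain M where M: "M \<in> SL2_paths" "\<phi> = moebius_path M" unfolding moebius_paths_def by blast
  then have "matrix_solution f g h M"
    using gen solution_generator_iff_matrix_solution[OF M(1) li] by simp
  then have "M = explicit_solution f g h"
    using M(1) by (intro matrix_solution_unique[OF loc_abs_continuous_explicit_solution[OF li]
      matrix_solution_explicit_solution[OF li] explicit_solution_0[OF li]]) (auto simp: SL2_paths_def)
  then show "\<phi> = moebius_path (explicit_solution f g h)" using M(2) by simp
next
  assume "\<phi> = moebius_path (explicit_solution f g h)"
  then show "solution_generator (abs_l1loc f, abs_l1loc g, abs_l1loc h) \<phi>"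
    using solution_generator_of_matrix_solution[OF explicit_solution_in_SL2_paths[OF li]
        matrix_solution_explicit_solution[OF li] li] by simp
qed

lemma solution_generator_unique: "\<exists>!\<phi>. solution_generator p \<phi>"
proof -
  obtain q1 q2 q3 where p: "p = (q1, q2, q3)" by (cases p)
  obtain f where f: "locally_integrable f" "q1 = abs_l1loc f" by (rule l1loc_exhaust)
  obtain g where g: "locally_integrable g" "q2 = abs_l1loc g" by (rule l1loc_exhaust)
  obtain h where h: "locally_integrable h" "q3 = abs_l1loc h" by (rule l1loc_exhaust)
  show ?thesis
    unfolding p f(2) g(2) h(2) solution_generator_iff_explicit_solution[OF f(1) g(1) h(1)] by simp
qed

lemma solution_generator_riccati_map: "solution_generator p (riccati_map p)"
  unfolding riccati_map_def by (rule theI'[OF solution_generator_unique])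

lemma riccati_map_eqI: "solution_generator p \<phi> \<Longrightarrow> riccati_map p = \<phi>"
  unfolding riccati_map_def by (rule the1_equality[OF solution_generator_unique])

lemma inj_riccati_map: "inj riccati_map"
proof (rule injI)
  fix p p' assume eq: "riccati_map p = riccati_map p'"
  obtain q1 q2 q3 where p: "p = (q1, q2, q3)" by (cases p)
  obtain f where f: "locally_integrable f" "q1 = abs_l1loc f" by (rule l1loc_exhaust)
  obtain g where g: "locally_integrable g" "q2 = abs_l1loc g" by (rule l1loc_exhaust)
  obtain h where h: "locally_integrable h" "q3 = abs_l1loc h" by (rule l1loc_exhaust)
  obtain q1' q2' q3' where p': "p' = (q1', q2', q3')" by (cases p')
  obtain f' where f': "locally_integrable f'" "q1' = abs_l1loc f'" by (rule l1loc_exhaust)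
  obtain g' where g': "locally_integrable g'" "q2' = abs_l1loc g'" by (rule l1loc_exhaust)
  obtain h' where h': "locally_integrable h'" "q3' = abs_l1loc h'" by (rule l1loc_exhaust)
  have gen: "solution_generator p (riccati_map p)" "solution_generator p' (riccati_map p)"
    using solution_generator_riccati_map[of p] solution_generator_riccati_map[of p'] eq by auto
  then have "riccati_map p \<in> moebius_paths" unfolding p solution_generator_def by simp
  then obtain M where M: "M \<in> SL2_paths" "riccati_map p = moebius_path M" unfolding moebius_paths_def by blast
  have "AE x in lebesgue. f x = f' x \<and> g x = g' x \<and> h x = h' x"
    using gen[unfolded M(2)] unfolding p p' f(2) g(2) h(2) f'(2) g'(2) h'(2)
    by (rule solution_generator_determines_equation[OF M(1) f(1) g(1) h(1) f'(1) g'(1) h'(1)])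
  then have ae: "AE x in lebesgue. f x = f' x" "AE x in lebesgue. g x = g' x" "AE x in lebesgue. h x = h' x"
    by (auto elim: eventually_mono)
  show "p = p'"
    unfolding p p' f(2) g(2) h(2) f'(2) g'(2) h'(2)
    using abs_l1loc_eqI[OF f(1) f'(1) ae(1)] abs_l1loc_eqI[OF g(1) g'(1) ae(2)] abs_l1loc_eqI[OF h(1) h'(1) ae(3)]
    by simp
qed

lemma bij_riccati_map: "bij_betw riccati_map UNIV moebius_paths"
  unfolding bij_betw_def
proof
  show "range riccati_map = moebius_paths"
  proof
    show "range riccati_map \<subseteq> moebius_paths"
      using solution_generator_riccati_map by (auto simp: solution_generator_def split: prod.splits)
    show "moebius_paths \<subseteq> range riccati_map"
    proof
      fix \<phi> assume "\<phi> \<in> moebius_paths"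
      then obtain M where M: "M \<in> SL2_paths" "\<phi> = moebius_path M" unfolding moebius_paths_def by blast
      note eq = riccati_map_eqI[OF solution_generator_of_matrix_solution[OF M(1) SL2_path_matrix_solution[OF M(1)]
            SL2_path_coefficients_integrable[OF M(1)]]]
      show "\<phi> \<in> range riccati_map" unfolding M(2) by (rule range_eqI[where f=riccati_map, OF eq[symmetric]])
    qed
  qed
qed (rule inj_riccati_map)

theorem mainTheorem4:
  shows
   "(\<forall>p. \<exists>!\<phi>. solution_generator p \<phi>) \<and>
    bij_betw riccati_map UNIV moebius_paths \<and>
    (\<forall>f g h. locally_integrable f \<and> locally_integrable g \<and> locally_integrable h \<longrightarrow>
      (let F = (\<lambda>x. - exp (prim g x) * f x);
           H = (\<lambda>x. exp (- prim g x) * h x);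
           M = (\<lambda>x. mat2 (exp (prim g x / 2) * bicosh F H x) (exp (prim g x / 2) * bisinh H F x)
                          (exp (- prim g x / 2) * bisinh F H x) (exp (- prim g x / 2) * bicosh H F x));
           solves = (\<lambda>N. AE x in lebesgue.
             (N has_vector_derivative mat2 (g x / 2) (h x) (- f x) (- g x / 2) ** N x) (at x))
       in M \<in> SL2_paths \<and> solves M \<and>
          (\<forall>N. loc_abs_continuous N \<and> solves N \<and> N 0 = mat 1 \<longrightarrow> N = M) \<and>
          riccati_map (abs_l1loc f, abs_l1loc g, abs_l1loc h) = moebius_path M)) \<and>
    (\<forall>\<phi>\<in>moebius_paths. \<exists>!M. M \<in> SL2_paths \<and> \<phi> = moebius_path M) \<and>
    (\<forall>M\<in>SL2_paths.
      (let a = (\<lambda>x. M x $ 1 $ 1); b = (\<lambda>x. M x $ 1 $ 2);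
           c = (\<lambda>x. M x $ 2 $ 1); d = (\<lambda>x. M x $ 2 $ 2);
           D = (\<lambda>u x. vector_derivative u (at x));
           f = (\<lambda>x. c x * D d x - D c x * d x);
           g = (\<lambda>x. 2 * (D a x * d x - D b x * c x));
           h = (\<lambda>x. a x * D b x - D a x * b x)
       in locally_integrable f \<and> locally_integrable g \<and> locally_integrable h \<and>
          inv riccati_map (moebius_path M) = (abs_l1loc f, abs_l1loc g, abs_l1loc h)))"
proof (intro conjI)
  show "\<forall>p. \<exists>!\<phi>. solution_generator p \<phi>" using solution_generator_unique by blast
  show "bij_betw riccati_map UNIV moebius_paths" by (rule bij_riccati_map)
  show "\<forall>\<phi>\<in>moebius_paths. \<exists>!M. M \<in> SL2_paths \<and> \<phi> = moebius_path M"
  proof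
    fix \<phi> assume "\<phi> \<in> moebius_paths"
    then obtain M where "M \<in> SL2_paths" "\<phi> = moebius_path M" unfolding moebius_paths_def by blast
    then show "\<exists>!M. M \<in> SL2_paths \<and> \<phi> = moebius_path M"
      using moebius_path_inj by (intro ex1I[of _ M]) (auto dest: inj_onD)
  qed
next
  \<comment> \<open>Stated with the named \<open>explicit_solution\<close>; unfolding its
    \<open>let\<close> definition gives the literal matrix of the goal.\<close>
  have main: "explicit_solution f g h \<in> SL2_paths \<and> matrix_solution f g h (explicit_solution f g h) \<and>
      (\<forall>N. loc_abs_continuous N \<and> matrix_solution f g h N \<and> N 0 = mat 1 \<longrightarrow> N = explicit_solution f g h) \<and>
      riccati_map (abs_l1loc f, abs_l1loc g, abs_l1loc h) = moebius_path (explicit_solution f g h)"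
    if li: "locally_integrable f" "locally_integrable g" "locally_integrable h" for f g h
  proof (intro conjI allI impI)
    show "explicit_solution f g h \<in> SL2_paths" by (rule explicit_solution_in_SL2_paths[OF li])
    show sol: "matrix_solution f g h (explicit_solution f g h)" by (rule matrix_solution_explicit_solution[OF li])
    show "N = explicit_solution f g h" if N: "loc_abs_continuous N \<and> matrix_solution f g h N \<and> N 0 = mat 1" for N
      using N by (intro matrix_solution_unique[OF loc_abs_continuous_explicit_solution[OF li] sol explicit_solution_0[OF li]]) auto
    show "riccati_map (abs_l1loc f, abs_l1loc g, abs_l1loc h) = moebius_path (explicit_solution f g h)"
      by (rule riccati_map_eqI) (simp add: solution_generator_iff_explicit_solution[OF li])
  qed
  show "\<forall>f g h. locally_integrable f \<and> locally_integrable g \<and> locally_integrable h \<longrightarrow>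
      (let F = (\<lambda>x. - exp (prim g x) * f x);
           H = (\<lambda>x. exp (- prim g x) * h x);
           M = (\<lambda>x. mat2 (exp (prim g x / 2) * bicosh F H x) (exp (prim g x / 2) * bisinh H F x)
                          (exp (- prim g x / 2) * bisinh F H x) (exp (- prim g x / 2) * bicosh H F x));
           solves = (\<lambda>N. AE x in lebesgue.
             (N has_vector_derivative mat2 (g x / 2) (h x) (- f x) (- g x / 2) ** N x) (at x))
       in M \<in> SL2_paths \<and> solves M \<and>
          (\<forall>N. loc_abs_continuous N \<and> solves N \<and> N 0 = mat 1 \<longrightarrow> N = M) \<and>
          riccati_map (abs_l1loc f, abs_l1loc g, abs_l1loc h) = moebius_path M)"
    unfolding Let_def
    by (intro allI impI, elim conjE, rule main[unfolded explicit_solution_def Let_def])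
next
  show "\<forall>M\<in>SL2_paths.
      (let a = (\<lambda>x. M x $ 1 $ 1); b = (\<lambda>x. M x $ 1 $ 2);
           c = (\<lambda>x. M x $ 2 $ 1); d = (\<lambda>x. M x $ 2 $ 2);
           D = (\<lambda>u x. vector_derivative u (at x));
           f = (\<lambda>x. c x * D d x - D c x * d x);
           g = (\<lambda>x. 2 * (D a x * d x - D b x * c x));
           h = (\<lambda>x. a x * D b x - D a x * b x)
       in locally_integrable f \<and> locally_integrable g \<and> locally_integrable h \<and>
          inv riccati_map (moebius_path M) = (abs_l1loc f, abs_l1loc g, abs_l1loc h))"
    unfolding Let_def
  proof (intro ballI conjI)
    fix M assume M: "M \<in> SL2_paths"
    note li = SL2_path_coefficients_integrable[OF M]
    note eq = riccati_map_eqI[OF solution_generator_of_matrix_solution[OF M SL2_path_matrix_solution[OF M] li]]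
    show "locally_integrable (\<lambda>x. M x $ 2 $ 1 * vderiv (\<lambda>x. M x $ 2 $ 2) x - vderiv (\<lambda>x. M x $ 2 $ 1) x * M x $ 2 $ 2)"
      "locally_integrable (\<lambda>x. 2 * (vderiv (\<lambda>x. M x $ 1 $ 1) x * M x $ 2 $ 2 - vderiv (\<lambda>x. M x $ 1 $ 2) x * M x $ 2 $ 1))"
      "locally_integrable (\<lambda>x. M x $ 1 $ 1 * vderiv (\<lambda>x. M x $ 1 $ 2) x - vderiv (\<lambda>x. M x $ 1 $ 1) x * M x $ 1 $ 2)"
      by (rule li)+
    show "inv riccati_map (moebius_path M) =
      (abs_l1loc (\<lambda>x. M x $ 2 $ 1 * vderiv (\<lambda>x. M x $ 2 $ 2) x - vderiv (\<lambda>x. M x $ 2 $ 1) x * M x $ 2 $ 2),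
       abs_l1loc (\<lambda>x. 2 * (vderiv (\<lambda>x. M x $ 1 $ 1) x * M x $ 2 $ 2 - vderiv (\<lambda>x. M x $ 1 $ 2) x * M x $ 2 $ 1)),
       abs_l1loc (\<lambda>x. M x $ 1 $ 1 * vderiv (\<lambda>x. M x $ 1 $ 2) x - vderiv (\<lambda>x. M x $ 1 $ 1) x * M x $ 1 $ 2))"
      by (rule inv_f_eq[where f=riccati_map, OF inj_riccati_map eq])
  qed
qed

end
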